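(* Let $M$ be a smooth manifold and let $k\ge1$ be an integer. Every smooth family of $k$-jets of curves on $M$ (that is, every smooth assignment to each $x\in M$ of the $k$-jet at $0$ of a curve $\gamma_x$ in $M$ with $\gamma_x(0)=x$) is defined by a unique list of $k$ smooth vector fields $A_1,\dots,A_k$ on $M$ according to the formula $$\gamma_x(t)=\Phi^{t^k}_{A_k}\Big(\Phi^{t^{k-1}}_{A_{k-1}}\big(\cdots\big(\Phi^{t}_{A_1}(x)\big)\cdots\big)\Big),$$ in the sense that for every $x\in M$ the given $k$-jet at $x$ equals the $k$-jet at $t=0$ of the curve on the right-hand side.
   Context: Two smooth curves $\gamma,\tilde\gamma$ in $M$ with $\gamma(0)=\tilde\gamma(0)$ have the same $k$-jet at $0$ if in one (equivalently every) coordinate chart their Taylor expansions at $t=0$ agree up to and including order $t^k$. A family of $k$-jets $x\mapsto j_k(\gamma_x)$ with $\gamma_x(0)=x$ is smooth if in each chart it is represented by curves $x+\sum_{i=1}^k a_i(x)t^i$ with smooth coefficient functions $a_i$; equivalently it is a smooth section of the bundle of $k$-jets of curves. For a vector field $A$, $\Phi^s_A$ denotes the (local) flow of $A$ at time $s$; in the formula $t^i$ denotes the $i$-th power of $t$, so $\Phi_{A_i}^{t^i}$ is the flow of $A_i$ for time $t^i$, and the formula is used for $t$ in a neighbourhood of $0$ (depending on $x$). *)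

theory Defs
  imports "HOL-Analysis.Analysis"
begin

text \<open>
  Manifolds are modelled on a type of sort \<open>{real_inner, heine_borel}\<close>. By the following lemma
  such types satisfy the axioms of \<open>euclidean_space\<close> except that the basis may be empty, so that
  they are the Euclidean spaces of arbitrary finite dimension, including dimension \<open>0\<close>. All types
  of class \<open>euclidean_space\<close> are of this sort.
\<close>

lemma finite_orthonormal_basis:
  "\<exists>B :: 'b::{real_inner, heine_borel} set.
     finite B \<and> (\<forall>u\<in>B. \<forall>v\<in>B. u \<bullet> v = (if u = v then 1 else 0)) \<and>
     (\<forall>x. (\<forall>u\<in>B. x \<bullet> u = 0) \<longleftrightarrow> x = 0)"
proof -
  define ON where "ON = {B :: 'b set. \<forall>u\<in>B. \<forall>v\<in>B. u \<bullet> v = (if u = v then 1 else 0)}"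
  have "{} \<in> ON"
    by (simp add: ON_def)
  have "\<exists>M\<in>ON. \<forall>B\<in>ON. M \<subseteq> B \<longrightarrow> B = M"
  proof (rule subset_Zorn_nonempty)
    show "ON \<noteq> {}"
      using \<open>{} \<in> ON\<close> by blast
    fix C
    assume C: "C \<noteq> {}" "subset.chain ON C"
    show "\<Union>C \<in> ON"
      unfolding ON_def
    proof (intro CollectI ballI)
      fix u v
      assume "u \<in> \<Union>C" "v \<in> \<Union>C"
      then obtain D where "D \<in> C" "u \<in> D" "v \<in> D"
        using C(2) unfolding subset_chain_def by blast
      then show "u \<bullet> v = (if u = v then 1 else 0)"
        using C(2) unfolding subset_chain_def ON_def by blast
    qed
  qed
  then obtain B where B: "B \<in> ON" and max: "\<And>D. D \<in> ON \<Longrightarrow> B \<subseteq> D \<Longrightarrow> D = B"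
    by blast
  have on: "\<And>u v. u \<in> B \<Longrightarrow> v \<in> B \<Longrightarrow> u \<bullet> v = (if u = v then 1 else 0)"
    using B by (simp add: ON_def)
  have "finite B"
  proof (rule ccontr)
    assume "infinite B"
    then obtain f :: "nat \<Rightarrow> 'b" where f: "inj f" "range f \<subseteq> B"
      using infinite_countable_subset by blast
    have "norm (f n) = 1" for n
      using on[of "f n" "f n"] f(2) by (auto simp: norm_eq_1)
    then have "bounded (range f)"
      by (auto simp: bounded_iff)
    then obtain l r where r: "strict_mono (r :: nat \<Rightarrow> nat)" "(f \<circ> r) \<longlonglongrightarrow> l"
      using bounded_imp_convergent_subsequence by blast
    then have "Cauchy (f \<circ> r)"
      by (auto intro: LIMSEQ_imp_Cauchy)
    then obtain N where N: "\<And>m n. m \<ge> N \<Longrightarrow> n \<ge> N \<Longrightarrow> dist (f (r m)) (f (r n)) < 1"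
      unfolding Cauchy_def by (metis comp_apply zero_less_one)
    have ne: "f (r N) \<noteq> f (r (Suc N))"
      using f(1) r(1) by (metis injD n_not_Suc_n strict_mono_eq)
    have mem: "f (r N) \<in> B" "f (r (Suc N)) \<in> B"
      using f(2) by auto
    have "(norm (f (r N) - f (r (Suc N))))\<^sup>2 = 2"
      using ne mem by (simp add: power2_norm_eq_inner inner_diff_left inner_diff_right on)
    moreover have "(norm (f (r N) - f (r (Suc N))))\<^sup>2 < 1"
      using N[of N "Suc N"] by (simp add: dist_norm power_less_one_iff)
    ultimately show False
      by simp
  qed
  moreover have "x = 0" if x: "\<forall>u\<in>B. x \<bullet> u = 0" for x
  proof (rule ccontr)
    assume "x \<noteq> 0"
    define y where "y = x /\<^sub>R norm x"
    have "y \<bullet> y = 1"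
      using \<open>x \<noteq> 0\<close> by (simp add: y_def dot_square_norm power2_eq_square)
    have orth: "\<forall>u\<in>B. y \<bullet> u = 0 \<and> u \<bullet> y = 0"
      using x by (simp add: y_def inner_commute)
    have "insert y B \<in> ON"
      using on orth \<open>y \<bullet> y = 1\<close> by (auto simp: ON_def)
    then have "y \<in> B"
      using max[of "insert y B"] by blast
    then show False
      using orth \<open>y \<bullet> y = 1\<close> by auto
  qed
  ultimately show ?thesis
    using on by (intro exI[of _ B]) auto
qed


section \<open>Smooth maps\<close>

text \<open>Only meant for open sets \<open>S\<close>; the codomain and domain are finite-dimensional in all uses, so
  continuity of all directional derivatives is continuity of the derivative.\<close>

primrec Ck_on :: "nat \<Rightarrow> 'c::real_normed_vector set \<Rightarrow> ('c \<Rightarrow> 'd::real_normed_vector) \<Rightarrow> bool" where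
  "Ck_on 0 S f \<longleftrightarrow> continuous_on S f"
| "Ck_on (Suc n) S f \<longleftrightarrow>
     (\<forall>x\<in>S. f differentiable (at x)) \<and> (\<forall>v. Ck_on n S (\<lambda>x. frechet_derivative f (at x) v))"

definition smooth_on :: "'c::real_normed_vector set \<Rightarrow> ('c \<Rightarrow> 'd::real_normed_vector) \<Rightarrow> bool" where
  "smooth_on S f \<longleftrightarrow> (\<forall>n. Ck_on n S f)"


section \<open>Smooth manifolds\<close>

text \<open>A chart is a pair \<open>(U, \<phi>)\<close>; the values of \<open>\<phi>\<close> outside of \<open>U\<close> are irrelevant. The atlas is not
  required to be maximal: smoothness with respect to all charts of an atlas is the same as
  smoothness with respect to all charts of the maximal atlas it generates.\<close>

type_synonym ('a, 'b) chart = "'a set \<times> ('a \<Rightarrow> 'b)"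

definition smooth_atlas ::
    "'a topology \<Rightarrow> ('a, 'b::{real_inner, heine_borel}) chart set \<Rightarrow> bool" where
  "smooth_atlas X \<A> \<longleftrightarrow>
     (\<forall>(U, \<phi>)\<in>\<A>. openin X U \<and> open (\<phi> ` U) \<and>
        homeomorphic_map (subtopology X U) (top_of_set (\<phi> ` U)) \<phi>) \<and>
     (\<Union>(U, \<phi>)\<in>\<A>. U) = topspace X \<and>
     (\<forall>(U, \<phi>)\<in>\<A>. \<forall>(V, \<psi>)\<in>\<A>. smooth_on (\<phi> ` (U \<inter> V)) (\<psi> \<circ> inv_into U \<phi>))"

definition smooth_manifold ::
    "'a topology \<Rightarrow> ('a, 'b::{real_inner, heine_borel}) chart set \<Rightarrow> bool" where
  "smooth_manifold X \<A> \<longleftrightarrow> Hausdorff_space X \<and> second_countable X \<and> smooth_atlas X \<A>"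


section \<open>Curves and jets\<close>

text \<open>\<open>I\<close> is meant to be an open set of parameters.\<close>

definition smooth_curve_on ::
    "'a topology \<Rightarrow> ('a, 'b::{real_inner, heine_borel}) chart set \<Rightarrow> real set \<Rightarrow> (real \<Rightarrow> 'a) \<Rightarrow> bool"
  where
  "smooth_curve_on X \<A> I \<gamma> \<longleftrightarrow>
     continuous_map (top_of_set I) X \<gamma> \<and>
     (\<forall>(U, \<phi>)\<in>\<A>. smooth_on {t\<in>I. \<gamma> t \<in> U} (\<phi> \<circ> \<gamma>))"

definition smooth_curve_near_0 ::
    "'a topology \<Rightarrow> ('a, 'b::{real_inner, heine_borel}) chart set \<Rightarrow> (real \<Rightarrow> 'a) \<Rightarrow> bool" where
  "smooth_curve_near_0 X \<A> \<gamma> \<longleftrightarrow> (\<exists>\<epsilon>>0. smooth_curve_on X \<A> {-\<epsilon><..<\<epsilon>} \<gamma>)"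

definition taylor_coeff :: "nat \<Rightarrow> (real \<Rightarrow> 'b::real_normed_vector) \<Rightarrow> 'b" where
  "taylor_coeff i f = ((\<lambda>g t. vector_derivative g (at t)) ^^ i) f 0 /\<^sub>R fact i"

definition same_kjet ::
    "('a, 'b::{real_inner, heine_borel}) chart set \<Rightarrow> nat \<Rightarrow> (real \<Rightarrow> 'a) \<Rightarrow> (real \<Rightarrow> 'a) \<Rightarrow> bool" where
  "same_kjet \<A> k \<gamma> \<gamma>' \<longleftrightarrow> \<gamma> 0 = \<gamma>' 0 \<and>
     (\<forall>(U, \<phi>)\<in>\<A>. \<gamma> 0 \<in> U \<longrightarrow>
        (\<forall>i\<le>k. taylor_coeff i (\<phi> \<circ> \<gamma>) = taylor_coeff i (\<phi> \<circ> \<gamma>')))"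

text \<open>The \<open>k\<close>-jet at \<open>0\<close> of a curve that is smooth near \<open>0\<close>, as an equivalence class of such curves.
  A curve is represented by a total function whose values away from \<open>0\<close> are irrelevant.\<close>

definition kjet ::
    "'a topology \<Rightarrow> ('a, 'b::{real_inner, heine_borel}) chart set \<Rightarrow> nat \<Rightarrow> (real \<Rightarrow> 'a) \<Rightarrow>
      (real \<Rightarrow> 'a) set" where
  "kjet X \<A> k \<gamma> = {\<gamma>'. smooth_curve_near_0 X \<A> \<gamma>' \<and> same_kjet \<A> k \<gamma> \<gamma>'}"

definition smooth_kjet_family ::
    "'a topology \<Rightarrow> ('a, 'b::{real_inner, heine_borel}) chart set \<Rightarrow> nat \<Rightarrow>
      ('a \<Rightarrow> (real \<Rightarrow> 'a) set) \<Rightarrow> bool" where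
  "smooth_kjet_family X \<A> k J \<longleftrightarrow>
     (\<forall>x\<in>topspace X. \<exists>\<gamma>. smooth_curve_near_0 X \<A> \<gamma> \<and> \<gamma> 0 = x \<and> J x = kjet X \<A> k \<gamma>) \<and>
     (\<forall>(U, \<phi>)\<in>\<A>. \<exists>a :: nat \<Rightarrow> 'b \<Rightarrow> 'b.
        (\<forall>i\<in>{1..k}. smooth_on (\<phi> ` U) (a i)) \<and>
        (\<forall>x\<in>U. J x = kjet X \<A> k (\<lambda>t. inv_into U \<phi> (\<phi> x + (\<Sum>i=1..k. t ^ i *\<^sub>R a i (\<phi> x))))))"


section \<open>Vector fields and flows\<close>

text \<open>A tangent vector at \<open>x\<close> is an equivalence class of curves through \<open>x\<close> with the same
  velocity, that is, a \<open>1\<close>-jet. Vector fields are made extensional so that two of them that agree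
  on the manifold are equal.\<close>

definition smooth_vector_field ::
    "'a topology \<Rightarrow> ('a, 'b::{real_inner, heine_borel}) chart set \<Rightarrow>
      ('a \<Rightarrow> (real \<Rightarrow> 'a) set) \<Rightarrow> bool" where
  "smooth_vector_field X \<A> A \<longleftrightarrow> A \<in> extensional (topspace X) \<and> smooth_kjet_family X \<A> 1 A"

definition velocity ::
    "'a topology \<Rightarrow> ('a, 'b::{real_inner, heine_borel}) chart set \<Rightarrow> (real \<Rightarrow> 'a) \<Rightarrow> real \<Rightarrow>
      (real \<Rightarrow> 'a) set" where
  "velocity X \<A> c t = kjet X \<A> 1 (\<lambda>s. c (t + s))"

definition integral_curve ::
    "'a topology \<Rightarrow> ('a, 'b::{real_inner, heine_borel}) chart set \<Rightarrow> ('a \<Rightarrow> (real \<Rightarrow> 'a) set) \<Rightarrow>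
      real set \<Rightarrow> (real \<Rightarrow> 'a) \<Rightarrow> bool" where
  "integral_curve X \<A> A I c \<longleftrightarrow>
     open I \<and> is_interval I \<and> smooth_curve_on X \<A> I c \<and> (\<forall>t\<in>I. velocity X \<A> c t = A (c t))"

definition flow_reaches ::
    "'a topology \<Rightarrow> ('a, 'b::{real_inner, heine_borel}) chart set \<Rightarrow> ('a \<Rightarrow> (real \<Rightarrow> 'a) set) \<Rightarrow>
      real \<Rightarrow> 'a \<Rightarrow> 'a \<Rightarrow> bool" where
  "flow_reaches X \<A> A s x y \<longleftrightarrow>
     (\<exists>I c. integral_curve X \<A> A I c \<and> 0 \<in> I \<and> s \<in> I \<and> c 0 = x \<and> c s = y)"

text \<open>For a smooth vector field on a manifold, \<open>y\<close> is unique if it exists.\<close>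

definition flow ::
    "'a topology \<Rightarrow> ('a, 'b::{real_inner, heine_borel}) chart set \<Rightarrow> ('a \<Rightarrow> (real \<Rightarrow> 'a) set) \<Rightarrow>
      real \<Rightarrow> 'a \<Rightarrow> 'a" where
  "flow X \<A> A s x = (THE y. flow_reaches X \<A> A s x y)"

definition flow_defined ::
    "'a topology \<Rightarrow> ('a, 'b::{real_inner, heine_borel}) chart set \<Rightarrow> ('a \<Rightarrow> (real \<Rightarrow> 'a) set) \<Rightarrow>
      real \<Rightarrow> 'a \<Rightarrow> bool" where
  "flow_defined X \<A> A s x \<longleftrightarrow> (\<exists>y. flow_reaches X \<A> A s x y)"

text \<open>The list \<open>As\<close> is \<open>[A\<^sub>1, \<dots>, A\<^sub>k]\<close>, hence \<open>A\<^sub>i\<close> is \<open>As ! (i - 1)\<close>; the flow of \<open>A\<^sub>1\<close> is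
  applied first.\<close>

definition flow_composite ::
    "'a topology \<Rightarrow> ('a, 'b::{real_inner, heine_borel}) chart set \<Rightarrow>
      ('a \<Rightarrow> (real \<Rightarrow> 'a) set) list \<Rightarrow> real \<Rightarrow> 'a \<Rightarrow> 'a" where
  "flow_composite X \<A> As t x =
     fold (\<lambda>i. flow X \<A> (As ! (i - 1)) (t ^ i)) [1..<Suc (length As)] x"

definition flow_composite_defined ::
    "'a topology \<Rightarrow> ('a, 'b::{real_inner, heine_borel}) chart set \<Rightarrow>
      ('a \<Rightarrow> (real \<Rightarrow> 'a) set) list \<Rightarrow> real \<Rightarrow> 'a \<Rightarrow> bool" where
  "flow_composite_defined X \<A> As t x \<longleftrightarrow>
     (\<forall>i\<in>{1..length As}.
        flow_defined X \<A> (As ! (i - 1)) (t ^ i) (flow_composite X \<A> (take (i - 1) As) t x))"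

end

theory Submission
  imports Defs
begin

text \<open>
  If two curves agree to order \<open>t ^ (j - 1)\<close> in some chart, the coefficient of \<open>t ^ j\<close> in their
  difference transforms like a tangent vector. Composing \<open>c\<close> with the flow of \<open>A\<^sub>j\<close> for time \<open>t ^ j\<close>
  changes \<open>c\<close> by \<open>t ^ j A\<^sub>j (c 0) + o(t ^ j)\<close>. So \<open>A\<^sub>j\<close> is forced to be the leading
  difference between the given jet and the composite of the first \<open>j - 1\<close> flows, later flows do not
  disturb the orders already matched, and induction on \<open>j\<close> gives existence and uniqueness.

  The analytic input is that flows are smooth in time and initial point. If \<open>u (y, s)\<close>
  solves \<open>u' = G (y, s, u)\<close>, then its derivative in \<open>y\<close> solves the variational equation, which is again
  an equation of this form on the same space with a right-hand side of one class less; hence a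
  single induction on the order of differentiability, over all right-hand sides \<open>G\<close>, suffices.
\<close>

section \<open>Differentiability of finite order\<close>

text \<open>The sort of the model space entails neither \<open>euclidean_space\<close> nor
  \<open>banach\<close>, and its dimension may be 0, so directions, linear maps and integrals are
  handled through one fixed, possibly empty orthonormal basis. \<open>Ck_on\<close> controls
  derivatives only in fixed directions; a varying direction is expanded in that basis. Jets are
  compared by remainders \<open>o(t ^ k)\<close>, called \<open>flat\<close>, instead of iterated
  derivatives. Substituting the time \<open>t ^ j\<close> into a flow, changing the chart and
  truncating are then first-order estimates, and no higher chain rule occurs. Taylor coefficients
  remain in the definition of a jet and in \<open>leading\<close>, where smoothness in the base
  point is needed. Estimates for differential equations use short intervals,
  \<open>K * d \<le> 1/2\<close>, in place of exponentials. This survives the induction on the order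
  because the variational equation has the same Lipschitz constant \<open>K\<close> in the state.
  The time interval of the conclusion does not shrink with the order either, so one neighbourhood
  serves all orders at once.\<close>

definition onb :: "'b::{real_inner, heine_borel} set" where
  "onb = (SOME B. finite B \<and> (\<forall>u\<in>B. \<forall>v\<in>B. u \<bullet> v = (if u = v then 1 else 0)) \<and>
     (\<forall>x. (\<forall>u\<in>B. x \<bullet> u = 0) \<longleftrightarrow> x = 0))"

lemma
  fixes u v x :: "'b::{real_inner, heine_borel}"
  shows finite_onb: "finite (onb :: 'b set)"
    and inner_onb: "u \<in> onb \<Longrightarrow> v \<in> onb \<Longrightarrow> u \<bullet> v = (if u = v then 1 else 0)"
    and onb_eq_0: "(\<And>u. u \<in> onb \<Longrightarrow> x \<bullet> u = 0) \<Longrightarrow> x = 0"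
  using someI_ex[OF finite_orthonormal_basis[where 'b = 'b], folded onb_def] by blast+

lemma norm_onb: "e \<in> onb \<Longrightarrow> norm e = 1"
  by (simp add: norm_eq_1 inner_onb)

lemma onb_expand: "(\<Sum>e\<in>onb. (x \<bullet> e) *\<^sub>R e) = x"
proof -
  have "x - (\<Sum>e\<in>onb. (x \<bullet> e) *\<^sub>R e) = 0"
  proof (rule onb_eq_0)
    fix u :: 'a assume u: "u \<in> onb"
    have "(\<Sum>e\<in>onb. (x \<bullet> e) *\<^sub>R e) \<bullet> u = (\<Sum>e\<in>onb. if e = u then x \<bullet> u else 0)"
      unfolding inner_sum_left by (rule sum.cong) (auto simp: inner_onb u)
    then show "(x - (\<Sum>e\<in>onb. (x \<bullet> e) *\<^sub>R e)) \<bullet> u = 0"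
      by (simp add: inner_diff_left finite_onb u)
  qed
  then show ?thesis by simp
qed

lemma linear_onb_expand: "linear f \<Longrightarrow> (\<Sum>e\<in>onb. (x \<bullet> e) *\<^sub>R f e) = f x"
  using linear_sum[of f "\<lambda>e. (x \<bullet> e) *\<^sub>R e" onb] by (simp add: onb_expand linear_scale)

section \<open>Calculus of maps of finite order on open sets\<close>

lemma Ck_on_cong_imp:
  assumes "Ck_on n S f" "open S" "\<And>x. x \<in> S \<Longrightarrow> f x = g x"
  shows "Ck_on n S g"
  using assms(1,3)
proof (induction n arbitrary: f g)
  case 0
  then show ?case using continuous_on_cong by force
next
  case (Suc n)
  \<comment> \<open>Openness of \<open>S\<close> makes \<open>f\<close> and \<open>g\<close> agree
    near \<open>x\<close>, so values off \<open>S\<close> cannot affect the derivative.\<close>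
  have d: "(g has_derivative frechet_derivative f (at x)) (at x)" if "x \<in> S" for x
    using that Suc.prems assms(2)
    by (auto simp: frechet_derivative_works[of f] intro: has_derivative_transform_within_open)
  have e: "frechet_derivative g (at x) = frechet_derivative f (at x)" if "x \<in> S" for x
    using d[OF that] frechet_derivative_at by metis
  show ?case
    using Suc.IH[where f = "\<lambda>x. frechet_derivative f (at x) v" and
        g = "\<lambda>x. frechet_derivative g (at x) v" for v] Suc.prems(1) e d
    by (auto simp: differentiable_def)
qed

lemma Ck_on_cong:
  assumes "open S" "\<And>x. x \<in> S \<Longrightarrow> f x = g x"
  shows "Ck_on n S f \<longleftrightarrow> Ck_on n S g"
  using Ck_on_cong_imp[of n S f g] Ck_on_cong_imp[of n S g f] assms by auto

lemma Ck_on_subset: "Ck_on n S f \<Longrightarrow> T \<subseteq> S \<Longrightarrow> Ck_on n T f"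
  by (induction n arbitrary: f) (auto intro: continuous_on_subset)

lemma Ck_on_local:
  assumes "\<And>x. x \<in> S \<Longrightarrow> \<exists>T. open T \<and> x \<in> T \<and> Ck_on n T f"
  shows "Ck_on n S f"
  using assms
proof (induction n arbitrary: f)
  case 0
  then show ?case
    by (metis Ck_on.simps(1) continuous_at_imp_continuous_on continuous_on_eq_continuous_at)
next
  case (Suc n)
  show ?case
    unfolding Ck_on.simps
  proof (intro conjI ballI allI)
    fix x assume "x \<in> S"
    then show "f differentiable at x" using Suc.prems by force
  next
    fix v show "Ck_on n S (\<lambda>x. frechet_derivative f (at x) v)"
      using Suc.prems by (intro Suc.IH) force
  qed
qed

text \<open>Any formula for the derivative may be supplied: on the open set it must coincide with
  \<open>frechet_derivative\<close>, which is what the recursion of \<open>Ck_on\<close>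
  inspects.\<close>

lemma Ck_on_SucI:
  assumes "open S" "\<And>x. x \<in> S \<Longrightarrow> (f has_derivative f' x) (at x)"
    and "\<And>v. Ck_on n S (\<lambda>x. f' x v)"
  shows "Ck_on (Suc n) S f"
proof -
  have "frechet_derivative f (at x) = f' x" if "x \<in> S" for x
    using assms(2)[OF that] frechet_derivative_at by metis
  then have "Ck_on n S (\<lambda>x. frechet_derivative f (at x) v)" for v
    using assms(3)[of v] by (subst Ck_on_cong[OF assms(1)]) auto
  then show ?thesis
    using assms(2) by (auto simp: differentiable_def)
qed

lemma Ck_on_SucD_deriv:
  "Ck_on (Suc n) S f \<Longrightarrow> x \<in> S \<Longrightarrow> (f has_derivative frechet_derivative f (at x)) (at x)"
  by (auto simp: frechet_derivative_works)

lemma Ck_on_SucD: "Ck_on (Suc n) S f \<Longrightarrow> Ck_on n S f"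
proof (induction n arbitrary: f)
  case 0
  then show ?case
    by (simp add: continuous_at_imp_continuous_on differentiable_imp_continuous_within)
next
  case (Suc n)
  show ?case
    unfolding Ck_on.simps
  proof (intro conjI ballI allI)
    fix x assume "x \<in> S"
    then show "f differentiable at x" using Suc.prems by auto
  next
    fix v
    have "Ck_on (Suc n) S (\<lambda>x. frechet_derivative f (at x) v)"
      using Suc.prems by (metis Ck_on.simps(2))
    then show "Ck_on n S (\<lambda>x. frechet_derivative f (at x) v)"
      by (rule Suc.IH)
  qed
qed

lemma Ck_on_mono: "Ck_on n S f \<Longrightarrow> m \<le> n \<Longrightarrow> Ck_on m S f"
  by (induction n) (auto simp: le_Suc_eq simp del: Ck_on.simps dest: Ck_on_SucD)

lemma Ck_on_imp_continuous_on: "Ck_on n S f \<Longrightarrow> continuous_on S f"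
  using Ck_on_mono[of n S f 0] by simp

lemma Ck_on_const: "Ck_on n S (\<lambda>x. c)"
proof (induction n arbitrary: c)
  case (Suc n)
  have "frechet_derivative (\<lambda>x. c) (at x) = (\<lambda>v. 0)" for x :: 'a
    by simp
  then show ?case using Suc by simp
qed simp

lemma Ck_on_bounded_linear_comp:
  assumes "bounded_linear L" "open S" "Ck_on n S f"
  shows "Ck_on n S (\<lambda>x. L (f x))"
  using assms(3)
proof (induction n arbitrary: f)
  case 0
  then show ?case
    using bounded_linear.continuous_on[OF assms(1)] by auto
next
  case (Suc n)
  show ?case
  proof (rule Ck_on_SucI[OF assms(2)])
    show "((\<lambda>x. L (f x)) has_derivative (\<lambda>v. L (frechet_derivative f (at x) v))) (at x)"
      if "x \<in> S" for x
      by (rule bounded_linear.has_derivative[OF assms(1)]) (rule Ck_on_SucD_deriv[OF Suc.prems that])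
    show "Ck_on n S (\<lambda>x. L (frechet_derivative f (at x) v))" for v
      using Suc by auto
  qed
qed

lemma Ck_on_bounded_linear:
  assumes "bounded_linear L" "open S" shows "Ck_on n S L"
proof (cases n)
  case 0
  then show ?thesis using assms by (simp add: linear_continuous_on)
next
  case (Suc m)
  show ?thesis unfolding Suc
    by (rule Ck_on_SucI[where f' = "\<lambda>_. L"])
      (use assms in \<open>auto intro: Ck_on_const bounded_linear_imp_has_derivative\<close>)
qed

lemma Ck_on_ident: "open S \<Longrightarrow> Ck_on n S (\<lambda>x. x)"
  by (rule Ck_on_bounded_linear) (auto intro: bounded_linear_ident)

lemma Ck_on_add:
  assumes "open S" "Ck_on n S f" "Ck_on n S g"
  shows "Ck_on n S (\<lambda>x. f x + g x)"
  using assms(2,3)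
proof (induction n arbitrary: f g)
  case 0
  then show ?case by (auto intro: continuous_intros)
next
  case (Suc n)
  show ?case
  proof (rule Ck_on_SucI[OF assms(1)])
    show "((\<lambda>x. f x + g x) has_derivative
        (\<lambda>v. frechet_derivative f (at x) v + frechet_derivative g (at x) v)) (at x)"
      if "x \<in> S" for x
      by (intro has_derivative_add) (use Ck_on_SucD_deriv Suc.prems that in blast)+
    show "Ck_on n S (\<lambda>x. frechet_derivative f (at x) v + frechet_derivative g (at x) v)" for v
      using Suc by auto
  qed
qed

lemma Ck_on_sum:
  assumes "open S" "\<And>i. i \<in> I \<Longrightarrow> Ck_on n S (f i)"
  shows "Ck_on n S (\<lambda>x. \<Sum>i\<in>I. f i x)"
  using assms(2)
proof (induction I rule: infinite_finite_induct)
  case (insert i I)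
  then show ?case by (simp add: Ck_on_add[OF assms(1)])
qed (simp_all add: Ck_on_const)

lemma Ck_on_minus:
  assumes "open S" "Ck_on n S f" shows "Ck_on n S (\<lambda>x. - f x)"
  using Ck_on_bounded_linear_comp[OF bounded_linear_minus[OF bounded_linear_ident] assms] .

lemma Ck_on_diff:
  assumes "open S" "Ck_on n S f" "Ck_on n S g"
  shows "Ck_on n S (\<lambda>x. f x - g x)"
  using Ck_on_add[OF assms(1,2) Ck_on_minus[OF assms(1,3)]] by simp

lemma Ck_on_bilinear:
  assumes "bounded_bilinear B" "open S" "Ck_on n S f" "Ck_on n S g"
  shows "Ck_on n S (\<lambda>x. B (f x) (g x))"
  using assms(3,4)
proof (induction n arbitrary: f g)
  case 0
  then show ?case
    using bounded_bilinear.continuous_on[OF assms(1)] by auto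
next
  case (Suc n)
  show ?case
  proof (rule Ck_on_SucI[OF assms(2)])
    show "((\<lambda>x. B (f x) (g x)) has_derivative
        (\<lambda>v. B (f x) (frechet_derivative g (at x) v) + B (frechet_derivative f (at x) v) (g x))) (at x)"
      if "x \<in> S" for x
      by (intro bounded_bilinear.FDERIV[OF assms(1)]) (use Ck_on_SucD_deriv Suc.prems that in blast)+
    show "Ck_on n S (\<lambda>x. B (f x) (frechet_derivative g (at x) v) + B (frechet_derivative f (at x) v) (g x))" for v
      using Suc.prems Ck_on_SucD[OF Suc.prems(1)] Ck_on_SucD[OF Suc.prems(2)]
      by (intro Ck_on_add[OF assms(2)] Suc.IH) auto
  qed
qed

lemmas Ck_on_scaleR = Ck_on_bilinear[OF bounded_bilinear_scaleR]

lemma Ck_on_power: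
  fixes f :: "'a::real_normed_vector \<Rightarrow> real"
  assumes "open S" "Ck_on n S f" shows "Ck_on n S (\<lambda>x. f x ^ j)"
proof (induction j)
  case (Suc j)
  then show ?case
    using Ck_on_bilinear[OF bounded_bilinear_mult assms] by simp
qed (simp add: Ck_on_const)

lemma Ck_on_Pair:
  assumes "open S" "Ck_on n S f" "Ck_on n S g"
  shows "Ck_on n S (\<lambda>x. (f x, g x))"
proof -
  have "Ck_on n S (\<lambda>x. (f x, 0) + (0, g x))"
    by (intro Ck_on_add assms Ck_on_bounded_linear_comp[where L = "\<lambda>x. (x, 0)"]
        Ck_on_bounded_linear_comp[where L = "\<lambda>x. (0, x)"] bounded_linear_Pair
        bounded_linear_zero bounded_linear_ident)
  then show ?thesis by simp
qed

lemma Ck_on_compose: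
  fixes f :: "'a::real_normed_vector \<Rightarrow> 'b::{real_inner, heine_borel}"
  assumes "open S" "open T" "Ck_on n S f" "Ck_on n T g" "\<And>x. x \<in> S \<Longrightarrow> f x \<in> T"
  shows "Ck_on n S (\<lambda>x. g (f x))"
  using assms(3,4)
proof (induction n arbitrary: g)
  case 0
  then show ?case using assms(5)
    by (auto intro!: continuous_on_compose2[where g = g and f = f])
next
  case (Suc n)
  \<comment> \<open>The chain rule evaluates the derivative of \<open>g\<close> in a direction that
    varies with \<open>x\<close>. Expanding that direction in the basis leaves products of
    coefficients with derivatives of \<open>g\<close> in fixed directions, to which the induction
    hypothesis applies.\<close>
  let ?D = "\<lambda>x v. \<Sum>e\<in>onb. (frechet_derivative f (at x) v \<bullet> e) *\<^sub>R frechet_derivative g (at (f x)) e"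
  show ?case
  proof (rule Ck_on_SucI[OF assms(1)])
    show "((\<lambda>x. g (f x)) has_derivative ?D x) (at x)" if "x \<in> S" for x
    proof -
      have g: "(g has_derivative frechet_derivative g (at (f x))) (at (f x))"
        using Ck_on_SucD_deriv Suc.prems(2) assms(5) that by blast
      have "((\<lambda>x. g (f x)) has_derivative (\<lambda>v. frechet_derivative g (at (f x)) (frechet_derivative f (at x) v))) (at x)"
        using has_derivative_compose[OF Ck_on_SucD_deriv[OF Suc.prems(1) that] g] .
      then show ?thesis
        using linear_onb_expand[OF has_derivative_linear[OF g]] by simp
    qed
    show "Ck_on n S (\<lambda>x. ?D x v)" for v
      using Suc.prems
      by (intro Ck_on_sum Ck_on_scaleR Ck_on_bounded_linear_comp[OF bounded_linear_inner_left]
          assms(1) Suc.IH Ck_on_SucD[OF Suc.prems(1)]) auto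
  qed
qed

text \<open>Bridge to \<open>taylor_coeff\<close>, which iterates \<open>vector_derivative\<close>:
  in one real variable every direction is a multiple of 1.\<close>

lemma Ck_on_real_Suc_iff:
  fixes f :: "real \<Rightarrow> 'b::real_normed_vector"
  assumes "open S"
  shows "Ck_on (Suc n) S f \<longleftrightarrow>
    (\<forall>t\<in>S. f differentiable at t) \<and> Ck_on n S (\<lambda>t. vector_derivative f (at t))"
proof -
  have "Ck_on (Suc n) S f" if d: "\<forall>t\<in>S. f differentiable at t"
    and c: "Ck_on n S (\<lambda>t. vector_derivative f (at t))"
  proof (rule Ck_on_SucI[OF assms])
    show "(f has_derivative (\<lambda>v. v *\<^sub>R vector_derivative f (at t))) (at t)" if "t \<in> S" for t
      using d that vector_derivative_works[of f "at t"] by (simp add: has_vector_derivative_def)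
    show "Ck_on n S (\<lambda>t. v *\<^sub>R vector_derivative f (at t))" for v
      by (intro Ck_on_scaleR Ck_on_const assms c)
  qed
  moreover have "Ck_on n S (\<lambda>t. vector_derivative f (at t))" if "Ck_on (Suc n) S f"
  proof (rule Ck_on_cong_imp[OF _ assms])
    show "Ck_on n S (\<lambda>x. frechet_derivative f (at x) 1)" using that by simp
    show "frechet_derivative f (at x) 1 = vector_derivative f (at x)" if "x \<in> S" for x
      using \<open>Ck_on (Suc n) S f\<close> that by (simp add: frechet_derivative_eq_vector_derivative)
  qed
  moreover have "\<forall>t\<in>S. f differentiable at t" if "Ck_on (Suc n) S f"
    using that by simp
  ultimately show ?thesis by blast
qed

section \<open>Transfer of the calculus to smooth maps\<close>

lemma smooth_on_cong:
  assumes "open S" "\<And>x. x \<in> S \<Longrightarrow> f x = g x" shows "smooth_on S f \<longleftrightarrow> smooth_on S g"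
  unfolding smooth_on_def using Ck_on_cong[OF assms] by simp

lemma smooth_on_subset: "smooth_on S f \<Longrightarrow> T \<subseteq> S \<Longrightarrow> smooth_on T f"
  by (auto simp: smooth_on_def intro: Ck_on_subset)

lemma smooth_on_local:
  assumes "\<And>x. x \<in> S \<Longrightarrow> \<exists>T. open T \<and> x \<in> T \<and> smooth_on T f"
  shows "smooth_on S f"
  unfolding smooth_on_def
proof
  fix n show "Ck_on n S f"
    using assms unfolding smooth_on_def by (intro Ck_on_local) blast
qed

lemma smooth_on_imp_continuous_on: "smooth_on S f \<Longrightarrow> continuous_on S f"
  by (metis smooth_on_def Ck_on.simps(1))

lemma smooth_on_frechet_derivative: "smooth_on S f \<Longrightarrow> smooth_on S (\<lambda>x. frechet_derivative f (at x) v)"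
  by (metis smooth_on_def Ck_on.simps(2))

lemma smooth_on_has_derivative:
  "smooth_on S f \<Longrightarrow> x \<in> S \<Longrightarrow> (f has_derivative frechet_derivative f (at x)) (at x)"
  by (metis smooth_on_def Ck_on_SucD_deriv)

lemma smooth_on_const: "smooth_on S (\<lambda>x. c)"
  by (simp add: smooth_on_def Ck_on_const)

lemma smooth_on_bounded_linear: "bounded_linear L \<Longrightarrow> open S \<Longrightarrow> smooth_on S L"
  by (simp add: smooth_on_def Ck_on_bounded_linear)

lemma smooth_on_ident: "open S \<Longrightarrow> smooth_on S (\<lambda>x. x)"
  by (simp add: smooth_on_def Ck_on_ident)

lemma smooth_on_add:
  "open S \<Longrightarrow> smooth_on S f \<Longrightarrow> smooth_on S g \<Longrightarrow> smooth_on S (\<lambda>x. f x + g x)"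
  by (simp add: smooth_on_def Ck_on_add)

lemma smooth_on_diff:
  "open S \<Longrightarrow> smooth_on S f \<Longrightarrow> smooth_on S g \<Longrightarrow> smooth_on S (\<lambda>x. f x - g x)"
  by (simp add: smooth_on_def Ck_on_diff)

lemma smooth_on_sum:
  "open S \<Longrightarrow> (\<And>i. i \<in> I \<Longrightarrow> smooth_on S (f i)) \<Longrightarrow> smooth_on S (\<lambda>x. \<Sum>i\<in>I. f i x)"
  by (simp add: smooth_on_def Ck_on_sum)

lemma smooth_on_scaleR:
  "open S \<Longrightarrow> smooth_on S f \<Longrightarrow> smooth_on S g \<Longrightarrow> smooth_on S (\<lambda>x. f x *\<^sub>R g x)"
  by (simp add: smooth_on_def Ck_on_scaleR)

lemma smooth_on_power:
  fixes f :: "'a::real_normed_vector \<Rightarrow> real"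
  shows "open S \<Longrightarrow> smooth_on S f \<Longrightarrow> smooth_on S (\<lambda>x. f x ^ j)"
  by (simp add: smooth_on_def Ck_on_power)

lemma smooth_on_Pair:
  "open S \<Longrightarrow> smooth_on S f \<Longrightarrow> smooth_on S g \<Longrightarrow> smooth_on S (\<lambda>x. (f x, g x))"
  by (simp add: smooth_on_def Ck_on_Pair)

lemma smooth_on_compose:
  fixes f :: "'a::real_normed_vector \<Rightarrow> 'b::{real_inner, heine_borel}"
  assumes "smooth_on S f" "smooth_on T g" "open S" "open T" "\<And>x. x \<in> S \<Longrightarrow> f x \<in> T"
  shows "smooth_on S (\<lambda>x. g (f x))"
  using assms by (auto simp: smooth_on_def intro: Ck_on_compose)

section \<open>Flat curves and Taylor coefficients\<close>

text \<open>This is \<open>f t = o(t ^ k)\<close> at 0. The filter \<open>nhds 0\<close> includes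
  the point 0 itself, so \<open>f 0 = 0\<close> is part of it; for \<open>k = 0\<close> it says that
  \<open>f\<close> tends to 0 there and vanishes at 0.\<close>

definition flat :: "nat \<Rightarrow> (real \<Rightarrow> 'b::real_normed_vector) \<Rightarrow> bool" where
  "flat k f \<longleftrightarrow> (\<forall>e>0. \<forall>\<^sub>F t in nhds 0. norm (f t) \<le> e * \<bar>t\<bar> ^ k)"

lemma flat_zero [simp]: "flat k (\<lambda>t. 0)"
  by (auto simp: flat_def)

lemma flat_cong_imp: "flat k f \<Longrightarrow> (\<forall>\<^sub>F t in nhds 0. f t = g t) \<Longrightarrow> flat k g"
  unfolding flat_def by (auto elim: eventually_elim2)

lemma flat_cong: "(\<forall>\<^sub>F t in nhds 0. f t = g t) \<Longrightarrow> flat k f \<longleftrightarrow> flat k g"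
  using flat_cong_imp[of k f g] flat_cong_imp[of k g f] by (auto simp: eq_commute)

lemma flat_add:
  assumes "flat k f" "flat k g" shows "flat k (\<lambda>t. f t + g t)"
  unfolding flat_def
proof (intro allI impI)
  fix e :: real assume "e > 0"
  then have "\<forall>\<^sub>F t in nhds 0. norm (f t) \<le> e/2 * \<bar>t\<bar> ^ k" "\<forall>\<^sub>F t in nhds 0. norm (g t) \<le> e/2 * \<bar>t\<bar> ^ k"
    using assms half_gt_zero unfolding flat_def by blast+
  then show "\<forall>\<^sub>F t in nhds 0. norm (f t + g t) \<le> e * \<bar>t\<bar> ^ k"
  proof eventually_elim
    case (elim t)
    then show ?case using norm_triangle_ineq[of "f t" "g t"] by (simp add: field_simps)
  qed
qed

lemma flat_bounded:
  assumes "flat k f" "\<forall>\<^sub>F t in nhds 0. norm (g t) \<le> C * norm (f t)"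
  shows "flat k g"
  unfolding flat_def
proof (intro allI impI)
  fix e :: real assume "e > 0"
  then have "e / (\<bar>C\<bar> + 1) > 0" by (simp add: add_nonneg_pos)
  then have "\<forall>\<^sub>F t in nhds 0. norm (f t) \<le> e / (\<bar>C\<bar> + 1) * \<bar>t\<bar> ^ k"
    using assms(1) unfolding flat_def by blast
  with assms(2) show "\<forall>\<^sub>F t in nhds 0. norm (g t) \<le> e * \<bar>t\<bar> ^ k"
  proof eventually_elim
    case (elim t)
    have "norm (g t) \<le> (\<bar>C\<bar> + 1) * norm (f t)"
      using elim(1) by (smt (verit) mult_right_mono norm_ge_zero)
    also have "\<dots> \<le> (\<bar>C\<bar> + 1) * (e / (\<bar>C\<bar> + 1) * \<bar>t\<bar> ^ k)"
      using elim(2) by (intro mult_left_mono) auto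
    also have "\<dots> = e * \<bar>t\<bar> ^ k" by simp
    finally show ?case .
  qed
qed

lemma flat_uminus: "flat k f \<Longrightarrow> flat k (\<lambda>t. - f t)"
  by (simp add: flat_def)

lemma flat_diff: "flat k f \<Longrightarrow> flat k g \<Longrightarrow> flat k (\<lambda>t. f t - g t)"
  using flat_add[of k f "\<lambda>t. - g t"] by (simp add: flat_uminus)

lemma flat_sum: "(\<And>i. i \<in> I \<Longrightarrow> flat k (f i)) \<Longrightarrow> flat k (\<lambda>t. \<Sum>i\<in>I. f i t)"
proof (induction I rule: infinite_finite_induct)
  case (insert i I)
  then show ?case by (simp add: flat_add)
qed simp_all

lemma eventually_abs_le_nhds_0: "e > 0 \<Longrightarrow> \<forall>\<^sub>F t::real in nhds 0. \<bar>t\<bar> < e"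
  by (auto simp: eventually_nhds_metric dist_real_def)

lemma flat_mono:
  assumes "flat k f" "j \<le> k" shows "flat j f"
  unfolding flat_def
proof (intro allI impI)
  fix e :: real assume "e > 0"
  then have "\<forall>\<^sub>F t in nhds 0. norm (f t) \<le> e * \<bar>t\<bar> ^ k"
    using assms unfolding flat_def by blast
  with eventually_abs_le_nhds_0[OF zero_less_one]
  show "\<forall>\<^sub>F t in nhds 0. norm (f t) \<le> e * \<bar>t\<bar> ^ j"
  proof eventually_elim
    case (elim t)
    then have "e * \<bar>t\<bar> ^ k \<le> e * \<bar>t\<bar> ^ j"
      using \<open>e > 0\<close> assms(2) by (simp add: power_decreasing)
    then show ?case using elim by simp
  qed
qed

lemma flat_power:
  assumes "j < i" shows "flat j (\<lambda>t. t ^ i *\<^sub>R c)"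
  unfolding flat_def
proof (intro allI impI)
  fix e :: real assume "e > 0"
  then have "min 1 (e / (norm c + 1)) > 0" by (simp add: add_nonneg_pos)
  from eventually_abs_le_nhds_0[OF this]
  show "\<forall>\<^sub>F t in nhds 0. norm (t ^ i *\<^sub>R c) \<le> e * \<bar>t\<bar> ^ j"
  proof eventually_elim
    case (elim t)
    have "\<bar>t\<bar> ^ i \<le> \<bar>t\<bar> ^ Suc j"
      using elim assms by (intro power_decreasing) auto
    moreover have "\<bar>t\<bar> * (norm c + 1) \<le> e"
      using elim by (simp add: pos_less_divide_eq add_nonneg_pos less_imp_le)
    moreover have "\<bar>t\<bar> * norm c \<le> \<bar>t\<bar> * (norm c + 1)"
      by (intro mult_left_mono) auto
    ultimately have "\<bar>t\<bar> ^ i * norm c \<le> \<bar>t\<bar> ^ Suc j * norm c" "\<bar>t\<bar> ^ j * (\<bar>t\<bar> * norm c) \<le> \<bar>t\<bar> ^ j * e"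
      by (intro mult_right_mono mult_left_mono; simp)+
    then have "\<bar>t\<bar> ^ i * norm c \<le> e * \<bar>t\<bar> ^ j"
      by (simp add: mult_ac)
    then show ?case
      by (simp add: power_abs)
  qed
qed

lemma flat_power_eq_0:
  assumes "flat k (\<lambda>t. t ^ k *\<^sub>R c)" shows "c = 0"
proof (rule ccontr)
  assume "c \<noteq> 0"
  then have "\<forall>\<^sub>F t in nhds 0. norm (t ^ k *\<^sub>R c) \<le> norm c / 2 * \<bar>t\<bar> ^ k"
    using assms half_gt_zero zero_less_norm_iff unfolding flat_def by blast
  then obtain d where d: "d > 0" "\<And>t. dist t 0 < d \<Longrightarrow> norm (t ^ k *\<^sub>R c) \<le> norm c / 2 * \<bar>t\<bar> ^ k"
    unfolding eventually_nhds_metric by blast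
  have "norm ((d/2) ^ k *\<^sub>R c) \<le> norm c / 2 * \<bar>d/2\<bar> ^ k"
    using d(1) by (intro d(2)) auto
  then show False using d(1) \<open>c \<noteq> 0\<close>
    by (simp add: power_abs field_simps)
qed

text \<open>The term of degree \<open>Suc k\<close> is itself \<open>o(t ^ k)\<close>, so the lower
  coefficients vanish by induction first, and only then is the top one isolated.\<close>

lemma flat_poly_eq_0:
  assumes "flat k (\<lambda>t. \<Sum>i\<le>k. t ^ i *\<^sub>R c i)" "i \<le> k"
  shows "c i = 0"
  using assms
proof (induction k arbitrary: i)
  case 0
  then show ?case using flat_power_eq_0[of 0 "c 0"] by simp
next
  case (Suc k)
  have "flat k (\<lambda>t. (\<Sum>i\<le>Suc k. t ^ i *\<^sub>R c i) - t ^ Suc k *\<^sub>R c (Suc k))"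
    using Suc.prems(1) by (intro flat_diff flat_power) (auto intro: flat_mono simp del: sum.atMost_Suc)
  then have *: "c j = 0" if "j \<le> k" for j
    using that Suc.IH by (simp add: algebra_simps)
  then have "flat (Suc k) (\<lambda>t. t ^ Suc k *\<^sub>R c (Suc k))"
    using Suc.prems(1) by simp
  then have "c (Suc k) = 0" by (rule flat_power_eq_0)
  then show ?case using * Suc.prems(2) by (auto simp: le_Suc_eq)
qed

text \<open>The epsilon-delta form of differentiability is a \<open>flat 1\<close> remainder; this
  is how equality of 1-jets becomes a statement about derivatives.\<close>

lemma flat_has_vector_derivative_iff:
  "flat 1 (\<lambda>s. f (t + s) - f t - s *\<^sub>R D) \<longleftrightarrow> (f has_vector_derivative D) (at t)"
proof -
  have "(f has_vector_derivative D) (at t) \<longleftrightarrow>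
    (\<forall>e>0. \<exists>d>0. \<forall>y. norm (y - t) < d \<longrightarrow> norm (f y - f t - (y - t) *\<^sub>R D) \<le> e * norm (y - t))"
    unfolding has_vector_derivative_def has_derivative_at_alt
    by (simp add: bounded_linear_scaleR_left)
  also have "\<dots> \<longleftrightarrow> (\<forall>e>0. \<exists>d>0. \<forall>s. norm s < d \<longrightarrow> norm (f (t + s) - f t - s *\<^sub>R D) \<le> e * norm s)"
    by (metis add_diff_cancel_left' add.commute diff_add_cancel)
  finally show ?thesis
    by (simp add: flat_def eventually_nhds_metric)
qed

section \<open>Taylor coefficients and Taylor's formula\<close>

lemma taylor_coeff_0: "taylor_coeff 0 f = f 0"
  by (simp add: taylor_coeff_def)

lemma taylor_coeff_vector_derivative:
  "taylor_coeff i (\<lambda>t. vector_derivative f (at t)) = real (Suc i) *\<^sub>R taylor_coeff (Suc i) f"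
proof -
  let ?F = "\<lambda>(g :: real \<Rightarrow> 'a) t. vector_derivative g (at t)"
  have "(?F ^^ Suc i) f = (?F ^^ i) (?F f)"
    by (simp add: funpow_Suc_right del: funpow.simps)
  moreover have "real (Suc i) * inverse (fact (Suc i)) = inverse (fact i)"
    by (simp add: divide_simps)
  ultimately show ?thesis
    by (simp add: taylor_coeff_def del: funpow.simps of_nat_Suc fact_Suc)
qed

text \<open>Integration raises the order by one. The mean value inequality on the symmetric interval
  from \<open>-\<bar>t\<bar>\<close> to \<open>\<bar>t\<bar>\<close> treats both signs of
  \<open>t\<close> together.\<close>

lemma flat_Suc_derivative:
  assumes "d > 0" "\<And>t. \<bar>t\<bar> < d \<Longrightarrow> (h has_vector_derivative h' t) (at t)" "flat k h'" "h 0 = 0"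
  shows "flat (Suc k) h"
  unfolding flat_def
proof (intro allI impI)
  fix e :: real assume "e > 0"
  then have "\<forall>\<^sub>F t in nhds 0. norm (h' t) \<le> e * \<bar>t\<bar> ^ k"
    using assms(3) by (simp add: flat_def)
  then obtain r where r: "r > 0" "\<And>t. \<bar>t\<bar> < r \<Longrightarrow> norm (h' t) \<le> e * \<bar>t\<bar> ^ k"
    unfolding eventually_nhds_metric by (auto simp: dist_real_def)
  have "norm (h t) \<le> e * \<bar>t\<bar> ^ Suc k" if t: "\<bar>t\<bar> < min d r" for t
  proof -
    have "norm (h t - h 0) \<le> (e * \<bar>t\<bar> ^ k) * norm (t - 0)"
    proof (rule differentiable_bound[where S = "{-\<bar>t\<bar>..\<bar>t\<bar>}"])
      fix x assume x: "x \<in> {-\<bar>t\<bar>..\<bar>t\<bar>}"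
      then have "\<bar>x\<bar> \<le> \<bar>t\<bar>" by auto
      show "(h has_derivative (\<lambda>v. v *\<^sub>R h' x)) (at x within {-\<bar>t\<bar>..\<bar>t\<bar>})"
        using assms(2)[of x] t x has_derivative_at_withinI
        unfolding has_vector_derivative_def by fastforce
      have "norm (h' x) \<le> e * \<bar>x\<bar> ^ k"
        using r(2)[of x] \<open>\<bar>x\<bar> \<le> \<bar>t\<bar>\<close> t by auto
      also have "\<dots> \<le> e * \<bar>t\<bar> ^ k"
        using \<open>e > 0\<close> \<open>\<bar>x\<bar> \<le> \<bar>t\<bar>\<close> by (simp add: power_mono)
      finally show "onorm (\<lambda>v. v *\<^sub>R h' x) \<le> e * \<bar>t\<bar> ^ k"
        using onorm_scaleR_left[of "\<lambda>v::real. v" "h' x"] by (simp add: bounded_linear_ident onorm_id)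
    qed auto
    then show ?thesis using assms(4) by (simp add: mult_ac)
  qed
  then show "\<forall>\<^sub>F t in nhds 0. norm (h t) \<le> e * \<bar>t\<bar> ^ Suc k"
    using eventually_abs_le_nhds_0[of "min d r"] assms(1) r(1)
    by (auto elim: eventually_mono)
qed

text \<open>Taylor's formula with Peano's remainder: the expansion of the derivative is the
  derivative of the Taylor polynomial, so the induction hypothesis for the derivative is integrated
  once.\<close>

lemma taylor_flat:
  fixes f :: "real \<Rightarrow> 'b::real_normed_vector"
  assumes "open S" "0 \<in> S" "Ck_on k S f"
  shows "flat k (\<lambda>t. f t - (\<Sum>i\<le>k. t ^ i *\<^sub>R taylor_coeff i f))"
  using assms(3)
proof (induction k arbitrary: f)
  case 0
  then have "f \<midarrow>0\<rightarrow> f 0"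
    using assms by (metis Ck_on.simps(1) continuous_on_eq_continuous_at isCont_def)
  then show ?case
    unfolding flat_def
    by (auto simp: taylor_coeff_0 tendsto_iff dist_norm eventually_at_filter eventually_nhds_metric
        intro: less_imp_le) (metis less_imp_le norm_zero right_minus_eq)
next
  case (Suc k)
  obtain d where d: "d > 0" "ball 0 d \<subseteq> S"
    using assms(1,2) openE by blast
  have f: "\<forall>t\<in>S. f differentiable at t" "Ck_on k S (\<lambda>t. vector_derivative f (at t))"
    using Suc.prems by (auto simp only: Ck_on_real_Suc_iff[OF assms(1)])
  show ?case
  proof (rule flat_Suc_derivative[OF d(1)])
    show "flat k (\<lambda>t. vector_derivative f (at t) - (\<Sum>i\<le>k. t ^ i *\<^sub>R taylor_coeff i (\<lambda>t. vector_derivative f (at t))))"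
      using Suc.IH[OF f(2)] .
    show "f 0 - (\<Sum>i\<le>Suc k. 0 ^ i *\<^sub>R taylor_coeff i f) = 0"
      by (simp add: taylor_coeff_0 sum.atMost_Suc_shift del: sum.atMost_Suc)
    fix t :: real assume "\<bar>t\<bar> < d"
    then have "t \<in> S" using d(2) by (auto simp: dist_real_def)
    then have "(f has_vector_derivative vector_derivative f (at t)) (at t)"
      using f(1) vector_derivative_works by blast
    moreover have "((\<lambda>t. \<Sum>i\<le>Suc k. t ^ i *\<^sub>R taylor_coeff i f) has_vector_derivative
        (\<Sum>i\<le>k. t ^ i *\<^sub>R taylor_coeff i (\<lambda>t. vector_derivative f (at t)))) (at t)"
      unfolding sum.atMost_Suc_shift
      by (rule derivative_eq_intros refl | simp add: taylor_coeff_vector_derivative mult.commute)+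
    ultimately show "((\<lambda>t. f t - (\<Sum>i\<le>Suc k. t ^ i *\<^sub>R taylor_coeff i f)) has_vector_derivative
      vector_derivative f (at t) - (\<Sum>i\<le>k. t ^ i *\<^sub>R taylor_coeff i (\<lambda>t. vector_derivative f (at t)))) (at t)"
      by (rule has_vector_derivative_diff)
  qed
qed

lemma taylor_coeff_unique:
  fixes f :: "real \<Rightarrow> 'b::real_normed_vector"
  assumes "open S" "0 \<in> S" "Ck_on k S f" "flat k (\<lambda>t. f t - (\<Sum>i\<le>k. t ^ i *\<^sub>R c i))" "i \<le> k"
  shows "taylor_coeff i f = c i"
proof -
  have "flat k (\<lambda>t. \<Sum>i\<le>k. t ^ i *\<^sub>R (taylor_coeff i f - c i))"
    using flat_diff[OF assms(4) taylor_flat[OF assms(1-3)]]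
    by (simp add: sum_subtractf algebra_simps)
  then show ?thesis using flat_poly_eq_0[of k "\<lambda>i. taylor_coeff i f - c i" i] assms(5) by simp
qed

lemma taylor_coeff_eq_iff_flat:
  fixes f g :: "real \<Rightarrow> 'b::real_normed_vector"
  assumes "open S" "0 \<in> S" "Ck_on k S f" "Ck_on k S g"
  shows "(\<forall>i\<le>k. taylor_coeff i f = taylor_coeff i g) \<longleftrightarrow> flat k (\<lambda>t. f t - g t)"
proof
  assume "\<forall>i\<le>k. taylor_coeff i f = taylor_coeff i g"
  then have "(\<Sum>i\<le>k. t ^ i *\<^sub>R taylor_coeff i f) = (\<Sum>i\<le>k. t ^ i *\<^sub>R taylor_coeff i g)" for t :: real
    by (intro sum.cong) auto
  then show "flat k (\<lambda>t. f t - g t)"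
    using flat_diff[OF taylor_flat[OF assms(1-3)] taylor_flat[OF assms(1,2,4)]] by simp
next
  assume "flat k (\<lambda>t. f t - g t)"
  from flat_add[OF this taylor_flat[OF assms(1,2,4)]]
  have "flat k (\<lambda>t. f t - (\<Sum>i\<le>k. t ^ i *\<^sub>R taylor_coeff i g))" by simp
  then show "\<forall>i\<le>k. taylor_coeff i f = taylor_coeff i g"
    using taylor_coeff_unique[OF assms(1-3), where c = "\<lambda>i. taylor_coeff i g"] by blast
qed

lemma taylor_coeff_cong:
  assumes "open S" "0 \<in> S" "\<And>t. t \<in> S \<Longrightarrow> f t = g t"
  shows "taylor_coeff i f = taylor_coeff i g"
proof -
  have "((\<lambda>g t. vector_derivative g (at t)) ^^ i) f t = ((\<lambda>g t. vector_derivative g (at t)) ^^ i) g t"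
    if "t \<in> S" for t
    using that
  proof (induction i arbitrary: t)
    case (Suc i)
    have "\<forall>\<^sub>F x in nhds t. ((\<lambda>g t. vector_derivative g (at t)) ^^ i) f x = ((\<lambda>g t. vector_derivative g (at t)) ^^ i) g x"
      using assms(1) Suc by (auto simp: eventually_nhds)
    then show ?case
      using Suc.prems by (auto intro!: vector_derivative_cong_eq)
  qed (use assms in auto)
  then show ?thesis using assms(2) by (simp add: taylor_coeff_def)
qed

text \<open>The iterated derivative in \<open>t\<close> alone equals the iterated directional
  derivative of \<open>u\<close> along \<open>(0, 1)\<close> in the joint variable, and the latter
  stays smooth in \<open>y\<close>.\<close>

lemma smooth_on_taylor_coeff:
  fixes u :: "'c::{real_inner, heine_borel} \<times> real \<Rightarrow> 'b::real_normed_vector"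
  assumes "open W" "d > 0" "smooth_on (W \<times> {-d<..<d}) u"
  shows "smooth_on W (\<lambda>y. taylor_coeff i (\<lambda>t. u (y, t)))"
proof -
  define D where "D = (\<lambda>(u :: 'c \<times> real \<Rightarrow> 'b) p. frechet_derivative u (at p) (0, 1))"
  have sm: "smooth_on (W \<times> {-d<..<d}) ((D ^^ i) u)" for i
    by (induction i) (auto simp: D_def assms smooth_on_frechet_derivative)
  have eq: "((\<lambda>g t. vector_derivative g (at t)) ^^ i) (\<lambda>t. u (y, t)) t = (D ^^ i) u (y, t)"
    if "y \<in> W" "t \<in> {-d<..<d}" for i t y
    using that
  proof (induction i arbitrary: t)
    case (Suc i)
    have "\<forall>\<^sub>F x in nhds t. ((\<lambda>g t. vector_derivative g (at t)) ^^ i) (\<lambda>t. u (y, t)) x = (D ^^ i) u (y, x)"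
      unfolding eventually_nhds using Suc by (intro exI[of _ "{-d<..<d}"]) auto
    then have "((\<lambda>g t. vector_derivative g (at t)) ^^ Suc i) (\<lambda>t. u (y, t)) t = vector_derivative (\<lambda>t. (D ^^ i) u (y, t)) (at t)"
      by (auto intro!: vector_derivative_cong_eq)
    also have "((\<lambda>t. (D ^^ i) u (y, t)) has_vector_derivative D ((D ^^ i) u) (y, t)) (at t)"
    proof -
      have L: "((D ^^ i) u has_derivative frechet_derivative ((D ^^ i) u) (at (y, t))) (at (y, t))"
        using smooth_on_has_derivative[OF sm] Suc.prems by auto
      have "((\<lambda>t. (D ^^ i) u (y, t)) has_derivative (\<lambda>s. frechet_derivative ((D ^^ i) u) (at (y, t)) (0, s))) (at t)"
        by (rule has_derivative_compose[where g = "(D ^^ i) u" and f = "\<lambda>t. (y, t)", OF _ L]) (auto intro!: derivative_eq_intros)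
      moreover have "frechet_derivative ((D ^^ i) u) (at (y, t)) (0, s) = s *\<^sub>R D ((D ^^ i) u) (y, t)" for s
        using linear_scale[OF has_derivative_linear[OF L], of s "(0, 1)"] by (simp add: D_def)
      ultimately show ?thesis
        by (simp add: has_vector_derivative_def)
    qed
    then have "vector_derivative (\<lambda>t. (D ^^ i) u (y, t)) (at t) = (D ^^ Suc i) u (y, t)"
      by (simp add: vector_derivative_at)
    finally show ?case .
  qed auto
  have "smooth_on W (\<lambda>y. (D ^^ i) u (y, 0))"
    by (rule smooth_on_compose[OF _ sm])
       (auto intro!: smooth_on_Pair smooth_on_ident smooth_on_const assms open_Times simp: assms)
  then have "smooth_on W (\<lambda>y. inverse (fact i) *\<^sub>R (D ^^ i) u (y, 0))"
    by (intro smooth_on_scaleR smooth_on_const assms)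
  then show ?thesis
    by (subst smooth_on_cong[OF assms(1)]) (auto simp: taylor_coeff_def eq assms(2))
qed

section \<open>Strict differentiability and the Picard iteration\<close>

text \<open>The number \<open>d\<close> is a Lebesgue number for a cover of \<open>K\<close> by good
  balls. The point \<open>z\<close> may lie off \<open>K\<close>, as it does when a compact solution
  graph is compared with nearby solutions.\<close>

lemma compact_uniform_nhds:
  assumes "compact K"
    and "\<And>x. x \<in> K \<Longrightarrow> \<exists>d>0. \<forall>y\<in>K. \<forall>z. y \<in> ball x d \<longrightarrow> z \<in> ball x d \<longrightarrow> Q y z"
  shows "\<exists>d>0. \<forall>y\<in>K. \<forall>z. dist y z < d \<longrightarrow> Q y z"
proof -
  define \<G> where "\<G> = {ball x d |x d. \<forall>y\<in>K. \<forall>z. y \<in> ball x d \<longrightarrow> z \<in> ball x d \<longrightarrow> Q y z}"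
  have "K \<subseteq> \<Union>\<G>"
  proof
    fix x assume "x \<in> K"
    with assms(2) obtain d where "d > 0" "\<forall>y\<in>K. \<forall>z. y \<in> ball x d \<longrightarrow> z \<in> ball x d \<longrightarrow> Q y z"
      by blast
    then have "ball x d \<in> \<G>" "x \<in> ball x d" by (auto simp: \<G>_def)
    then show "x \<in> \<Union>\<G>" by blast
  qed
  moreover have "open G" if "G \<in> \<G>" for G
    using that by (auto simp: \<G>_def)
  ultimately obtain e where e: "e > 0" "\<And>x. x \<in> K \<Longrightarrow> \<exists>G\<in>\<G>. ball x e \<subseteq> G"
    using Heine_Borel_lemma[OF assms(1)] by metis
  have "Q y z" if "y \<in> K" "dist y z < e" for y z
  proof -
    obtain G where G: "G \<in> \<G>" "ball y e \<subseteq> G"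
      using e(2)[OF \<open>y \<in> K\<close>] by blast
    have "y \<in> G" "z \<in> G" using that e(1) G(2) by auto
    with G(1) that(1) show ?thesis by (auto simp: \<G>_def)
  qed
  with e(1) show ?thesis by blast
qed

lemma continuous_uniform_near_compact:
  assumes "compact K" "K \<subseteq> S" "open S" "continuous_on S f" "e > 0"
  shows "\<exists>d>0. \<forall>y\<in>K. \<forall>z. dist y z < d \<longrightarrow> z \<in> S \<and> dist (f z) (f y) \<le> e"
proof (rule compact_uniform_nhds[OF assms(1)])
  fix x assume "x \<in> K"
  then have "x \<in> S" using assms by auto
  obtain d1 where d1: "d1 > 0" "ball x d1 \<subseteq> S"
    using \<open>x \<in> S\<close> assms(3) openE by blast
  have "isCont f x" using assms \<open>x \<in> S\<close> by (simp add: continuous_on_eq_continuous_at)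
  then obtain d2 where d2: "d2 > 0" "\<And>y. dist y x < d2 \<Longrightarrow> dist (f y) (f x) < e/2"
    unfolding continuous_at_eps_delta using half_gt_zero[OF \<open>e > 0\<close>] by metis
  have "z \<in> S \<and> dist (f z) (f y) \<le> e"
    if "y \<in> ball x (min d1 d2)" "z \<in> ball x (min d1 d2)" for y z
  proof
    show "z \<in> S" using that d1 by auto
    have "dist (f y) (f x) < e/2" "dist (f z) (f x) < e/2"
      using that d2(2)[of y] d2(2)[of z] by (auto simp: dist_commute)
    then show "dist (f z) (f y) \<le> e"
      using dist_triangle2[of "f z" "f y" "f x"] by linarith
  qed
  then show "\<exists>d>0. \<forall>y\<in>K. \<forall>z. y \<in> ball x d \<longrightarrow> z \<in> ball x d \<longrightarrow> z \<in> S \<and> dist (f z) (f y) \<le> e"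
    using d1(1) d2(1) by (intro exI[of _ "min d1 d2"]) auto
qed

text \<open>Strict differentiability: both \<open>y\<close> and \<open>z\<close> move while the
  linear map stays the derivative at \<open>x\<close>. It is the mean value inequality for
  \<open>f\<close> minus that linear map, whose derivative is small near \<open>x\<close> because
  finitely many basis directions control its norm.\<close>

lemma Ck_on_1_strict:
  fixes f :: "'c::{real_inner, heine_borel} \<Rightarrow> 'd::real_normed_vector"
  assumes "open S" "Ck_on 1 S f" "x \<in> S" "e > 0"
  shows "\<exists>d>0. ball x d \<subseteq> S \<and>
    (\<forall>y\<in>ball x d. \<forall>v. norm (frechet_derivative f (at y) v - frechet_derivative f (at x) v) \<le> e * norm v) \<and>
    (\<forall>y\<in>ball x d. \<forall>z\<in>ball x d. norm (f z - f y - frechet_derivative f (at x) (z - y)) \<le> e * norm (z - y))"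
proof -
  let ?D = "\<lambda>y. frechet_derivative f (at y)"
  have D: "(f has_derivative ?D y) (at y)" if "y \<in> S" for y
    using Ck_on_SucD_deriv[of 0 S f y] assms(2) that by simp
  \<comment> \<open>Summing over the basis costs the factor \<open>card onb\<close>; the added 1
    covers the empty basis of dimension 0.\<close>
  define c where "c = e / (card (onb :: 'c set) + 1)"
  have "c > 0" using assms(4) by (simp add: c_def add_nonneg_pos)
  have "isCont (\<lambda>y. ?D y v) x" for v
    using assms(1-3) by (simp add: continuous_on_eq_continuous_at)
  then have "((\<lambda>y. ?D y v) \<longlongrightarrow> ?D x v) (nhds x)" for v
    using tendsto_at_iff_tendsto_nhds[of "\<lambda>y. ?D y v" x] by (simp add: isCont_def)
  from tendstoD[OF this \<open>c > 0\<close>] have "\<forall>\<^sub>F y in nhds x. norm (?D y v - ?D x v) < c" for v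
    by (simp add: dist_norm)
  then have "\<forall>\<^sub>F y in nhds x. y \<in> S \<and> (\<forall>b\<in>onb. norm (?D y b - ?D x b) < c)"
    using assms(1,3) by (intro eventually_conj eventually_ball_finite finite_onb) (auto simp: eventually_nhds_in_open)
  then obtain d where d: "d > 0" "\<And>y. dist y x < d \<Longrightarrow> y \<in> S \<and> (\<forall>b\<in>onb. norm (?D y b - ?D x b) < c)"
    unfolding eventually_nhds_metric by blast
  have le: "norm (?D y v - ?D x v) \<le> e * norm v" if "y \<in> ball x d" for y v
  proof -
    have y: "y \<in> S" "\<And>b. b \<in> onb \<Longrightarrow> norm (?D y b - ?D x b) \<le> c"
      using d(2)[of y] that by (auto simp: dist_commute less_imp_le)
    have "linear (\<lambda>v. ?D y v - ?D x v)"
      by (intro linear_compose_sub has_derivative_linear[OF D] y assms)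
    then have "?D y v - ?D x v = (\<Sum>b\<in>onb. (v \<bullet> b) *\<^sub>R (?D y b - ?D x b))"
      by (rule linear_onb_expand[symmetric])
    also have "norm \<dots> \<le> (\<Sum>b\<in>(onb :: 'c set). norm v * c)"
    proof (rule sum_norm_le)
      fix b :: 'c assume b: "b \<in> onb"
      have "\<bar>v \<bullet> b\<bar> \<le> norm v" using Cauchy_Schwarz_ineq2[of v b] norm_onb[OF b] by simp
      then show "norm ((v \<bullet> b) *\<^sub>R (?D y b - ?D x b)) \<le> norm v * c"
        using y(2)[OF b] by (simp add: mult_mono)
    qed
    also have "\<dots> = norm v * (card (onb :: 'c set) * c)" by simp
    also have "\<dots> \<le> norm v * e"
      using assms(4) by (intro mult_left_mono) (auto simp: c_def field_simps)
    finally show ?thesis by (simp add: mult.commute)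
  qed
  have "norm (f z - f y - ?D x (z - y)) \<le> e * norm (z - y)" if "y \<in> ball x d" "z \<in> ball x d" for y z
  proof -
    have lin: "bounded_linear (?D x)" using D[OF assms(3)] has_derivative_bounded_linear by blast
    have "norm ((f z - ?D x z) - (f y - ?D x y)) \<le> e * norm (z - y)"
    proof (rule differentiable_bound[where S = "ball x d" and f' = "\<lambda>y v. ?D y v - ?D x v"])
      fix y assume y: "y \<in> ball x d"
      then have "y \<in> S" using d(2) by (auto simp: dist_commute)
      show "((\<lambda>y. f y - ?D x y) has_derivative (\<lambda>v. ?D y v - ?D x v)) (at y within ball x d)"
        by (intro has_derivative_diff has_derivative_at_withinI[OF D[OF \<open>y \<in> S\<close>]]
            bounded_linear_imp_has_derivative lin)
      show "onorm (\<lambda>v. ?D y v - ?D x v) \<le> e"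
        using assms(4) le[OF y] by (intro onorm_bound) auto
    qed (use that in auto)
    then show ?thesis
      by (simp add: linear_diff[OF bounded_linear.linear[OF lin]] algebra_simps)
  qed
  with le d show ?thesis
    by (intro exI[of _ d]) (auto simp: dist_commute)
qed

lemma Ck_on_1_lipschitz:
  fixes f :: "'c::{real_inner, heine_borel} \<Rightarrow> 'd::real_normed_vector"
  assumes "open S" "Ck_on 1 S f" "x \<in> S"
  shows "\<exists>d>0. \<exists>C\<ge>0. ball x d \<subseteq> S \<and> (\<forall>y\<in>ball x d. \<forall>z\<in>ball x d. norm (f z - f y) \<le> C * norm (z - y))"
proof -
  obtain d where d: "d > 0" "ball x d \<subseteq> S"
    "\<And>y z. y\<in>ball x d \<Longrightarrow> z\<in>ball x d \<Longrightarrow> norm (f z - f y - frechet_derivative f (at x) (z - y)) \<le> 1 * norm (z - y)"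
    using Ck_on_1_strict[OF assms zero_less_one] by blast
  have "bounded_linear (frechet_derivative f (at x))"
    using Ck_on_SucD_deriv[of 0 S f x] assms has_derivative_bounded_linear by auto
  then obtain B where B: "B \<ge> 0" "\<And>v. norm (frechet_derivative f (at x) v) \<le> norm v * B"
    using bounded_linear.nonneg_bounded by blast
  have "norm (f z - f y) \<le> (B + 1) * norm (z - y)" if "y\<in>ball x d" "z\<in>ball x d" for y z
    using d(3)[OF that] B(2)[of "z - y"] norm_triangle_sub[of "f z - f y" "frechet_derivative f (at x) (z - y)"]
    by (simp add: algebra_simps)
  then show ?thesis using d B(1) by (intro exI[of _ d] conjI exI[of _ "B + 1"]) auto
qed

text \<open>Here the linear map is the derivative at the moving point \<open>y\<close>. One half of
  \<open>e\<close> pays for strict differentiability at the centre of a ball, the other for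
  replacing the derivative there by the one at \<open>y\<close>.\<close>

lemma Ck_on_1_uniform:
  fixes f :: "'c::{real_inner, heine_borel} \<Rightarrow> 'd::real_normed_vector"
  assumes "compact K" "K \<subseteq> S" "open S" "Ck_on 1 S f" "e > 0"
  shows "\<exists>d>0. \<forall>y\<in>K. \<forall>z. dist y z < d \<longrightarrow>
    z \<in> S \<and> norm (f z - f y - frechet_derivative f (at y) (z - y)) \<le> e * norm (z - y)"
proof (rule compact_uniform_nhds[OF assms(1)])
  fix x assume "x \<in> K"
  let ?D = "\<lambda>y. frechet_derivative f (at y)"
  obtain d where d: "d > 0" "ball x d \<subseteq> S"
    "\<And>y v. y\<in>ball x d \<Longrightarrow> norm (?D y v - ?D x v) \<le> e/2 * norm v"
    "\<And>y z. y\<in>ball x d \<Longrightarrow> z\<in>ball x d \<Longrightarrow> norm (f z - f y - ?D x (z - y)) \<le> e/2 * norm (z - y)"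
    using Ck_on_1_strict[OF assms(3,4) subsetD[OF assms(2) \<open>x \<in> K\<close>] half_gt_zero[OF assms(5)]] by blast
  have "norm (f z - f y - ?D y (z - y)) \<le> e * norm (z - y)"
    if "y\<in>ball x d" "z\<in>ball x d" for y z
    using d(4)[OF that] d(3)[OF that(1), of "z - y"]
      norm_triangle_ineq4[of "f z - f y - ?D x (z - y)" "?D y (z - y) - ?D x (z - y)"] by simp
  then show "\<exists>d>0. \<forall>y\<in>K. \<forall>z. y \<in> ball x d \<longrightarrow> z \<in> ball x d \<longrightarrow>
    z \<in> S \<and> norm (f z - f y - ?D y (z - y)) \<le> e * norm (z - y)"
    using d(1,2) by (intro exI[of _ d]) auto
qed

section \<open>Growth estimates and existence for differential equations\<close>

lemma vector_derivative_bound: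
  fixes z :: "real \<Rightarrow> 'b::real_normed_vector"
  assumes "convex T" "\<And>s. s \<in> T \<Longrightarrow> (z has_vector_derivative z' s) (at s within T)"
    and "\<And>s. s \<in> T \<Longrightarrow> norm (z' s) \<le> B" "s \<in> T" "t \<in> T"
  shows "norm (z s - z t) \<le> B * \<bar>s - t\<bar>"
proof -
  have "onorm (\<lambda>v. v *\<^sub>R z' s) \<le> B" if "s \<in> T" for s
    using assms(3)[OF that] onorm_scaleR_left[of "\<lambda>v::real. v" "z' s"]
    by (simp add: bounded_linear_ident onorm_id)
  then show ?thesis
    using differentiable_bound[of T z "\<lambda>s v. v *\<^sub>R z' s" B s t] assms
    by (auto simp: has_vector_derivative_def)
qed

text \<open>A substitute for Gronwall's inequality on intervals that are short compared to \<open>1 / K\<close>.\<close>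

lemma ode_growth:
  fixes z :: "real \<Rightarrow> 'b::real_normed_vector"
  assumes "convex T" "0 \<in> T" "\<And>s. s \<in> T \<Longrightarrow> \<bar>s\<bar> \<le> d"
    and "\<And>s. s \<in> T \<Longrightarrow> (z has_vector_derivative z' s) (at s within T)"
    and "\<And>s. s \<in> T \<Longrightarrow> norm (z' s) \<le> K * norm (z s) + e"
    and "0 \<le> K" "0 \<le> e" "K * d \<le> 3/4" "s \<in> T"
  shows "norm (z s) \<le> 4 * (norm (z 0) + d * e)"
proof -
  let ?C = "closed_segment 0 s"
  have C: "?C \<subseteq> T" using assms(1,2,9) by (simp add: closed_segment_subset)
  have der: "(z has_vector_derivative z' t) (at t within ?C)" if "t \<in> ?C" for t
    using has_vector_derivative_within_subset[OF assms(4) C] that C by blast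
  have "continuous_on ?C (\<lambda>t. norm (z t))"
    using der by (intro continuous_on_norm) (meson continuous_on_eq_continuous_within has_vector_derivative_continuous)
  \<comment> \<open>Up to a maximum point \<open>m\<close> of \<open>norm (z t)\<close>, the growth
    costs at most the fraction \<open>K * d \<le> 3/4\<close> of the maximum, which is absorbed on
    the left; hence the factor 4. Allowing 3/4 instead of 1/2 leaves room for the extra
    \<open>\<epsilon> * d \<le> 1/4\<close> in \<open>variational_solution\<close>.\<close>
  then obtain m where m: "m \<in> ?C" "\<And>t. t \<in> ?C \<Longrightarrow> norm (z t) \<le> norm (z m)"
    using continuous_attains_sup[of ?C "\<lambda>t. norm (z t)"] by (auto simp: compact_segment)
  have "norm (z m - z 0) \<le> (K * norm (z m) + e) * \<bar>m - 0\<bar>"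
  proof (rule vector_derivative_bound[where T = ?C])
    fix t assume t: "t \<in> ?C"
    have "norm (z' t) \<le> K * norm (z t) + e" using assms(5) C t by blast
    also have "\<dots> \<le> K * norm (z m) + e" using m(2)[OF t] assms(6) by (simp add: mult_left_mono)
    finally show "norm (z' t) \<le> K * norm (z m) + e" .
  qed (use der m in auto)
  also have "\<dots> \<le> (K * norm (z m) + e) * d"
    using assms(3)[of m] C m(1) assms(6,7) by (intro mult_left_mono) auto
  also have "\<dots> = (K * d) * norm (z m) + d * e" by (simp add: algebra_simps)
  also have "\<dots> \<le> 3/4 * norm (z m) + d * e"
    using assms(8) by (intro add_right_mono mult_right_mono) auto
  finally have "norm (z m) \<le> 4 * (norm (z 0) + d * e)"
    using norm_triangle_sub[of "z m" "z 0"] by (simp add: algebra_simps)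
  with m(2)[of s] show ?thesis by simp
qed

text \<open>The sort of \<open>'b\<close> does not entail class \<open>banach\<close>, so the integral is taken coordinatewise.\<close>

lemma antiderivative_onb:
  fixes f :: "real \<Rightarrow> 'b::{real_inner, heine_borel}"
  assumes "continuous_on {a..b} f"
  shows "\<exists>F. F t0 = c \<and> (\<forall>s\<in>{a..b}. (F has_vector_derivative f s) (at s within {a..b}))"
proof -
  define F where "F = (\<lambda>s. \<Sum>e\<in>onb. integral {a..s} (\<lambda>t. f t \<bullet> e) *\<^sub>R e)"
  have "(F has_vector_derivative f s) (at s within {a..b})" if s: "s \<in> {a..b}" for s
  proof -
    have "((\<lambda>s. integral {a..s} (\<lambda>t. f t \<bullet> e)) has_vector_derivative f s \<bullet> e) (at s within {a..b})" for e
      using assms s by (intro integral_has_vector_derivative) (auto intro!: continuous_intros)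
    then have "(F has_vector_derivative (\<Sum>e\<in>onb. (f s \<bullet> e) *\<^sub>R e)) (at s within {a..b})"
      unfolding F_def
      by (intro has_vector_derivative_sum bounded_linear.has_vector_derivative[OF bounded_linear_scaleR_left])
    then show ?thesis by (simp add: onb_expand)
  qed
  then show ?thesis
    by (intro exI[of _ "\<lambda>s. F s + (c - F t0)"]) (auto simp: has_vector_derivative_add_const)
qed

text \<open>The integral operator contracts with factor \<open>K * r \<le> 1/2\<close>. On the ball
  the field is at most \<open>M + K * \<rho>\<close>, with \<open>M\<close> bounding it at the
  centre only; over time \<open>r\<close> each summand moves the curve by at most
  \<open>\<rho>/2\<close>, so the iterate stays in the ball.\<close>

lemma picard:
  fixes g :: "real \<Rightarrow> 'b \<Rightarrow> 'b::{real_inner, heine_borel}"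
  assumes "0 \<le> r" "0 \<le> K" "K * r \<le> 1/2" "0 \<le> \<rho>" "M * r \<le> \<rho>/2"
    and cont: "continuous_on ({-r..r} \<times> cball x0 \<rho>) (\<lambda>p. g (fst p) (snd p))"
    and lip: "\<And>s w w'. s \<in> {-r..r} \<Longrightarrow> w \<in> cball x0 \<rho> \<Longrightarrow> w' \<in> cball x0 \<rho> \<Longrightarrow>
      norm (g s w - g s w') \<le> K * norm (w - w')"
    and bd: "\<And>s. s \<in> {-r..r} \<Longrightarrow> norm (g s x0) \<le> M"
  shows "\<exists>u. u 0 = x0 \<and> (\<forall>s\<in>{-r..r}. u s \<in> cball x0 \<rho> \<and>
    (u has_vector_derivative g s (u s)) (at s within {-r..r}))"
proof -
  let ?I = "{-r..r}"
  \<comment> \<open>Curves are taken on the whole line, so that the complete sup metric of bounded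
    continuous functions is available.\<close>
  define S :: "(real \<Rightarrow>\<^sub>C 'b) set" where "S = PiC UNIV (\<lambda>_. cball x0 \<rho>)"
  have S_iff: "u \<in> S \<longleftrightarrow> (\<forall>s. apply_bcontfun u s \<in> cball x0 \<rho>)" for u
    by (auto simp: S_def mem_PiC_iff)
  have "complete S"
    unfolding S_def by (simp add: complete_eq_closed closed_PiC)
  have "const_bcontfun x0 \<in> S"
    using assms(4) by (simp add: S_iff const_bcontfun.rep_eq)
  \<comment> \<open>The last clause freezes the new curve outside \<open>{-r..r}\<close>; comparing
    two images on that interval then bounds their distance as functions on the line.\<close>
  have ex: "\<exists>v. v \<in> S \<and> apply_bcontfun v 0 = x0 \<and>
      (\<forall>s\<in>?I. (apply_bcontfun v has_vector_derivative g s (apply_bcontfun u s)) (at s within ?I)) \<and>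
      (\<forall>s. apply_bcontfun v s = apply_bcontfun v (max (-r) (min r s)))" if u: "u \<in> S" for u
  proof -
    have "continuous_on ?I (\<lambda>s. g s (apply_bcontfun u s))"
    proof -
      have "continuous_on ?I (\<lambda>s. (s, apply_bcontfun u s))"
        by (intro continuous_intros continuous_on_apply_bcontfun)
      moreover have "(\<lambda>s. (s, apply_bcontfun u s)) ` ?I \<subseteq> ?I \<times> cball x0 \<rho>"
        using u by (auto simp: S_iff)
      ultimately show ?thesis
        using continuous_on_compose2[OF cont] by force
    qed
    from antiderivative_onb[OF this, of 0 x0] obtain F where F: "F 0 = x0"
      "\<And>s. s \<in> ?I \<Longrightarrow> (F has_vector_derivative g s (apply_bcontfun u s)) (at s within ?I)"
      by blast
    have F_in: "F s \<in> cball x0 \<rho>" if "s \<in> ?I" for s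
    proof -
      have "norm (F s - F 0) \<le> (M + K * \<rho>) * \<bar>s - 0\<bar>"
      proof (rule vector_derivative_bound[OF _ F(2)])
        fix t assume t: "t \<in> ?I"
        have ut: "apply_bcontfun u t \<in> cball x0 \<rho>" using u by (simp add: S_iff)
        then have "norm (g t (apply_bcontfun u t) - g t x0) \<le> K * norm (apply_bcontfun u t - x0)"
          using t assms(4) by (intro lip) auto
        also have "\<dots> \<le> K * \<rho>"
          using ut assms(2) by (intro mult_left_mono) (auto simp: dist_norm norm_minus_commute)
        finally show "norm (g t (apply_bcontfun u t)) \<le> M + K * \<rho>"
          using bd[OF t] norm_triangle_sub[of "g t (apply_bcontfun u t)" "g t x0"] by linarith
      qed (use assms(1) that in auto)
      also have "\<dots> \<le> (M + K * \<rho>) * r"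
        using that bd[of 0] assms(1,2,4) norm_ge_zero[of "g 0 x0"]
        by (intro mult_left_mono) (auto intro: add_nonneg_nonneg order_trans simp del: norm_ge_zero)
      also have "\<dots> = M * r + (K * r) * \<rho>" by (simp add: algebra_simps)
      also have "\<dots> \<le> \<rho>/2 + 1/2 * \<rho>"
        using assms(3-5) by (intro add_mono mult_right_mono) auto
      finally show ?thesis using F(1) by (simp add: dist_norm norm_minus_commute)
    qed
    have clamp: "max (-r) (min r s) \<in> ?I" for s using assms(1) by auto
    have "continuous_on ?I F"
      using F(2) by (meson continuous_on_eq_continuous_within has_vector_derivative_continuous)
    then have "continuous_on UNIV (\<lambda>s. F (max (-r) (min r s)))"
      by (rule continuous_on_compose2) (use clamp in \<open>auto intro!: continuous_intros\<close>)
    moreover have "bounded (range (\<lambda>s. F (max (-r) (min r s))))"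
      using F_in clamp by (intro bounded_subset[OF bounded_cball[of x0 \<rho>]]) blast
    ultimately have "(\<lambda>s. F (max (-r) (min r s))) \<in> bcontfun"
      by (simp add: bcontfun_def)
    then obtain v where v: "apply_bcontfun v = (\<lambda>s. F (max (-r) (min r s)))"
      using bcontfunE by metis
    have "v \<in> S" using F_in clamp by (simp only: S_iff v) blast
    moreover have "apply_bcontfun v 0 = x0" using F(1) assms(1) by (simp add: v)
    moreover have "(apply_bcontfun v has_vector_derivative g s (apply_bcontfun u s)) (at s within ?I)"
      if "s \<in> ?I" for s
      by (rule has_vector_derivative_transform[OF that _ F(2)[OF that]]) (auto simp: v)
    moreover have "apply_bcontfun v s = apply_bcontfun v (max (-r) (min r s))" for s
      using assms(1) by (simp add: v)
    ultimately show ?thesis by blast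
  qed
  then obtain \<Phi> where \<Phi>: "\<And>u. u \<in> S \<Longrightarrow> \<Phi> u \<in> S" "\<And>u. u \<in> S \<Longrightarrow> apply_bcontfun (\<Phi> u) 0 = x0"
    "\<And>u s. u \<in> S \<Longrightarrow> s \<in> ?I \<Longrightarrow> (apply_bcontfun (\<Phi> u) has_vector_derivative g s (apply_bcontfun u s)) (at s within ?I)"
    "\<And>u s. u \<in> S \<Longrightarrow> apply_bcontfun (\<Phi> u) s = apply_bcontfun (\<Phi> u) (max (-r) (min r s))"
    by metis
  have "\<exists>!u\<in>S. \<Phi> u = u"
  proof (rule Banach_fix[OF \<open>complete S\<close>, where c = "1/2"])
    fix u w assume uw: "u \<in> S" "w \<in> S"
    show "dist (\<Phi> u) (\<Phi> w) \<le> 1/2 * dist u w"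
    proof (rule dist_bound)
      fix s0 :: real
      define s where "s = max (-r) (min r s0)"
      have s: "s \<in> ?I" using assms(1) by (auto simp: s_def)
      have "norm ((apply_bcontfun (\<Phi> u) s - apply_bcontfun (\<Phi> w) s) - (apply_bcontfun (\<Phi> u) 0 - apply_bcontfun (\<Phi> w) 0))
          \<le> (K * dist u w) * \<bar>s - 0\<bar>"
      proof (rule vector_derivative_bound[where T = ?I])
        fix t assume t: "t \<in> ?I"
        show "((\<lambda>s. apply_bcontfun (\<Phi> u) s - apply_bcontfun (\<Phi> w) s) has_vector_derivative
            g t (apply_bcontfun u t) - g t (apply_bcontfun w t)) (at t within ?I)"
          by (intro has_vector_derivative_diff \<Phi> uw t)
        have "norm (g t (apply_bcontfun u t) - g t (apply_bcontfun w t)) \<le> K * norm (apply_bcontfun u t - apply_bcontfun w t)"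
          using uw t S_iff by (intro lip) auto
        also have "\<dots> \<le> K * dist u w"
          using dist_bounded[of u t w] assms(2) by (intro mult_left_mono) (auto simp: dist_norm)
        finally show "norm (g t (apply_bcontfun u t) - g t (apply_bcontfun w t)) \<le> K * dist u w" .
      qed (use s assms(1) in auto)
      then have "norm (apply_bcontfun (\<Phi> u) s - apply_bcontfun (\<Phi> w) s) \<le> (K * dist u w) * \<bar>s\<bar>"
        by (simp add: \<Phi>(2) uw)
      also have "\<dots> \<le> (K * dist u w) * r"
        using s assms(2) by (intro mult_left_mono) auto
      also have "\<dots> = (K * r) * dist u w" by simp
      also have "\<dots> \<le> 1/2 * dist u w"
        using assms(3) by (intro mult_right_mono) auto
      finally show "dist (apply_bcontfun (\<Phi> u) s0) (apply_bcontfun (\<Phi> w) s0) \<le> 1/2 * dist u w"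
        using \<Phi>(4)[OF uw(1), of s0] \<Phi>(4)[OF uw(2), of s0] by (simp add: dist_norm s_def)
    qed
  qed (use \<open>const_bcontfun x0 \<in> S\<close> \<Phi>(1) in auto)
  then obtain u where u: "u \<in> S" "\<Phi> u = u" by blast
  show ?thesis
    using \<Phi>(2)[OF u(1)] \<Phi>(3)[OF u(1)] u S_iff
    by (intro exI[of _ "apply_bcontfun u"]) auto
qed

section \<open>Smooth dependence on parameters\<close>

lemma mult_divide_double: "m > 0 \<Longrightarrow> m * (x / (2 * m)) = x / (2 :: real)"
  by simp

text \<open>Difference quotients along small multiples of \<open>w\<close> inherit the Lipschitz
  bound. Hence the variational equation, whose state enters through this derivative, has the same
  constant \<open>K\<close>.\<close>

lemma lipschitz_imp_norm_derivative_le: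
  fixes G :: "'p::real_normed_vector \<times> 'b::real_normed_vector \<Rightarrow> 'c::real_normed_vector"
  assumes "open Q" "(p, a) \<in> Q" "(G has_derivative D) (at (p, a))" "0 \<le> K"
    and lip: "\<And>b. (p, b) \<in> Q \<Longrightarrow> norm (G (p, b) - G (p, a)) \<le> K * norm (b - a)"
  shows "norm (D (0, w)) \<le> K * norm w"
proof (rule field_le_epsilon)
  fix e :: real assume "e > 0"
  define c where "c = e / (norm w + 1)"
  have "c > 0" using \<open>e > 0\<close> by (simp add: c_def add_nonneg_pos)
  obtain d1 where d1: "d1 > 0" "ball (p, a) d1 \<subseteq> Q"
    using assms(1,2) openE by blast
  obtain d2 where d2: "d2 > 0" "\<And>y. norm (y - (p, a)) < d2 \<Longrightarrow>
      norm (G y - G (p, a) - D (y - (p, a))) \<le> c * norm (y - (p, a))"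
    using assms(3) \<open>c > 0\<close> unfolding has_derivative_at_alt by blast
  \<comment> \<open>The multiple \<open>t\<close> brings the test point within both radii; the added
    1 admits \<open>w = 0\<close>.\<close>
  define t where "t = min d1 d2 / (2 * (norm w + 1))"
  have t: "t > 0" using d1(1) d2(1) by (simp add: t_def add_nonneg_pos)
  have "t * (norm w + 1) = min d1 d2 / 2"
    using mult_divide_double[of "norm w + 1" "min d1 d2"] by (simp only: t_def mult.commute add_nonneg_pos norm_ge_zero zero_less_one)
  moreover have "t * norm w \<le> t * (norm w + 1)" using t by simp
  ultimately have small: "t * norm w < min d1 d2" using d1(1) d2(1) by linarith
  let ?y = "(p, a + t *\<^sub>R w)"
  have y: "?y - (p, a) = t *\<^sub>R (0, w)" by simp
  have ny: "norm (?y - (p, a)) = t * norm w" using t by (simp add: norm_Pair)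
  have "?y \<in> Q" using small d1 ny by (auto simp: dist_norm norm_minus_commute)
  then have "norm (G ?y - G (p, a)) \<le> K * (t * norm w)" using lip[of "a + t *\<^sub>R w"] t by simp
  moreover have "norm (G ?y - G (p, a) - D (t *\<^sub>R (0, w))) \<le> c * (t * norm w)"
    using d2(2)[of ?y] small unfolding ny unfolding y by simp
  ultimately have "norm (D (t *\<^sub>R (0, w))) \<le> K * (t * norm w) + c * (t * norm w)"
    using norm_triangle_ineq4[of "G ?y - G (p, a)" "G ?y - G (p, a) - D (t *\<^sub>R (0, w))"] by simp
  then have "t * norm (D (0, w)) \<le> t * (K * norm w + c * norm w)"
    using linear_scale[OF has_derivative_linear[OF assms(3)], of t "(0, w)"] t by (simp add: algebra_simps)
  then have "norm (D (0, w)) \<le> K * norm w + c * norm w" using t by simp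
  also have "c * norm w \<le> e"
  proof -
    have "c * norm w \<le> c * (norm w + 1)" using \<open>c > 0\<close> by simp
    also have "\<dots> = e" using add_nonneg_pos[OF norm_ge_zero zero_less_one, of w] by (simp add: c_def)
    finally show ?thesis .
  qed
  finally show "norm (D (0, w)) \<le> K * norm w + e" by simp
qed

lemma diff_eq_diff_add_diff: "a - c = (a - b) + (b - c)" for a b c :: "'a::ab_group_add"
  by simp

lemma norm_le_sum: "a = b + c \<Longrightarrow> norm b \<le> B \<Longrightarrow> norm c \<le> C \<Longrightarrow> norm a \<le> B + C"
  by (simp add: norm_triangle_mono)

text \<open>The right-hand side may depend on parameter and time even if the original field does
  not, because the variational equation does. The solution \<open>u\<close> is part of the data,
  which separates regularity from existence; the bound on \<open>K * d\<close> makes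
  \<open>ode_growth\<close> applicable.\<close>

locale parametric_ode =
  fixes W :: "'p::{real_inner, heine_borel} set" and d K :: real
    and Q :: "(('p \<times> real) \<times> 'b::{real_inner, heine_borel}) set"
    and G :: "('p \<times> real) \<times> 'b \<Rightarrow> 'b" and h :: "'p \<Rightarrow> 'b" and u :: "'p \<times> real \<Rightarrow> 'b"
  assumes open_W: "open W" and open_Q: "open Q"
    and d_pos: "0 < d" and K_nonneg: "0 \<le> K" and Kd: "K * d \<le> 1/2"
    and lip: "\<And>p a b. (p, a) \<in> Q \<Longrightarrow> (p, b) \<in> Q \<Longrightarrow> norm (G (p, a) - G (p, b)) \<le> K * norm (a - b)"
    and in_Q: "\<And>y s. y \<in> W \<Longrightarrow> \<bar>s\<bar> < d \<Longrightarrow> ((y, s), u (y, s)) \<in> Q"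
    and ode: "\<And>y s. y \<in> W \<Longrightarrow> \<bar>s\<bar> < d \<Longrightarrow>
      ((\<lambda>s. u (y, s)) has_vector_derivative G ((y, s), u (y, s))) (at s)"
    and init: "\<And>y. y \<in> W \<Longrightarrow> u (y, 0) = h y"
begin

section \<open>Continuity of solutions in parameter and time\<close>

lemma continuous_time: "y \<in> W \<Longrightarrow> r < d \<Longrightarrow> continuous_on {-r..r} (\<lambda>s. u (y, s))"
  using has_vector_derivative_continuous[OF ode] by (intro continuous_at_imp_continuous_on) auto

lemma compact_graph: "y \<in> W \<Longrightarrow> r < d \<Longrightarrow> compact ((\<lambda>s. ((y, s), u (y, s))) ` {-r..r})"
  by (intro compact_continuous_image continuous_intros continuous_time) auto

lemma graph_subset: "y \<in> W \<Longrightarrow> r < d \<Longrightarrow> (\<lambda>s. ((y, s), u (y, s))) ` {-r..r} \<subseteq> Q"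
  by (auto intro!: in_Q)

text \<open>The graph over the closed interval \<open>{-r..r}\<close> is compact, which makes the
  effect of the parameter on \<open>G\<close> uniform in time; \<open>ode_growth\<close> converts it
  into closeness of the solutions.\<close>

lemma uniformly_continuous_param:
  assumes "continuous_on Q G" "continuous_on W h" "y0 \<in> W" "0 \<le> r" "r < d" "e > 0"
  shows "\<exists>c>0. \<forall>y. dist y y0 < c \<longrightarrow> y \<in> W \<and> (\<forall>s\<in>{-r..r}. norm (u (y, s) - u (y0, s)) \<le> e)"
proof -
  \<comment> \<open>An initial error \<open>c\<close> and a forcing error \<open>c\<close> yield
    \<open>4 * (c + d * c) = e\<close> in \<open>ode_growth\<close>.\<close>
  define c where "c = e / (4 * (1 + d))"
  have "c > 0" using assms(6) d_pos by (simp add: c_def)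
  obtain c1 where c1: "c1 > 0" "\<And>s z. s \<in> {-r..r} \<Longrightarrow> dist ((y0, s), u (y0, s)) z < c1 \<Longrightarrow>
      z \<in> Q \<and> dist (G z) (G ((y0, s), u (y0, s))) \<le> c"
    using continuous_uniform_near_compact[OF compact_graph[OF assms(3,5)] graph_subset[OF assms(3,5)]
        open_Q assms(1) \<open>c > 0\<close>] by auto
  obtain c2 where c2: "c2 > 0" "\<And>y. dist y y0 < c2 \<Longrightarrow> y \<in> W \<and> dist (h y) (h y0) \<le> c"
    using continuous_uniform_near_compact[of "{y0}", OF _ _ open_W assms(2) \<open>c > 0\<close>] assms(3)
    by (auto simp: dist_commute)
  have "y \<in> W \<and> (\<forall>s\<in>{-r..r}. norm (u (y, s) - u (y0, s)) \<le> e)" if y: "dist y y0 < min c1 c2" for y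
  proof (intro conjI ballI)
    show "y \<in> W" using c2(2)[of y] y by simp
    fix s assume s: "s \<in> {-r..r}"
    have "norm (u (y, s) - u (y0, s)) \<le> 4 * (norm (u (y, 0) - u (y0, 0)) + d * c)"
    proof (rule ode_growth[where T = "{-r..r}" and z = "\<lambda>s. u (y, s) - u (y0, s)" and K = K])
      fix t assume t: "t \<in> {-r..r}"
      then have td: "\<bar>t\<bar> < d" using assms(5) by auto
      show "\<bar>t\<bar> \<le> d" using td by simp
      show "((\<lambda>s. u (y, s) - u (y0, s)) has_vector_derivative
          G ((y, t), u (y, t)) - G ((y0, t), u (y0, t))) (at t within {-r..r})"
        by (intro has_vector_derivative_at_within[OF has_vector_derivative_diff] ode td \<open>y \<in> W\<close> assms(3))
      \<comment> \<open>The intermediate point has the new parameter but the old state: the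
        parameter change costs \<open>c\<close>, the state change is covered by the Lipschitz
        bound.\<close>
      have "dist ((y0, t), u (y0, t)) ((y, t), u (y0, t)) < c1"
        using y by (simp add: dist_Pair_Pair dist_commute)
      then have 1: "((y, t), u (y0, t)) \<in> Q"
        "norm (G ((y, t), u (y0, t)) - G ((y0, t), u (y0, t))) \<le> c"
        using c1(2)[OF t] by (auto simp: dist_norm)
      have "norm (G ((y, t), u (y, t)) - G ((y, t), u (y0, t))) \<le> K * norm (u (y, t) - u (y0, t))"
        by (intro lip in_Q 1 \<open>y \<in> W\<close> td)
      with 1(2) show "norm (G ((y, t), u (y, t)) - G ((y0, t), u (y0, t))) \<le> K * norm (u (y, t) - u (y0, t)) + c"
        using norm_triangle_ineq[of "G ((y, t), u (y, t)) - G ((y, t), u (y0, t))" "G ((y, t), u (y0, t)) - G ((y0, t), u (y0, t))"]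
        by simp
    qed (use s assms(4) Kd K_nonneg \<open>c > 0\<close> in auto)
    also have "\<dots> \<le> 4 * (c + d * c)"
      using c2(2)[of y] y by (simp add: init \<open>y \<in> W\<close> assms(3) dist_norm)
    also have "\<dots> = e / (4 * (1 + d)) * (4 * (1 + d))" by (simp only: c_def algebra_simps)
    also have "\<dots> = e" using d_pos by (subst times_divide_eq_left, intro nonzero_mult_div_cancel_right) auto
    finally show "norm (u (y, s) - u (y0, s)) \<le> e" .
  qed
  then show ?thesis using c1(1) c2(1) by (intro exI[of _ "min c1 c2"]) auto
qed

lemma continuous_solution:
  assumes "continuous_on Q G" "continuous_on W h"
  shows "continuous_on (W \<times> {-d<..<d}) u"
proof (rule continuous_at_imp_continuous_on, clarify)
  fix y0 s0 assume *: "y0 \<in> W" "s0 \<in> {-d<..<d}"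
  then have "\<bar>s0\<bar> < d" by auto
  then obtain r where r: "\<bar>s0\<bar> < r" "r < d" using dense by blast
  then have "0 \<le> r" by linarith
  show "isCont u (y0, s0)"
    unfolding continuous_at_eps_delta
  proof (intro allI impI)
    fix e :: real assume "e > 0"
    obtain c where c: "c > 0" "\<And>y s. dist y y0 < c \<Longrightarrow> s \<in> {-r..r} \<Longrightarrow> norm (u (y, s) - u (y0, s)) \<le> e/3"
      using uniformly_continuous_param[OF assms *(1), of r "e/3"] r \<open>0 \<le> r\<close> \<open>e > 0\<close> by auto
    have "isCont (\<lambda>s. u (y0, s)) s0"
      using has_vector_derivative_continuous[OF ode[OF *(1) \<open>\<bar>s0\<bar> < d\<close>]] .
    then obtain c' where c': "c' > 0" "\<And>s. dist s s0 < c' \<Longrightarrow> dist (u (y0, s)) (u (y0, s0)) < e/3"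
      unfolding continuous_at_eps_delta using \<open>e > 0\<close> by (metis divide_pos_pos zero_less_numeral)
    have "dist (u x) (u (y0, s0)) < e" if x: "dist x (y0, s0) < min (min c c') (r - \<bar>s0\<bar>)" for x
    proof (cases x)
      case (Pair y s)
      have ys: "dist y y0 < c" "dist s s0 < c'" "\<bar>s - s0\<bar> < r - \<bar>s0\<bar>"
        using x Pair dist_fst_le[of x "(y0, s0)"] dist_snd_le[of x "(y0, s0)"]
        by (auto simp: dist_real_def)
      then have "s \<in> {-r..r}" by auto
      then show ?thesis
        using c(2)[OF ys(1) \<open>s \<in> {-r..r}\<close>] c'(2)[OF ys(2)] \<open>e > 0\<close> dist_triangle[of "u (y, s)" "u (y0, s0)" "u (y0, s)"]
        by (simp add: Pair dist_norm)
    qed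
    then show "\<exists>c>0. \<forall>x. dist x (y0, s0) < c \<longrightarrow> dist (u x) (u (y0, s0)) < e"
      using c(1) c'(1) r(1) by (intro exI[of _ "min (min c c') (r - \<bar>s0\<bar>)"]) auto
  qed
qed

section \<open>The variational equation\<close>

lemma norm_DG_state_le:
  assumes "Ck_on 1 Q G" "(p, a) \<in> Q"
  shows "norm (frechet_derivative G (at (p, a)) (0, w)) \<le> K * norm w"
proof (rule lipschitz_imp_norm_derivative_le[OF open_Q assms(2)])
  show "(G has_derivative frechet_derivative G (at (p, a))) (at (p, a))"
    using Ck_on_SucD_deriv[of 0 Q G] assms by simp
qed (use K_nonneg lip assms(2) in auto)

text \<open>With \<open>v = y' - y\<close>, the remainder
  \<open>u (y', s) - u (y, s) - z v s\<close> solves the homogeneous linearised equation up to an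
  error that is small compared to \<open>norm v\<close> and to the remainder itself, and its initial
  value is small compared to \<open>norm v\<close>. The growth estimate keeps it so for later
  times.\<close>

lemma variational_solution:
  assumes G: "Ck_on 1 Q G" and h: "Ck_on 1 W h" and "y \<in> W" "0 \<le> r" "r < d"
    and z: "\<And>v s. s \<in> {-r..r} \<Longrightarrow>
      (z v has_vector_derivative frechet_derivative G (at ((y, s), u (y, s))) ((v, 0), z v s)) (at s within {-r..r})"
    and z0: "\<And>v. z v 0 = frechet_derivative h (at y) v"
    and s: "s \<in> {-r..r}"
  shows "((\<lambda>y. u (y, s)) has_derivative (\<lambda>v. z v s)) (at y)"
proof -
  let ?I = "{-r..r}" and ?c = "\<lambda>s. ((y, s), u (y, s))"
  let ?D = "\<lambda>s. frechet_derivative G (at (?c s))"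
  let ?H = "frechet_derivative h (at y)"
  have I: "\<bar>t\<bar> < d" "\<bar>t\<bar> \<le> d" "?c t \<in> Q" if "t \<in> ?I" for t
    using that in_Q[OF \<open>y \<in> W\<close>, of t] \<open>r < d\<close> by auto
  have D: "(G has_derivative ?D t) (at (?c t))" if "t \<in> ?I" for t
    using Ck_on_SucD_deriv[of 0 Q G] G I(3)[OF that] by simp
  have H: "(h has_derivative ?H) (at y)"
    using Ck_on_SucD_deriv[of 0 W h] h \<open>y \<in> W\<close> by simp
  have D_split: "?D t ((v, 0), w) = ?D t ((v, 0), 0) + ?D t (0, w)" if "t \<in> ?I" for t v w
    using linear_add[OF has_derivative_linear[OF D[OF that]], of "((v, 0), 0)" "(0, w)"]
    by (simp add: zero_prod_def)
  have D_le: "norm (?D t (0, w)) \<le> K * norm w" if "t \<in> ?I" for t w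
    using norm_DG_state_le[OF G] I(3)[OF that] by blast
  have zero_ex: "0 \<in> ?I" using \<open>0 \<le> r\<close> by auto

  \<comment> \<open>The constant \<open>K\<close> controls the state direction only. The parameter
    direction is bounded through compactness of the time interval, one basis vector at a
    time.\<close>
  obtain M where M: "M \<ge> 0" "\<And>t v. t \<in> ?I \<Longrightarrow> norm (?D t ((v, 0), 0)) \<le> M * norm v"
  proof -
    have "\<exists>B. \<forall>t\<in>?I. norm (?D t ((b, 0), 0)) \<le> B" for b
    proof -
      have "continuous_on Q (\<lambda>q. frechet_derivative G (at q) ((b, 0), 0))"
        using G by simp
      then have "continuous_on ?I (\<lambda>t. ?D t ((b, 0), 0))"
        by (rule continuous_on_compose2)
           (use I in \<open>auto intro!: continuous_intros continuous_time \<open>y \<in> W\<close> \<open>r < d\<close>\<close>)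
      then have "bounded ((\<lambda>t. ?D t ((b, 0), 0)) ` ?I)"
        by (intro compact_imp_bounded compact_continuous_image) auto
      then show ?thesis by (auto simp: bounded_iff)
    qed
    then obtain B where B: "\<And>b t. t \<in> ?I \<Longrightarrow> norm (?D t ((b, 0), 0)) \<le> B b" by metis
    have "norm (?D t ((v, 0), 0)) \<le> (\<Sum>b\<in>onb. \<bar>B b\<bar>) * norm v" if t: "t \<in> ?I" for t v
    proof -
      have "linear (\<lambda>v. ?D t ((v, 0), 0))"
        by (rule linear_compose[of "\<lambda>v. ((v, 0), 0)", unfolded o_def])
           (auto intro!: linearI has_derivative_linear[OF D[OF t]])
      then have "?D t ((v, 0), 0) = (\<Sum>b\<in>onb. (v \<bullet> b) *\<^sub>R ?D t ((b, 0), 0))"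
        by (rule linear_onb_expand[symmetric])
      also have "norm \<dots> \<le> (\<Sum>b\<in>(onb :: 'p set). norm v * \<bar>B b\<bar>)"
      proof (rule sum_norm_le)
        fix b :: 'p assume b: "b \<in> onb"
        have "\<bar>v \<bullet> b\<bar> \<le> norm v" using Cauchy_Schwarz_ineq2[of v b] norm_onb[OF b] by simp
        then show "norm ((v \<bullet> b) *\<^sub>R ?D t ((b, 0), 0)) \<le> norm v * \<bar>B b\<bar>"
          using B[OF t, of b] by (simp add: mult_mono)
      qed
      finally show ?thesis unfolding sum_distrib_left[symmetric] by (simp add: mult.commute)
    qed
    then show ?thesis by (intro that[of "\<Sum>b\<in>onb. \<bar>B b\<bar>"]) (auto simp: sum_nonneg)
  qed
  obtain N where N: "N \<ge> 0" "\<And>v. norm (?H v) \<le> N * norm v"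
    using bounded_linear.nonneg_bounded[OF has_derivative_bounded_linear[OF H]] by (metis mult.commute)

  define C where "C = 4 * (N + d * M)"
  have C: "C \<ge> 0" using N(1) M(1) d_pos by (simp add: C_def)
  have z_le: "norm (z v t) \<le> C * norm v" if t: "t \<in> ?I" for v t
  proof -
    have "norm (z v t) \<le> 4 * (norm (z v 0) + d * (M * norm v))"
    proof (rule ode_growth[where T = ?I and K = K])
      fix t assume t: "t \<in> ?I"
      show "norm (?D t ((v, 0), z v t)) \<le> K * norm (z v t) + M * norm v"
        using D_split[OF t] D_le[OF t, of "z v t"] M(2)[OF t, of v] norm_triangle_ineq
        by (smt (verit))
    qed (use I z t zero_ex Kd K_nonneg M(1) in auto)
    also have "\<dots> \<le> 4 * (N * norm v + d * (M * norm v))"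
      using N(2)[of v] by (simp add: z0)
    finally show ?thesis by (simp add: C_def algebra_simps)
  qed
  \<comment> \<open>Uniqueness for the homogeneous equation is \<open>ode_growth\<close> without
    error term. It forces \<open>z\<close> to be linear in the direction \<open>v\<close>, although
    the \<open>z v\<close> were given separately.\<close>
  have zero: "w t = 0" if t: "t \<in> ?I" and w0: "w 0 = 0"
    and w: "\<And>t. t \<in> ?I \<Longrightarrow> (w has_vector_derivative ?D t (0, w t)) (at t within ?I)" for w t
    using ode_growth[of ?I d w "\<lambda>t. ?D t (0, w t)" K 0 t] I D_le w w0 t zero_ex Kd K_nonneg by auto
  have lin: "linear (\<lambda>v. z v s)"
  proof
    fix a b
    have "(\<lambda>t. z (a + b) t - z a t - z b t) s = 0"
    proof (rule zero[OF s])
      show "z (a + b) 0 - z a 0 - z b 0 = 0"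
        by (simp add: z0 linear_add[OF has_derivative_linear[OF H]])
      fix t assume t: "t \<in> ?I"
      have "?D t (0, z (a + b) t - z a t - z b t) =
          ?D t ((a + b, 0), z (a + b) t) - ?D t ((a, 0), z a t) - ?D t ((b, 0), z b t)"
        by (simp add: linear_diff[OF has_derivative_linear[OF D[OF t]], symmetric] zero_prod_def)
      then show "((\<lambda>t. z (a + b) t - z a t - z b t) has_vector_derivative
          ?D t (0, z (a + b) t - z a t - z b t)) (at t within ?I)"
        by (simp only:) (intro has_vector_derivative_diff z t)
    qed
    then show "z (a + b) s = z a s + z b s" by (simp add: algebra_simps)
  next
    fix c :: real and b
    have "(\<lambda>t. z (c *\<^sub>R b) t - c *\<^sub>R z b t) s = 0"
    proof (rule zero[OF s])
      show "z (c *\<^sub>R b) 0 - c *\<^sub>R z b 0 = 0"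
        by (simp add: z0 linear_scale[OF has_derivative_linear[OF H]])
      fix t assume t: "t \<in> ?I"
      have "?D t (0, z (c *\<^sub>R b) t - c *\<^sub>R z b t) = ?D t ((c *\<^sub>R b, 0), z (c *\<^sub>R b) t) - c *\<^sub>R ?D t ((b, 0), z b t)"
        by (simp add: linear_diff[OF has_derivative_linear[OF D[OF t]], symmetric]
            linear_scale[OF has_derivative_linear[OF D[OF t]], symmetric] zero_prod_def)
      then show "((\<lambda>t. z (c *\<^sub>R b) t - c *\<^sub>R z b t) has_vector_derivative
          ?D t (0, z (c *\<^sub>R b) t - c *\<^sub>R z b t)) (at t within ?I)"
        by (simp only:) (intro has_vector_derivative_diff bounded_linear.has_vector_derivative[OF bounded_linear_scaleR_right] z t)
    qed
    then show "z (c *\<^sub>R b) s = c *\<^sub>R z b s" by simp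
  qed
  show ?thesis
    unfolding has_derivative_at_alt
  proof (intro conjI allI impI)
    show "bounded_linear (\<lambda>v. z v s)"
      using linear_add[OF lin] linear_scale[OF lin] z_le[OF s]
      by (intro bounded_linear_intro[where K = C]) (simp_all add: mult.commute)
    fix e :: real assume "e > 0"
    \<comment> \<open>The first entry keeps \<open>(K + \<epsilon>) * d \<le> 3/4\<close>; the
      second makes the final estimate at most \<open>e * norm v\<close>.\<close>
    define \<epsilon> where "\<epsilon> = min (1 / (4 * d)) (e / (4 * (1 + d * (1 + C))))"
    have pos: "0 < 4 * (1 + d * (1 + C))" using d_pos C by (simp add: add_pos_nonneg)
    have \<epsilon>: "\<epsilon> > 0" "\<epsilon> * d \<le> 1/4" "4 * (\<epsilon> + d * (\<epsilon> * (1 + C))) \<le> e"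
    proof -
      show "\<epsilon> > 0" using \<open>e > 0\<close> d_pos pos by (simp add: \<epsilon>_def)
      have "\<epsilon> * d \<le> 1 / (4 * d) * d" using d_pos by (intro mult_right_mono) (auto simp: \<epsilon>_def)
      then show "\<epsilon> * d \<le> 1/4" using d_pos by simp
      have "\<epsilon> * (4 * (1 + d * (1 + C))) \<le> e / (4 * (1 + d * (1 + C))) * (4 * (1 + d * (1 + C)))"
        using pos by (intro mult_right_mono) (auto simp: \<epsilon>_def)
      also have "\<dots> = e" using pos by simp
      finally show "4 * (\<epsilon> + d * (\<epsilon> * (1 + C))) \<le> e" by (simp add: algebra_simps)
    qed
    obtain c1 where c1: "c1 > 0" "\<And>t x. t \<in> ?I \<Longrightarrow> dist (?c t) x < c1 \<Longrightarrow>
        x \<in> Q \<and> norm (G x - G (?c t) - ?D t (x - ?c t)) \<le> \<epsilon> * norm (x - ?c t)"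
      using Ck_on_1_uniform[OF compact_graph[OF \<open>y \<in> W\<close> \<open>r < d\<close>] graph_subset[OF \<open>y \<in> W\<close> \<open>r < d\<close>]
          open_Q G \<epsilon>(1)] by auto
    obtain c2 where c2: "c2 > 0" "\<And>y' t. dist y' y < c2 \<Longrightarrow> y' \<in> W"
        "\<And>y' t. dist y' y < c2 \<Longrightarrow> t \<in> ?I \<Longrightarrow> norm (u (y', t) - u (y, t)) \<le> c1/3"
      using uniformly_continuous_param[OF Ck_on_imp_continuous_on[OF G] Ck_on_imp_continuous_on[OF h]
          \<open>y \<in> W\<close> \<open>0 \<le> r\<close> \<open>r < d\<close>, of "c1/3"] c1(1) by auto
    obtain c3 where c3: "c3 > 0" "\<And>y'. norm (y' - y) < c3 \<Longrightarrow> norm (h y' - h y - ?H (y' - y)) \<le> \<epsilon> * norm (y' - y)"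
      using H \<epsilon>(1) unfolding has_derivative_at_alt by blast
    have "norm (u (y', s) - u (y, s) - z (y' - y) s) \<le> e * norm (y' - y)"
      if y': "norm (y' - y) < min (c1/3) (min c2 c3)" for y'
    proof -
      define v where "v = y' - y"
      have "y' \<in> W" using c2(2)[of y'] y' by (simp add: dist_norm)
      let ?\<rho> = "\<lambda>t. u (y', t) - u (y, t) - z v t"
      have "norm (?\<rho> s) \<le> 4 * (norm (?\<rho> 0) + d * (\<epsilon> * (1 + C) * norm v))"
      proof (rule ode_growth[where T = ?I and K = "K + \<epsilon>"])
        fix t assume t: "t \<in> ?I"
        let ?x = "((y', t), u (y', t))"
        show "(?\<rho> has_vector_derivative G ?x - G (?c t) - ?D t ((v, 0), z v t)) (at t within ?I)"
          by (intro has_vector_derivative_diff has_vector_derivative_at_within[OF ode] z t I \<open>y' \<in> W\<close> \<open>y \<in> W\<close>)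
        have x: "?x - ?c t = ((v, 0), u (y', t) - u (y, t))" by (simp add: v_def)
        have nx: "norm (?x - ?c t) \<le> norm v + norm (u (y', t) - u (y, t))"
          unfolding x using norm_Pair_le[of "(v, 0)" "u (y', t) - u (y, t)"] norm_Pair_le[of v "0::real"]
          by simp
        also have "\<dots> < c1"
          using y' c2(3)[of y' t] t c1(1) by (simp add: v_def dist_norm)
        finally have "dist (?c t) ?x < c1" by (simp only: dist_norm norm_minus_commute)
        from c1(2)[OF t this] have "norm (G ?x - G (?c t) - ?D t (?x - ?c t)) \<le> \<epsilon> * norm (?x - ?c t)" ..
        also have "\<dots> \<le> \<epsilon> * (norm v + norm (u (y', t) - u (y, t)))"
          using nx \<epsilon>(1) by simp
        \<comment> \<open>The increment of \<open>u\<close> is the remainder plus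
          \<open>z v t\<close>. The resulting multiple of the remainder enlarges the growth rate
          from \<open>K\<close> to \<open>K + \<epsilon>\<close>; the rest is a multiple of
          \<open>norm v\<close>.\<close>
        also have "\<dots> \<le> \<epsilon> * (norm v + (norm (?\<rho> t) + C * norm v))"
          using \<epsilon>(1) z_le[OF t, of v] norm_triangle_sub[of "u (y', t) - u (y, t)" "z v t"] by simp
        finally have R: "norm (G ?x - G (?c t) - ?D t (?x - ?c t)) \<le> \<epsilon> * norm (?\<rho> t) + \<epsilon> * (1 + C) * norm v"
          by (simp add: algebra_simps)
        have "?D t (?x - ?c t) - ?D t ((v, 0), z v t) = ?D t (0, ?\<rho> t)"
          unfolding x by (simp add: linear_diff[OF has_derivative_linear[OF D[OF t]], symmetric] zero_prod_def)
        then have "G ?x - G (?c t) - ?D t ((v, 0), z v t) = (G ?x - G (?c t) - ?D t (?x - ?c t)) + ?D t (0, ?\<rho> t)"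
          by (rule subst) (rule diff_eq_diff_add_diff)
        from norm_le_sum[OF this R D_le[OF t]]
        show "norm (G ?x - G (?c t) - ?D t ((v, 0), z v t)) \<le> (K + \<epsilon>) * norm (?\<rho> t) + \<epsilon> * (1 + C) * norm v"
          by (simp only: distrib_right add_ac)
        show "\<bar>t\<bar> \<le> d" using I[OF t] by simp
      qed (use s zero_ex Kd K_nonneg \<epsilon> C in \<open>auto simp: distrib_right\<close>)
      also have "\<dots> \<le> 4 * (\<epsilon> * norm v + d * (\<epsilon> * (1 + C) * norm v))"
        using c3(2)[of y'] y' by (simp add: init \<open>y' \<in> W\<close> \<open>y \<in> W\<close> z0 v_def)
      also have "\<dots> = 4 * (\<epsilon> + d * (\<epsilon> * (1 + C))) * norm v" by (simp add: algebra_simps)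
      also have "\<dots> \<le> e * norm v" using \<epsilon>(3) by (rule mult_right_mono) simp
      finally show ?thesis by (simp add: v_def)
    qed
    then show "\<exists>c>0. \<forall>y'. norm (y' - y) < c \<longrightarrow> norm (u (y', s) - u (y, s) - z (y' - y) s) \<le> e * norm (y' - y)"
      using c1(1) c2(1) c3(1) by (intro exI[of _ "min (c1/3) (min c2 c3)"]) auto
  qed
qed

end


text \<open>\<open>W\<close> and \<open>K\<close> stay fixed in the induction since the variational
  equation keeps them. Its state domain becomes the whole space, because it is linear, and its time
  interval shrinks to \<open>r < d\<close>, where closed intervals give solutions and bounds;
  locality restores the full interval.\<close>

lemma parametric_ode_Ck:
  fixes u :: "'p::{real_inner, heine_borel} \<times> real \<Rightarrow> 'b::{real_inner, heine_borel}"
  assumes "parametric_ode W d K Q G h u" "Ck_on n Q G" "Ck_on n W h"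
  shows "Ck_on n (W \<times> {-d<..<d}) u"
  using assms
proof (induction n arbitrary: d Q G h u)
  case 0
  then show ?case by (simp add: parametric_ode.continuous_solution)
next
  case (Suc n)
  interpret parametric_ode W d K Q G h u by fact
  let ?P = "W \<times> {-d<..<d}"
  let ?D = "\<lambda>p. frechet_derivative G (at (p, u p))"
  have G1: "Ck_on 1 Q G" and h1: "Ck_on 1 W h"
    using Suc.prems(2,3) by (auto intro: Ck_on_mono simp del: Ck_on.simps)
  \<comment> \<open>The coefficients of the variational equation contain \<open>u\<close>, so the
    induction hypothesis is first applied to the original equation.\<close>
  have Pu: "Ck_on n ?P u"
    by (rule Suc.IH[OF Suc.prems(1) Ck_on_SucD[OF Suc.prems(2)] Ck_on_SucD[OF Suc.prems(3)]])
  have openP: "open ?P" and openP': "open (?P \<times> (UNIV :: 'b set))"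
    by (auto intro!: open_Times open_W)
  have inQ: "(p, u p) \<in> Q" if "p \<in> ?P" for p
    using that in_Q by (cases p) auto
  have lin: "linear (?D p)" if "p \<in> ?P" for p
    using Ck_on_SucD_deriv[OF Suc.prems(2) inQ[OF that]] has_derivative_linear by blast
  define Gt where "Gt = (\<lambda>v (q :: ('p \<times> real) \<times> 'b). ?D (fst q) ((v, 0), snd q))"
  have Gt: "Ck_on n (?P \<times> UNIV) (Gt v)" for v
  proof -
    have c: "Ck_on n (?P \<times> (UNIV :: 'b set)) (\<lambda>q. (fst q, u (fst q)))"
      by (intro Ck_on_Pair openP' Ck_on_bounded_linear bounded_linear_fst Ck_on_compose[OF openP' openP _ Pu]) auto
    have D: "Ck_on n (?P \<times> (UNIV :: 'b set)) (\<lambda>q. ?D (fst q) w)" for w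
    proof (rule Ck_on_compose[OF openP' open_Q c])
      show "Ck_on n Q (\<lambda>q. frechet_derivative G (at q) w)"
        using Suc.prems(2) unfolding Ck_on.simps by blast
    qed (use inQ in auto)
    \<comment> \<open>The state enters linearly; its expansion leaves derivatives of
      \<open>G\<close> in fixed directions only.\<close>
    have "Ck_on n (?P \<times> (UNIV :: 'b set)) (\<lambda>q. ?D (fst q) ((v, 0), 0) + (\<Sum>e\<in>onb. (snd q \<bullet> e) *\<^sub>R ?D (fst q) ((0, 0), e)))"
      by (intro Ck_on_add Ck_on_sum Ck_on_scaleR D openP'
          Ck_on_bounded_linear bounded_linear_compose[OF bounded_linear_inner_left bounded_linear_snd, unfolded o_def])
    moreover have "?D (fst q) ((v, 0), 0) + (\<Sum>e\<in>onb. (snd q \<bullet> e) *\<^sub>R ?D (fst q) ((0, 0), e)) = Gt v q"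
      if q: "q \<in> ?P \<times> UNIV" for q
    proof -
      have l: "linear (?D (fst q))" using lin q by auto
      have "linear (\<lambda>w. ?D (fst q) ((0, 0), w))"
        by (rule linear_compose[of "\<lambda>w. ((0, 0), w)", unfolded o_def]) (auto intro!: linearI l)
      then have "(\<Sum>e\<in>onb. (snd q \<bullet> e) *\<^sub>R ?D (fst q) ((0, 0), e)) = ?D (fst q) ((0, 0), snd q)"
        by (rule linear_onb_expand)
      then show ?thesis
        using linear_add[OF l, of "((v, 0), 0)" "((0, 0), snd q)"] by (simp add: Gt_def)
    qed
    ultimately show ?thesis
      using Ck_on_cong_imp[OF _ openP'] by blast
  qed
  have Gt_lip: "norm (Gt v (p, a) - Gt v (p, b)) \<le> K * norm (a - b)" if "p \<in> ?P" for v p a b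
    using norm_DG_state_le[OF G1 inQ[OF that], of "a - b"]
    by (simp add: Gt_def linear_diff[OF lin[OF that], symmetric] zero_prod_def)
  show ?case
  proof (rule Ck_on_local)
    fix p0 assume "p0 \<in> ?P"
    then obtain y0 s0 where p0: "p0 = (y0, s0)" "y0 \<in> W" "\<bar>s0\<bar> < d" by auto
    then obtain r where r: "\<bar>s0\<bar> < r" "r < d" using dense by blast
    let ?T = "W \<times> {-r<..<r}"
    have openT: "open ?T" by (auto intro!: open_Times open_W)
    have sub: "?T \<subseteq> ?P" using r by auto
    have Kr: "K * r \<le> 1/2"
      using Kd mult_left_mono[OF less_imp_le[OF r(2)] K_nonneg] by linarith
    have ex: "\<exists>z. z 0 = frechet_derivative h (at y) v \<and>
      (\<forall>s\<in>{-r..r}. (z has_vector_derivative Gt v ((y, s), z s)) (at s within {-r..r}))"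
      if y: "y \<in> W" for y v
    proof -
      let ?x0 = "frechet_derivative h (at y) v"
      have cont: "continuous_on ({-r..r} \<times> UNIV) (\<lambda>p. Gt v ((y, fst p), snd p))"
        by (rule continuous_on_compose2[OF Ck_on_imp_continuous_on[OF Gt[of v]]])
           (use r y in \<open>auto intro!: continuous_intros\<close>)
      have "continuous_on {-r..r} (\<lambda>s. Gt v ((y, s), ?x0))"
        by (rule continuous_on_compose2[OF Ck_on_imp_continuous_on[OF Gt[of v]]])
           (use r y in \<open>auto intro!: continuous_intros\<close>)
      then have "bounded ((\<lambda>s. Gt v ((y, s), ?x0)) ` {-r..r})"
        by (intro compact_imp_bounded compact_continuous_image) auto
      then obtain M where M: "\<And>s. s \<in> {-r..r} \<Longrightarrow> norm (Gt v ((y, s), ?x0)) \<le> M"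
        unfolding bounded_iff by blast
      have "0 \<in> {-r..r}" using r(1) by auto
      from order_trans[OF norm_ge_zero M[OF this]] have "0 \<le> M" .
      \<comment> \<open>The radius \<open>2 * (M * r)\<close> is what \<open>picard\<close> demands;
        it can be chosen freely because the linear field is defined for all states.\<close>
      have "\<exists>u. u 0 = ?x0 \<and> (\<forall>s\<in>{-r..r}. u s \<in> cball ?x0 (2 * (M * r)) \<and>
          (u has_vector_derivative Gt v ((y, s), u s)) (at s within {-r..r}))"
      proof (rule picard[where g = "\<lambda>s w. Gt v ((y, s), w)", OF _ K_nonneg Kr])
        show "continuous_on ({-r..r} \<times> cball ?x0 (2 * (M * r))) (\<lambda>p. Gt v ((y, fst p), snd p))"
          by (rule continuous_on_subset[OF cont]) auto
      qed (use r y M Gt_lip \<open>0 \<le> M\<close> in auto)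
      then show ?thesis by blast
    qed
    obtain Z where Z0: "\<And>y v. y \<in> W \<Longrightarrow> Z y v 0 = frechet_derivative h (at y) v"
      and Z: "\<And>y v s. y \<in> W \<Longrightarrow> s \<in> {-r..r} \<Longrightarrow>
        (Z y v has_vector_derivative Gt v ((y, s), Z y v s)) (at s within {-r..r})"
      using ex by metis
    have Z_Ck: "Ck_on n ?T (\<lambda>p. Z (fst p) v (snd p))" for v
    proof (rule Suc.IH[OF _ Gt[of v]])
      show "parametric_ode W r K (?P \<times> UNIV) (Gt v) (\<lambda>y. frechet_derivative h (at y) v) (\<lambda>p. Z (fst p) v (snd p))"
      proof unfold_locales
        show "((\<lambda>s. Z (fst (y, s)) v (snd (y, s))) has_vector_derivative
            Gt v ((y, s), Z (fst (y, s)) v (snd (y, s)))) (at s)" if "y \<in> W" "\<bar>s\<bar> < r" for y s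
        proof -
          have "at s within {-r..r} = at s"
            by (rule at_within_interior) (use that(2) in auto)
          moreover have "s \<in> {-r..r}" using that(2) by auto
          ultimately show ?thesis using Z[OF that(1), of s v] by (simp only: fst_conv snd_conv)
        qed
      qed (use open_W openP' r Kr K_nonneg Gt_lip Z0 in auto)
      show "Ck_on n W (\<lambda>y. frechet_derivative h (at y) v)"
        using Suc.prems(3) by simp
    qed
    have der: "(u has_derivative (\<lambda>v. Z (fst p) (fst v) (snd p) + snd v *\<^sub>R G (p, u p))) (at p)" if "p \<in> ?T" for p
    proof -
      have "fst p \<in> W" "\<bar>snd p\<bar> < r" using that by (auto simp: mem_Times_iff)
      then obtain y s where p: "p = (y, s)" "y \<in> W" "\<bar>s\<bar> < r" by (metis prod.collapse)
      have GT: "continuous_on ?T (\<lambda>p. G (p, u p))"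
        by (rule continuous_on_compose2[OF Ck_on_imp_continuous_on[OF G1]])
           (use sub inQ in \<open>auto intro!: continuous_intros continuous_on_subset[OF Ck_on_imp_continuous_on[OF Pu]]\<close>)
      \<comment> \<open>Joint differentiability follows from the two partial derivatives once the
        one in time is continuous; that one is known from the equation and is packed as a bounded
        linear map to make continuity meaningful.\<close>
      have "((\<lambda>(y, s). u (y, s)) has_derivative
          (\<lambda>(ty, ts). Z y ty s + blinfun_scaleR_left (G ((y, s), u (y, s))) ts)) (at (y, s) within ?T)"
      proof (rule has_derivative_partialsI)
        show "((\<lambda>y. u (y, s)) has_derivative (\<lambda>v. Z y v s)) (at y within W)"
        proof (rule has_derivative_at_withinI, rule variational_solution[where z = "Z y" and s = s, OF G1 h1 p(2) _ r(2)])
          show "(Z y v has_vector_derivative ?D (y, s) ((v, 0), Z y v s)) (at s within {-r..r})"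
            if "s \<in> {-r..r}" for v s
            using Z[OF p(2) that, of v] by (simp only: Gt_def fst_conv snd_conv)
          show "0 \<le> r" "s \<in> {-r..r}" using p(3) by auto
        qed (rule Z0[OF p(2)])
        show "((\<lambda>s. u (y, s)) has_derivative blinfun_apply (blinfun_scaleR_left (G ((y, s), u (y, s))))) (at s within {-r<..<r})"
          if "y \<in> W" "s \<in> {-r<..<r}" for y s
        proof -
          have "\<bar>s\<bar> < d" using that(2) r(2) by auto
          from ode[OF that(1) this] show ?thesis
            unfolding has_vector_derivative_def blinfun_scaleR_left.rep_eq by (rule has_derivative_at_withinI)
        qed
        have "continuous (at (y, s) within ?T) (\<lambda>p. G (p, u p))"
          using GT that p(1) by (auto simp: continuous_on_eq_continuous_within)
        then have "continuous (at (y, s) within ?T) (\<lambda>p. blinfun_scaleR_left (G (p, u p)))"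
          by (rule bounded_linear.continuous[OF bounded_linear_blinfun_scaleR_left])
        then show "continuous (at (y, s) within ?T) (\<lambda>(y, s). blinfun_scaleR_left (G ((y, s), u (y, s))))"
          by (simp add: case_prod_beta')
      qed (use p in auto)
      then show ?thesis
        using at_within_open[OF that openT] by (simp add: p(1) case_prod_beta')
    qed
    have "Ck_on (Suc n) ?T u"
    proof (rule Ck_on_SucI[OF openT der])
      have "Ck_on n ?T (\<lambda>p. G (p, u p))"
        by (rule Ck_on_compose[OF openT open_Q _ Ck_on_SucD[OF Suc.prems(2)]])
           (use sub inQ in \<open>auto intro!: Ck_on_Pair Ck_on_ident openT Ck_on_subset[OF Pu]\<close>)
      then show "Ck_on n ?T (\<lambda>p. Z (fst p) (fst v) (snd p) + snd v *\<^sub>R G (p, u p))" for v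
        by (intro Ck_on_add Ck_on_scaleR Ck_on_const openT Z_Ck)
    qed
    then show "\<exists>T. open T \<and> p0 \<in> T \<and> Ck_on (Suc n) T u"
      using openT p0 r(1) by (intro exI[of _ ?T]) auto
  qed
qed

text \<open>\<open>W\<close> and \<open>d\<close> are chosen from first-order data of
  \<open>F\<close> alone; every order of differentiability then holds on the same set by
  \<open>parametric_ode_Ck\<close>.\<close>

lemma smooth_local_flow:
  fixes F :: "'b::{real_inner, heine_borel} \<Rightarrow> 'b"
  assumes "open S" "smooth_on S F" "x0 \<in> S"
  shows "\<exists>d>0. \<exists>W u. open W \<and> x0 \<in> W \<and> W \<subseteq> S \<and> smooth_on (W \<times> {-d<..<d}) u \<and>
    (\<forall>y\<in>W. u (y, 0) = y) \<and>
    (\<forall>y\<in>W. \<forall>s\<in>{-d<..<d}. u (y, s) \<in> S \<and> ((\<lambda>s. u (y, s)) has_vector_derivative F (u (y, s))) (at s))"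
proof -
  have F1: "Ck_on 1 S F" using assms(2) by (simp add: smooth_on_def del: Ck_on.simps)
  obtain R K where R: "R > 0" "K \<ge> 0" "ball x0 R \<subseteq> S"
    "\<And>y z. y \<in> ball x0 R \<Longrightarrow> z \<in> ball x0 R \<Longrightarrow> norm (F z - F y) \<le> K * norm (z - y)"
    using Ck_on_1_lipschitz[OF assms(1) F1 assms(3)] by blast
  \<comment> \<open>A third of \<open>R\<close> keeps closed balls of radius \<open>\<rho>\<close>
    around points of \<open>ball x0 \<rho>\<close> inside \<open>ball x0 R\<close>. The two entries
    of \<open>d\<close> give \<open>K * d \<le> 1/2\<close> and \<open>M * d \<le> \<rho>/2\<close>,
    with 1 added so that no denominator vanishes.\<close>
  define \<rho> where "\<rho> = R / 3"
  define M where "M = norm (F x0) + K * R"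
  define d where "d = min (1 / (2 * (K + 1))) (\<rho> / (2 * (M + 1)))"
  have \<rho>: "\<rho> > 0" "\<rho> < R" "2 * \<rho> < R" using R(1) by (auto simp: \<rho>_def)
  have M: "M \<ge> 0" using R by (simp add: M_def)
  have d: "d > 0" using R(2) \<rho> M by (simp add: d_def)
  have Kd: "K * d \<le> 1/2"
  proof -
    have "K * d \<le> (K + 1) * (1 / (2 * (K + 1)))" using R(2) d by (intro mult_mono) (auto simp: d_def)
    then show ?thesis using mult_divide_double[of "K + 1" 1] R(2) by linarith
  qed
  have Md: "M * d \<le> \<rho>/2"
  proof -
    have "M * d \<le> (M + 1) * (\<rho> / (2 * (M + 1)))" using M d by (intro mult_mono) (auto simp: d_def)
    then show ?thesis using mult_divide_double[of "M + 1" \<rho>] M by linarith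
  qed
  let ?W = "ball x0 \<rho>"
  have sub: "cball y \<rho> \<subseteq> ball x0 R" if "y \<in> ?W" for y
  proof
    fix z assume "z \<in> cball y \<rho>"
    then show "z \<in> ball x0 R"
      using that \<rho>(3) dist_triangle[of x0 z y] by auto
  qed
  have F_le: "norm (F y) \<le> M" if "y \<in> ball x0 R" for y
  proof -
    have "norm (F y - F x0) \<le> K * norm (y - x0)" using R that by (intro R(4)) auto
    also have "\<dots> \<le> K * R" using R(2) that by (intro mult_left_mono) (auto simp: dist_norm norm_minus_commute)
    finally show ?thesis using norm_triangle_sub[of "F y" "F x0"] by (simp add: M_def)
  qed
  have ex: "\<exists>u. u 0 = y \<and> (\<forall>s\<in>{-d..d}. u s \<in> cball y \<rho> \<and> (u has_vector_derivative F (u s)) (at s within {-d..d}))"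
    if y: "y \<in> ?W" for y
  proof (rule picard[where g = "\<lambda>s. F" and K = K and M = M])
    have "continuous_on (cball y \<rho>) F"
      using smooth_on_imp_continuous_on[OF assms(2)] sub[OF y] R(3) by (meson continuous_on_subset subset_trans)
    then show "continuous_on ({-d..d} \<times> cball y \<rho>) (\<lambda>p. F (snd p))"
      by (rule continuous_on_compose2) (auto intro!: continuous_intros)
    show "norm (F w - F w') \<le> K * norm (w - w')" if "w \<in> cball y \<rho>" "w' \<in> cball y \<rho>" for w w'
      using R(4) sub[OF y] that by blast
    show "norm (F y) \<le> M" using F_le y \<rho>(2) by simp
  qed (use d R(2) Kd \<rho> Md in auto)
  obtain U where U0: "\<And>y. y \<in> ?W \<Longrightarrow> U y 0 = y"
    and U: "\<And>y s. y \<in> ?W \<Longrightarrow> s \<in> {-d..d} \<Longrightarrow> U y s \<in> cball y \<rho>"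
      "\<And>y s. y \<in> ?W \<Longrightarrow> s \<in> {-d..d} \<Longrightarrow> (U y has_vector_derivative F (U y s)) (at s within {-d..d})"
    using ex by metis
  define u where "u = (\<lambda>p. U (fst p) (snd p))"
  have in_ball: "u (y, s) \<in> ball x0 R" if "y \<in> ?W" "s \<in> {-d<..<d}" for y s
    using U(1)[OF that(1), of s] sub[OF that(1)] that(2) by (auto simp: u_def)
  have ode: "((\<lambda>s. u (y, s)) has_vector_derivative F (u (y, s))) (at s)" if "y \<in> ?W" "s \<in> {-d<..<d}" for y s
  proof -
    have "at s within {-d..d} = at s"
      by (rule at_within_interior) (use that(2) in auto)
    moreover have "s \<in> {-d..d}" using that(2) by auto
    ultimately show ?thesis using U(2)[OF that(1), of s] by (simp only: u_def fst_conv snd_conv)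
  qed
  have open_ball': "open ((UNIV :: ('b \<times> real) set) \<times> ball x0 R)"
    by (intro open_Times) auto
  have pode: "parametric_ode ?W d K (UNIV \<times> ball x0 R) (\<lambda>q. F (snd q)) (\<lambda>y. y) u"
  proof unfold_locales
    show "((y, s), u (y, s)) \<in> UNIV \<times> ball x0 R" if "y \<in> ?W" "\<bar>s\<bar> < d" for y s
    proof -
      have "s \<in> {-d<..<d}" using that(2) by auto
      then show ?thesis using in_ball[OF that(1)] by simp
    qed
    show "((\<lambda>s. u (y, s)) has_vector_derivative F (snd ((y, s), u (y, s)))) (at s)" if "y \<in> ?W" "\<bar>s\<bar> < d" for y s
    proof -
      have "s \<in> {-d<..<d}" using that(2) by auto
      then show ?thesis using ode[OF that(1)] by simp
    qed
  qed (use R d Kd U0 open_ball' in \<open>auto simp: u_def\<close>)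
  have "smooth_on (?W \<times> {-d<..<d}) u"
    unfolding smooth_on_def
  proof
    fix n
    have "Ck_on n (ball x0 R) F" using assms(2) R(3) by (auto simp: smooth_on_def intro: Ck_on_subset)
    then have "Ck_on n ((UNIV :: ('b \<times> real) set) \<times> ball x0 R) (\<lambda>q. F (snd q))"
      by (intro Ck_on_compose[OF open_ball' open_ball Ck_on_bounded_linear[OF bounded_linear_snd open_ball']]) auto
    then show "Ck_on n (?W \<times> {-d<..<d}) u"
      by (rule parametric_ode_Ck[OF pode]) (auto intro: Ck_on_ident)
  qed
  moreover have "?W \<subseteq> ball x0 R" using \<rho>(2) by auto
  moreover have "u (y, s) \<in> S" if "y \<in> ?W" "s \<in> {-d<..<d}" for y s
    using in_ball[OF that] R(3) by blast
  moreover have "u (y, 0) = y" if "y \<in> ?W" for y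
    using U0[OF that] by (simp add: u_def)
  moreover have "x0 \<in> ?W" "?W \<subseteq> S" using \<rho> R(3) by auto
  ultimately have "open ?W \<and> x0 \<in> ?W \<and> ?W \<subseteq> S \<and> smooth_on (?W \<times> {-d<..<d}) u \<and>
    (\<forall>y\<in>?W. u (y, 0) = y) \<and>
    (\<forall>y\<in>?W. \<forall>s\<in>{-d<..<d}. u (y, s) \<in> S \<and> ((\<lambda>s. u (y, s)) has_vector_derivative F (u (y, s))) (at s))"
    using ode by (intro conjI ballI open_ball) simp_all
  with d show ?thesis by blast
qed

section \<open>Curves and jets in charts\<close>

locale smooth_mfd =
  fixes X :: "'a topology" and \<A> :: "('a, 'b::{real_inner, heine_borel}) chart set"
  assumes smooth_mfd: "smooth_manifold X \<A>"
begin

section \<open>Charts as local coordinates\<close>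

lemma
  assumes "(U, \<phi>) \<in> \<A>"
  shows chart_open: "openin X U" and chart_image_open: "open (\<phi> ` U)"
    and chart_homeomorphic: "homeomorphic_map (subtopology X U) (top_of_set (\<phi> ` U)) \<phi>"
  using smooth_mfd assms unfolding smooth_manifold_def smooth_atlas_def by fast+

lemma chart_transition:
  "(U, \<phi>) \<in> \<A> \<Longrightarrow> (V, \<psi>) \<in> \<A> \<Longrightarrow> smooth_on (\<phi> ` (U \<inter> V)) (\<psi> \<circ> inv_into U \<phi>)"
  using smooth_mfd unfolding smooth_manifold_def smooth_atlas_def by fast

lemma chart_exists:
  assumes "x \<in> topspace X" obtains U \<phi> where "(U, \<phi>) \<in> \<A>" "x \<in> U"
  using smooth_mfd assms unfolding smooth_manifold_def smooth_atlas_def by fast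

lemma chart_subset: "(U, \<phi>) \<in> \<A> \<Longrightarrow> U \<subseteq> topspace X"
  by (simp add: chart_open openin_subset)

lemma chart_inj: "(U, \<phi>) \<in> \<A> \<Longrightarrow> inj_on \<phi> U"
  using chart_homeomorphic[of U \<phi>] chart_subset[of U \<phi>]
  by (simp add: homeomorphic_map_def Int_absorb1)

lemma chart_inv [simp]: "(U, \<phi>) \<in> \<A> \<Longrightarrow> x \<in> U \<Longrightarrow> inv_into U \<phi> (\<phi> x) = x"
  by (simp add: chart_inj)

lemma chart_inv_continuous:
  assumes "(U, \<phi>) \<in> \<A>" shows "continuous_map (top_of_set (\<phi> ` U)) X (inv_into U \<phi>)"
proof -
  obtain g where g: "homeomorphic_maps (subtopology X U) (top_of_set (\<phi> ` U)) \<phi> g"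
    using chart_homeomorphic[OF assms] homeomorphic_map_maps by blast
  have "g y = inv_into U \<phi> y" if "y \<in> \<phi> ` U" for y
    using g that assms chart_subset[OF assms]
    by (force simp: homeomorphic_maps_def Int_absorb1)
  moreover have "continuous_map (top_of_set (\<phi> ` U)) X g"
    using g by (auto simp: homeomorphic_maps_def continuous_map_in_subtopology)
  ultimately show ?thesis
    by (rule continuous_map_eq[rotated]) simp
qed

text \<open>The set is the preimage of \<open>V\<close> under the continuous inverse chart. Openness
  matters because \<open>smooth_on\<close> is meaningful on open sets.\<close>

lemma chart_inter_open:
  assumes "(U, \<phi>) \<in> \<A>" "(V, \<psi>) \<in> \<A>" shows "open (\<phi> ` (U \<inter> V))"
proof -
  have "openin (top_of_set (\<phi> ` U)) {y \<in> topspace (top_of_set (\<phi> ` U)). inv_into U \<phi> y \<in> V}"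
    by (rule openin_continuous_map_preimage[OF chart_inv_continuous chart_open]) (use assms in auto)
  moreover have "{y \<in> topspace (top_of_set (\<phi> ` U)). inv_into U \<phi> y \<in> V} = \<phi> ` (U \<inter> V)"
    using assms by auto
  ultimately show ?thesis
    using openin_open_trans chart_image_open[OF assms(1)] by metis
qed

section \<open>Smooth curves read in a chart\<close>

lemma curve_preimage_open:
  assumes "smooth_curve_on X \<A> I c" "open I" "(U, \<phi>) \<in> \<A>"
  shows "open {t\<in>I. c t \<in> U}"
proof -
  have "openin (top_of_set I) {t \<in> topspace (top_of_set I). c t \<in> U}"
    using assms by (intro openin_continuous_map_preimage[OF _ chart_open]) (auto simp: smooth_curve_on_def)
  then show ?thesis using openin_open_trans assms(2) by fastforce
qed

lemma smooth_curve_onD: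
  "smooth_curve_on X \<A> I c \<Longrightarrow> (U, \<phi>) \<in> \<A> \<Longrightarrow> smooth_on {t\<in>I. c t \<in> U} (\<lambda>t. \<phi> (c t))"
  unfolding smooth_curve_on_def o_def by blast

lemma smooth_curve_on_topspace: "smooth_curve_on X \<A> I c \<Longrightarrow> t \<in> I \<Longrightarrow> c t \<in> topspace X"
  by (auto simp: smooth_curve_on_def continuous_map_def)

lemma smooth_curve_on_cong:
  assumes "smooth_curve_on X \<A> I c" "open I" "\<And>t. t \<in> I \<Longrightarrow> c t = c' t"
  shows "smooth_curve_on X \<A> I c'"
  unfolding smooth_curve_on_def
proof safe
  show "continuous_map (top_of_set I) X c'"
    using assms by (auto simp: smooth_curve_on_def intro: continuous_map_eq)
  fix U \<phi> assume UV: "(U, \<phi>) \<in> \<A>"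
  have "{t\<in>I. c' t \<in> U} = {t\<in>I. c t \<in> U}" using assms(3) by auto
  moreover have "smooth_on {t\<in>I. c t \<in> U} (\<phi> \<circ> c')"
    using smooth_curve_onD[OF assms(1) UV] assms(3)
    by (subst smooth_on_cong[OF curve_preimage_open[OF assms(1,2) UV], where g = "\<lambda>t. \<phi> (c t)"]) auto
  ultimately show "smooth_on {t\<in>I. c' t \<in> U} (\<phi> \<circ> c')" by simp
qed

text \<open>Transition maps carry smoothness from the one chart to all charts of the atlas.\<close>

lemma smooth_curve_on_chart:
  assumes "open I" "smooth_on I f" "\<And>t. t \<in> I \<Longrightarrow> f t \<in> \<phi> ` U" "(U, \<phi>) \<in> \<A>"
  shows "smooth_curve_on X \<A> I (\<lambda>t. inv_into U \<phi> (f t))"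
  unfolding smooth_curve_on_def
proof safe
  have f: "continuous_map (top_of_set I) (top_of_set (\<phi> ` U)) f"
    using assms(3) smooth_on_imp_continuous_on[OF assms(2)] by (auto intro: continuous_map_into_subtopology)
  show "continuous_map (top_of_set I) X (\<lambda>t. inv_into U \<phi> (f t))"
    using continuous_map_compose[OF f chart_inv_continuous[OF assms(4)]] by (simp add: o_def)
  fix V \<psi> assume V: "(V, \<psi>) \<in> \<A>"
  let ?T = "{t \<in> I. inv_into U \<phi> (f t) \<in> V}"
  have "?T = I \<inter> f -` (\<phi> ` (U \<inter> V))"
    using assms(3,4) by (force intro: image_eqI)
  then have "open ?T"
    using continuous_on_open_vimage[OF assms(1)] smooth_on_imp_continuous_on[OF assms(2)]
      chart_inter_open[OF assms(4) V] by (metis Int_commute)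
  then show "smooth_on ?T (\<psi> \<circ> (\<lambda>t. inv_into U \<phi> (f t)))"
    using smooth_on_compose[OF smooth_on_subset[OF assms(2)] chart_transition[OF assms(4) V] _
        chart_inter_open[OF assms(4) V], of ?T] assms(3,4)
    by (force simp: o_def)
qed

lemma smooth_near_0_chartI:
  assumes "(U, \<phi>) \<in> \<A>" "d > 0" "\<And>t. \<bar>t\<bar> < d \<Longrightarrow> \<gamma> t \<in> U" "smooth_on {-d<..<d} (\<lambda>t. \<phi> (\<gamma> t))"
  shows "smooth_curve_near_0 X \<A> \<gamma>"
proof -
  have "smooth_curve_on X \<A> {-d<..<d} (\<lambda>t. inv_into U \<phi> (\<phi> (\<gamma> t)))"
    using assms by (intro smooth_curve_on_chart) auto
  then have "smooth_curve_on X \<A> {-d<..<d} \<gamma>"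
    by (rule smooth_curve_on_cong) (use assms in auto)
  then show ?thesis using assms(2) by (auto simp: smooth_curve_near_0_def)
qed

lemma smooth_near_0_chartD:
  assumes "smooth_curve_near_0 X \<A> \<gamma>" "(U, \<phi>) \<in> \<A>" "\<gamma> 0 \<in> U"
  obtains d where "d > 0" "\<And>t. \<bar>t\<bar> < d \<Longrightarrow> \<gamma> t \<in> U" "smooth_on {-d<..<d} (\<lambda>t. \<phi> (\<gamma> t))"
proof -
  obtain e where e: "e > 0" "smooth_curve_on X \<A> {-e<..<e} \<gamma>"
    using assms(1) by (auto simp: smooth_curve_near_0_def)
  let ?T = "{t \<in> {-e<..<e}. \<gamma> t \<in> U}"
  have "open ?T" using curve_preimage_open[OF e(2) _ assms(2)] by simp
  then obtain d where d: "d > 0" "ball 0 d \<subseteq> ?T"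
    using e(1) assms(3) openE[of ?T 0] by auto
  have sub: "{-d<..<d} \<subseteq> ?T" using d(2) by (auto simp: dist_real_def subset_eq)
  show thesis
  proof (rule that[OF d(1)])
    show "smooth_on {-d<..<d} (\<lambda>t. \<phi> (\<gamma> t))"
      by (rule smooth_on_subset[OF smooth_curve_onD[OF e(2) assms(2)] sub])
    show "\<gamma> t \<in> U" if "\<bar>t\<bar> < d" for t
    proof -
      have "t \<in> {-d<..<d}" using that by auto
      with sub show ?thesis by blast
    qed
  qed
qed

lemma smooth_near_0_chart_tendsto:
  assumes "smooth_curve_near_0 X \<A> \<gamma>" "(U, \<phi>) \<in> \<A>" "\<gamma> 0 \<in> U"
  shows "\<forall>\<^sub>F t in nhds 0. \<gamma> t \<in> U" "((\<lambda>t. \<phi> (\<gamma> t)) \<longlongrightarrow> \<phi> (\<gamma> 0)) (nhds 0)"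
proof -
  obtain d where d: "d > 0" "\<And>t. \<bar>t\<bar> < d \<Longrightarrow> \<gamma> t \<in> U" "smooth_on {-d<..<d} (\<lambda>t. \<phi> (\<gamma> t))"
    using smooth_near_0_chartD[OF assms] by blast
  show "\<forall>\<^sub>F t in nhds 0. \<gamma> t \<in> U"
    using eventually_abs_le_nhds_0[OF d(1)] by eventually_elim (rule d(2))
  have "isCont (\<lambda>t. \<phi> (\<gamma> t)) 0"
    using smooth_on_imp_continuous_on[OF d(3)] d(1) by (simp add: continuous_on_eq_continuous_at)
  then show "((\<lambda>t. \<phi> (\<gamma> t)) \<longlongrightarrow> \<phi> (\<gamma> 0)) (nhds 0)"
    using tendsto_at_iff_tendsto_nhds[of "\<lambda>t. \<phi> (\<gamma> t)" 0] by (simp add: isCont_def)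
qed

lemma smooth_near_0_inv_chart:
  assumes "(U, \<phi>) \<in> \<A>" "e > 0" "smooth_on {-e<..<e} f" "f 0 \<in> \<phi> ` U"
  shows "smooth_curve_near_0 X \<A> (\<lambda>t. inv_into U \<phi> (f t))"
    and "\<forall>\<^sub>F t in nhds 0. \<phi> (inv_into U \<phi> (f t)) = f t"
proof -
  have c: "continuous_on {-e<..<e} f" by (rule smooth_on_imp_continuous_on) fact
  have "open ({-e<..<e} \<inter> f -` (\<phi> ` U))"
    using continuous_on_open_vimage[of "{-e<..<e}" f] c chart_image_open[OF assms(1)]
    by (metis Int_commute open_greaterThanLessThan)
  then obtain d where d: "d > 0" "ball 0 d \<subseteq> {-e<..<e} \<inter> f -` (\<phi> ` U)"
    using assms(2,4) openE[of "{-e<..<e} \<inter> f -` (\<phi> ` U)" 0] by auto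
  have T: "t \<in> {-e<..<e}" "f t \<in> \<phi> ` U" if "\<bar>t\<bar> < d" for t
    using d(2) that by (auto simp: dist_real_def subset_eq)
  have "smooth_on {-d<..<d} f"
    by (rule smooth_on_subset[OF assms(3)]) (use T in force)
  then have "smooth_curve_on X \<A> {-d<..<d} (\<lambda>t. inv_into U \<phi> (f t))"
    using T(2) assms(1) by (intro smooth_curve_on_chart) auto
  then show "smooth_curve_near_0 X \<A> (\<lambda>t. inv_into U \<phi> (f t))"
    using d(1) by (auto simp: smooth_curve_near_0_def)
  show "\<forall>\<^sub>F t in nhds 0. \<phi> (inv_into U \<phi> (f t)) = f t"
    using eventually_abs_le_nhds_0[OF d(1)] by eventually_elim (rule f_inv_into_f[OF T(2)])
qed

text \<open>Both curves move, so the ordinary derivative of the transition map at the common point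
  does not suffice; strict differentiability there does. The curves themselves need no expansion,
  only their difference.\<close>

lemma flat_chart_change_strict:
  assumes "(U, \<phi>) \<in> \<A>" "(V, \<psi>) \<in> \<A>" "smooth_curve_near_0 X \<A> \<gamma>" "smooth_curve_near_0 X \<A> \<gamma>'"
    and "\<gamma> 0 = x" "\<gamma>' 0 = x" "x \<in> U" "x \<in> V"
    and fl: "flat j (\<lambda>t. \<phi> (\<gamma> t) - \<phi> (\<gamma>' t) - t ^ j *\<^sub>R b)"
  shows "flat j (\<lambda>t. \<psi> (\<gamma> t) - \<psi> (\<gamma>' t) -
    t ^ j *\<^sub>R frechet_derivative (\<psi> \<circ> inv_into U \<phi>) (at (\<phi> x)) b)"
proof -
  define \<tau> where "\<tau> = \<psi> \<circ> inv_into U \<phi>"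
  let ?D = "frechet_derivative \<tau> (at (\<phi> x))"
  have \<tau>: "smooth_on (\<phi> ` (U \<inter> V)) \<tau>" unfolding \<tau>_def by (rule chart_transition) fact+
  have o: "open (\<phi> ` (U \<inter> V))" by (rule chart_inter_open) fact+
  have x: "\<phi> x \<in> \<phi> ` (U \<inter> V)" using assms by auto
  have bl: "bounded_linear ?D"
    using smooth_on_has_derivative[OF \<tau> x] has_derivative_bounded_linear by blast
  have ev: "\<forall>\<^sub>F t in nhds 0. \<gamma> t \<in> U" "\<forall>\<^sub>F t in nhds 0. \<gamma>' t \<in> U"
    using smooth_near_0_chart_tendsto(1) assms by auto
  \<comment> \<open>The difference is \<open>O(t ^ j)\<close>, hence a relative error in the
    difference is an error of order \<open>o(t ^ j)\<close>.\<close>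
  have le: "\<forall>\<^sub>F t in nhds 0. norm (\<phi> (\<gamma> t) - \<phi> (\<gamma>' t)) \<le> (norm b + 1) * \<bar>t\<bar> ^ j"
  proof -
    have "\<forall>\<^sub>F t in nhds 0. norm (\<phi> (\<gamma> t) - \<phi> (\<gamma>' t) - t ^ j *\<^sub>R b) \<le> 1 * \<bar>t\<bar> ^ j"
      using fl unfolding flat_def using zero_less_one by blast
    then show ?thesis
    proof eventually_elim
      case (elim t)
      then show ?case
        using norm_triangle_sub[of "\<phi> (\<gamma> t) - \<phi> (\<gamma>' t)" "t ^ j *\<^sub>R b"]
        by (simp add: power_abs algebra_simps)
    qed
  qed
  have "flat j (\<lambda>t. \<psi> (\<gamma> t) - \<psi> (\<gamma>' t) - ?D (\<phi> (\<gamma> t) - \<phi> (\<gamma>' t)))"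
    unfolding flat_def
  proof (intro allI impI)
    fix e :: real assume "e > 0"
    define c where "c = e / (norm b + 1)"
    have c: "c > 0" "c * (norm b + 1) = e"
      using \<open>e > 0\<close> add_nonneg_pos[OF norm_ge_zero zero_less_one, of b] by (auto simp: c_def)
    have "Ck_on 1 (\<phi> ` (U \<inter> V)) \<tau>" using \<tau> unfolding smooth_on_def by blast
    from Ck_on_1_strict[OF o this x c(1)] obtain d where d: "d > 0"
      "\<And>y z. y \<in> ball (\<phi> x) d \<Longrightarrow> z \<in> ball (\<phi> x) d \<Longrightarrow> norm (\<tau> z - \<tau> y - ?D (z - y)) \<le> c * norm (z - y)"
      by blast
    have "\<forall>\<^sub>F t in nhds 0. dist (\<phi> (\<gamma> t)) (\<phi> x) < d" "\<forall>\<^sub>F t in nhds 0. dist (\<phi> (\<gamma>' t)) (\<phi> x) < d"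
      using tendstoD[OF smooth_near_0_chart_tendsto(2)[OF assms(3,1)] d(1)]
        tendstoD[OF smooth_near_0_chart_tendsto(2)[OF assms(4,1)] d(1)] assms(5-7) by simp_all
    with ev le show "\<forall>\<^sub>F t in nhds 0. norm (\<psi> (\<gamma> t) - \<psi> (\<gamma>' t) - ?D (\<phi> (\<gamma> t) - \<phi> (\<gamma>' t))) \<le> e * \<bar>t\<bar> ^ j"
    proof eventually_elim
      case (elim t)
      have "norm (\<tau> (\<phi> (\<gamma> t)) - \<tau> (\<phi> (\<gamma>' t)) - ?D (\<phi> (\<gamma> t) - \<phi> (\<gamma>' t))) \<le> c * norm (\<phi> (\<gamma> t) - \<phi> (\<gamma>' t))"
        using elim by (intro d(2)) (auto simp: dist_commute)
      also have "\<dots> \<le> c * ((norm b + 1) * \<bar>t\<bar> ^ j)"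
        using elim(3) c(1) by (intro mult_left_mono) auto
      also have "\<dots> = e * \<bar>t\<bar> ^ j" using c(2) by (simp only: mult.assoc[symmetric])
      finally show ?case using elim(1,2) assms(1) by (simp add: \<tau>_def)
    qed
  qed
  moreover have "flat j (\<lambda>t. ?D (\<phi> (\<gamma> t) - \<phi> (\<gamma>' t) - t ^ j *\<^sub>R b))"
  proof -
    obtain B where "\<And>v. norm (?D v) \<le> B * norm v"
      using bounded_linear.bounded[OF bl] by (metis mult.commute)
    then show ?thesis by (intro flat_bounded[OF fl, of _ B] always_eventually) auto
  qed
  ultimately have "flat j (\<lambda>t. (\<psi> (\<gamma> t) - \<psi> (\<gamma>' t) - ?D (\<phi> (\<gamma> t) - \<phi> (\<gamma>' t))) + ?D (\<phi> (\<gamma> t) - \<phi> (\<gamma>' t) - t ^ j *\<^sub>R b))"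
    by (rule flat_add)
  then show ?thesis
    using linear_diff[OF bounded_linear.linear[OF bl]] linear_scale[OF bounded_linear.linear[OF bl]]
    by (simp add: \<tau>_def)
qed

lemma flat_chart_change:
  assumes "(U, \<phi>) \<in> \<A>" "(V, \<psi>) \<in> \<A>" "smooth_curve_near_0 X \<A> \<gamma>" "smooth_curve_near_0 X \<A> \<gamma>'"
    and "\<gamma> 0 = x" "\<gamma>' 0 = x" "x \<in> U" "x \<in> V"
    and "flat j (\<lambda>t. \<phi> (\<gamma> t) - \<phi> (\<gamma>' t))"
  shows "flat j (\<lambda>t. \<psi> (\<gamma> t) - \<psi> (\<gamma>' t))"
proof -
  have "smooth_on (\<phi> ` (U \<inter> V)) (\<psi> \<circ> inv_into U \<phi>)" by (rule chart_transition) fact+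
  from linear_0[OF has_derivative_linear[OF smooth_on_has_derivative[OF this, of "\<phi> x"]]]
  have "frechet_derivative (\<psi> \<circ> inv_into U \<phi>) (at (\<phi> x)) 0 = 0"
    using assms(7,8) by simp
  then show ?thesis
    using flat_chart_change_strict[OF assms(1-8), of j 0] assms(9) by simp
qed

text \<open>Taylor's formula translates equality of coefficients into flatness chart by chart, and
  flatness passes from one chart to any other; one chart therefore decides.\<close>

lemma same_kjet_iff_flat:
  assumes "(U, \<phi>) \<in> \<A>" "smooth_curve_near_0 X \<A> \<gamma>" "smooth_curve_near_0 X \<A> \<gamma>'" "\<gamma> 0 \<in> U" "\<gamma> 0 = \<gamma>' 0"
  shows "same_kjet \<A> k \<gamma> \<gamma>' \<longleftrightarrow> flat k (\<lambda>t. \<phi> (\<gamma> t) - \<phi> (\<gamma>' t))"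
proof -
  have iff: "(\<forall>i\<le>k. taylor_coeff i (\<psi> \<circ> \<gamma>) = taylor_coeff i (\<psi> \<circ> \<gamma>')) \<longleftrightarrow> flat k (\<lambda>t. \<psi> (\<gamma> t) - \<psi> (\<gamma>' t))"
    if V: "(V, \<psi>) \<in> \<A>" "\<gamma> 0 \<in> V" for V \<psi>
  proof -
    obtain d1 where d1: "d1 > 0" "smooth_on {-d1<..<d1} (\<lambda>t. \<psi> (\<gamma> t))"
      using smooth_near_0_chartD[OF assms(2) V] by blast
    obtain d2 where d2: "d2 > 0" "smooth_on {-d2<..<d2} (\<lambda>t. \<psi> (\<gamma>' t))"
      using smooth_near_0_chartD[OF assms(3) V(1)] V(2) assms(5) by metis
    have "{- min d1 d2<..<min d1 d2} \<subseteq> {-d1<..<d1}" "{- min d1 d2<..<min d1 d2} \<subseteq> {-d2<..<d2}"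
      by auto
    then have "Ck_on k {- min d1 d2<..<min d1 d2} (\<psi> \<circ> \<gamma>)" "Ck_on k {- min d1 d2<..<min d1 d2} (\<psi> \<circ> \<gamma>')"
      using smooth_on_subset[OF d1(2), of "{- min d1 d2<..<min d1 d2}"]
        smooth_on_subset[OF d2(2), of "{- min d1 d2<..<min d1 d2}"]
      by (simp_all add: smooth_on_def o_def)
    then show ?thesis
      using taylor_coeff_eq_iff_flat[of "{- min d1 d2<..<min d1 d2}" k "\<psi> \<circ> \<gamma>" "\<psi> \<circ> \<gamma>'"] d1(1) d2(1)
      by simp
  qed
  show ?thesis
  proof
    assume "same_kjet \<A> k \<gamma> \<gamma>'"
    then show "flat k (\<lambda>t. \<phi> (\<gamma> t) - \<phi> (\<gamma>' t))"
      using iff[OF assms(1,4)] assms(1,4) unfolding same_kjet_def by blast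
  next
    assume f: "flat k (\<lambda>t. \<phi> (\<gamma> t) - \<phi> (\<gamma>' t))"
    have "flat k (\<lambda>t. \<psi> (\<gamma> t) - \<psi> (\<gamma>' t))" if "(V, \<psi>) \<in> \<A>" "\<gamma> 0 \<in> V" for V \<psi>
      using flat_chart_change[OF assms(1) that(1) assms(2,3) refl assms(5)[symmetric] assms(4) that(2) f] .
    then show "same_kjet \<A> k \<gamma> \<gamma>'"
      using iff assms(5) unfolding same_kjet_def by blast
  qed
qed

lemma kjet_eq_iff:
  assumes "smooth_curve_near_0 X \<A> \<gamma>"
  shows "kjet X \<A> k \<gamma> = kjet X \<A> k \<gamma>' \<longleftrightarrow> same_kjet \<A> k \<gamma> \<gamma>'"
proof
  assume "kjet X \<A> k \<gamma> = kjet X \<A> k \<gamma>'"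
  moreover have "\<gamma> \<in> kjet X \<A> k \<gamma>" using assms by (auto simp: kjet_def same_kjet_def)
  ultimately show "same_kjet \<A> k \<gamma> \<gamma>'" by (auto simp: kjet_def same_kjet_def)
next
  assume s: "same_kjet \<A> k \<gamma> \<gamma>'"
  have "same_kjet \<A> k \<gamma> c \<longleftrightarrow> same_kjet \<A> k \<gamma>' c" for c
    using s unfolding same_kjet_def by (fastforce simp: split_beta)
  then show "kjet X \<A> k \<gamma> = kjet X \<A> k \<gamma>'" by (simp add: kjet_def)
qed

lemma kjet_eq_iff_flat:
  assumes "(U, \<phi>) \<in> \<A>" "smooth_curve_near_0 X \<A> \<gamma>" "smooth_curve_near_0 X \<A> \<gamma>'" "\<gamma> 0 \<in> U" "\<gamma> 0 = \<gamma>' 0"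
  shows "kjet X \<A> k \<gamma> = kjet X \<A> k \<gamma>' \<longleftrightarrow> flat k (\<lambda>t. \<phi> (\<gamma> t) - \<phi> (\<gamma>' t))"
  using kjet_eq_iff[OF assms(2)] same_kjet_iff_flat[OF assms] by simp

end

section \<open>Flows of vector fields\<close>

lemma has_vector_derivative_shift:
  "((\<lambda>s. f (t + s)) has_vector_derivative D) (at s) \<longleftrightarrow> (f has_vector_derivative D) (at (t + s))"
  unfolding flat_has_vector_derivative_iff[symmetric] by (simp add: add.assoc)

context smooth_mfd
begin

text \<open>This is the principal part of a vector field in a chart; a tangent vector being a class
  of curves, it is represented by a coordinate line.\<close>

definition vf_rep :: "('a \<Rightarrow> (real \<Rightarrow> 'a) set) \<Rightarrow> 'a set \<Rightarrow> ('a \<Rightarrow> 'b) \<Rightarrow> ('b \<Rightarrow> 'b) \<Rightarrow> bool" where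
  "vf_rep A U \<phi> F \<longleftrightarrow> smooth_on (\<phi> ` U) F \<and>
    (\<forall>x\<in>U. A x = kjet X \<A> 1 (\<lambda>t. inv_into U \<phi> (\<phi> x + t *\<^sub>R F (\<phi> x))))"

lemma vf_rep_exists:
  assumes "smooth_vector_field X \<A> A" "(U, \<phi>) \<in> \<A>" obtains F where "vf_rep A U \<phi> F"
proof -
  have "\<exists>a :: nat \<Rightarrow> 'b \<Rightarrow> 'b. (\<forall>i\<in>{1..1}. smooth_on (\<phi> ` U) (a i)) \<and>
      (\<forall>x\<in>U. A x = kjet X \<A> 1 (\<lambda>t. inv_into U \<phi> (\<phi> x + (\<Sum>i=1..1. t ^ i *\<^sub>R a i (\<phi> x)))))"
    using assms unfolding smooth_vector_field_def smooth_kjet_family_def by blast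
  then show thesis using that by (auto simp: vf_rep_def)
qed

section \<open>Tangent vectors and integral curves in a chart\<close>

lemma smooth_line:
  assumes "(U, \<phi>) \<in> \<A>" "x \<in> U"
  shows "smooth_curve_near_0 X \<A> (\<lambda>t. inv_into U \<phi> (\<phi> x + t *\<^sub>R b))"
    and "\<forall>\<^sub>F t in nhds 0. \<phi> (inv_into U \<phi> (\<phi> x + t *\<^sub>R b)) = \<phi> x + t *\<^sub>R b"
proof -
  have "smooth_on {-1<..<1} (\<lambda>t::real. \<phi> x + t *\<^sub>R b)"
    by (intro smooth_on_add smooth_on_scaleR smooth_on_const smooth_on_ident) auto
  from smooth_near_0_inv_chart[OF assms(1) zero_less_one this] assms(2)
  show "smooth_curve_near_0 X \<A> (\<lambda>t. inv_into U \<phi> (\<phi> x + t *\<^sub>R b))"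
    and "\<forall>\<^sub>F t in nhds 0. \<phi> (inv_into U \<phi> (\<phi> x + t *\<^sub>R b)) = \<phi> x + t *\<^sub>R b" by auto
qed

text \<open>Turns equality of tangent vectors, which are classes of curves, into the remainder
  estimate that \<open>flat_has_vector_derivative_iff\<close> reads as a derivative.\<close>

lemma kjet_1_eq_line_iff:
  assumes "(U, \<phi>) \<in> \<A>" "smooth_curve_near_0 X \<A> \<gamma>" "\<gamma> 0 \<in> U"
  shows "kjet X \<A> 1 \<gamma> = kjet X \<A> 1 (\<lambda>t. inv_into U \<phi> (\<phi> (\<gamma> 0) + t *\<^sub>R b)) \<longleftrightarrow>
    flat 1 (\<lambda>t. \<phi> (\<gamma> t) - \<phi> (\<gamma> 0) - t *\<^sub>R b)"
proof -
  have "kjet X \<A> 1 \<gamma> = kjet X \<A> 1 (\<lambda>t. inv_into U \<phi> (\<phi> (\<gamma> 0) + t *\<^sub>R b)) \<longleftrightarrow>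
      flat 1 (\<lambda>t. \<phi> (\<gamma> t) - \<phi> (inv_into U \<phi> (\<phi> (\<gamma> 0) + t *\<^sub>R b)))"
    using assms by (intro kjet_eq_iff_flat smooth_line) auto
  also have "\<dots> \<longleftrightarrow> flat 1 (\<lambda>t. \<phi> (\<gamma> t) - \<phi> (\<gamma> 0) - t *\<^sub>R b)"
    by (rule flat_cong) (use smooth_line(2)[OF assms(1,3), of b] in \<open>auto elim: eventually_mono\<close>)
  finally show ?thesis .
qed

lemma smooth_curve_shift:
  assumes "smooth_curve_on X \<A> I c" "open I" "t \<in> I"
  shows "smooth_curve_near_0 X \<A> (\<lambda>s. c (t + s))"
proof -
  obtain U \<phi> where U: "(U, \<phi>) \<in> \<A>" "c t \<in> U"
    using chart_exists smooth_curve_on_topspace[OF assms(1,3)] by blast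
  let ?T = "{s\<in>I. c s \<in> U}"
  have T: "open ?T" "t \<in> ?T" using curve_preimage_open[OF assms(1,2) U(1)] U(2) assms(3) by auto
  then obtain d where d: "d > 0" "ball t d \<subseteq> ?T" using openE by blast
  have in_T: "t + s \<in> ?T" if "\<bar>s\<bar> < d" for s
    using d(2) that by (auto simp: dist_real_def subset_eq)
  show ?thesis
  proof (rule smooth_near_0_chartI[OF U(1) d(1)])
    show "c (t + s) \<in> U" if "\<bar>s\<bar> < d" for s using in_T[OF that] by simp
    show "smooth_on {-d<..<d} (\<lambda>s. \<phi> (c (t + s)))"
    proof (rule smooth_on_compose[OF _ smooth_curve_onD[OF assms(1) U(1)] _ T(1)])
      show "smooth_on {-d<..<d} (\<lambda>s. t + s)"
        by (intro smooth_on_add smooth_on_const smooth_on_ident) auto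
      show "t + s \<in> ?T" if "s \<in> {-d<..<d}" for s using that by (intro in_T) auto
    qed auto
  qed
qed

lemma integral_curve_chart_derivative:
  assumes "integral_curve X \<A> A I c" "vf_rep A U \<phi> F" "(U, \<phi>) \<in> \<A>" "t \<in> I" "c t \<in> U"
  shows "((\<lambda>t. \<phi> (c t)) has_vector_derivative F (\<phi> (c t))) (at t)"
proof -
  have sm: "smooth_curve_near_0 X \<A> (\<lambda>s. c (t + s))"
    using assms by (intro smooth_curve_shift) (auto simp: integral_curve_def)
  have "kjet X \<A> 1 (\<lambda>s. c (t + s)) = kjet X \<A> 1 (\<lambda>s. inv_into U \<phi> (\<phi> (c t) + s *\<^sub>R F (\<phi> (c t))))"
    using assms by (auto simp: integral_curve_def vf_rep_def velocity_def)
  then have "flat 1 (\<lambda>s. \<phi> (c (t + s)) - \<phi> (c t) - s *\<^sub>R F (\<phi> (c t)))"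
    using kjet_1_eq_line_iff[OF assms(3) sm, of "F (\<phi> (c t))"] assms(5) by simp
  then show ?thesis by (rule iffD1[OF flat_has_vector_derivative_iff[where f = "\<lambda>t. \<phi> (c t)"]])
qed

lemma integral_curve_chartI:
  assumes "vf_rep A U \<phi> F" "(U, \<phi>) \<in> \<A>" "open I" "is_interval I" "smooth_on I f"
    and f: "\<And>t. t \<in> I \<Longrightarrow> f t \<in> \<phi> ` U" "\<And>t. t \<in> I \<Longrightarrow> (f has_vector_derivative F (f t)) (at t)"
  shows "integral_curve X \<A> A I (\<lambda>t. inv_into U \<phi> (f t))"
proof -
  let ?c = "\<lambda>t. inv_into U \<phi> (f t)"
  have sm: "smooth_curve_on X \<A> I ?c" by (rule smooth_curve_on_chart[OF assms(3,5) f(1) assms(2)])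
  have "velocity X \<A> ?c t = A (?c t)" if t: "t \<in> I" for t
  proof -
    have sm': "smooth_curve_near_0 X \<A> (\<lambda>s. ?c (t + s))"
      by (rule smooth_curve_shift[OF sm assms(3) t])
    have U: "?c t \<in> U" "\<phi> (?c t) = f t" using f(1)[OF t] by (auto intro: inv_into_into f_inv_into_f)
    obtain e where e: "e > 0" "ball t e \<subseteq> I" using openE[OF assms(3) t] by blast
    have "t + s \<in> I" if "\<bar>s\<bar> < e" for s
      using e(2) that by (auto simp: dist_real_def subset_eq)
    then have ev: "\<forall>\<^sub>F s in nhds 0. \<phi> (?c (t + s)) = f (t + s)"
      using eventually_abs_le_nhds_0[OF e(1)] by (auto elim!: eventually_mono intro!: f_inv_into_f f(1))
    have "flat 1 (\<lambda>s. f (t + s) - f t - s *\<^sub>R F (f t))"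
      using f(2)[OF t] by (simp only: flat_has_vector_derivative_iff)
    \<comment> \<open>The form \<open>t + 0\<close> is the value at 0 of the shifted curve, as
      \<open>kjet_1_eq_line_iff\<close> expects it.\<close>
    then have "flat 1 (\<lambda>s. \<phi> (?c (t + s)) - \<phi> (?c (t + 0)) - s *\<^sub>R F (f t))"
      by (rule flat_cong_imp) (use ev U(2) in \<open>auto elim: eventually_mono\<close>)
    then have "kjet X \<A> 1 (\<lambda>s. ?c (t + s)) = kjet X \<A> 1 (\<lambda>s. inv_into U \<phi> (\<phi> (?c (t + 0)) + s *\<^sub>R F (f t)))"
      by (subst kjet_1_eq_line_iff[OF assms(2) sm']) (use U in auto)
    then show ?thesis using assms(1) U unfolding velocity_def vf_rep_def by simp
  qed
  then show ?thesis using sm assms(3,4) unfolding integral_curve_def by blast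
qed

text \<open>Near \<open>t0\<close> both curves stay in a coordinate ball on which the field is
  Lipschitz; \<open>ode_growth\<close> with zero initial value and zero error makes their difference
  vanish.\<close>

lemma integral_curve_local_unique:
  assumes "smooth_vector_field X \<A> A" "integral_curve X \<A> A I c" "integral_curve X \<A> A I' c'"
    and "t0 \<in> I" "t0 \<in> I'" "c t0 = c' t0"
  shows "\<exists>d>0. \<forall>t. \<bar>t - t0\<bar> < d \<longrightarrow> c t = c' t"
proof -
  have I: "open I" "open I'" "smooth_curve_on X \<A> I c" "smooth_curve_on X \<A> I' c'"
    using assms by (auto simp: integral_curve_def)
  obtain U \<phi> where U: "(U, \<phi>) \<in> \<A>" "c t0 \<in> U"
    using chart_exists smooth_curve_on_topspace[OF I(3) assms(4)] by blast
  obtain F where F: "vf_rep A U \<phi> F" using vf_rep_exists assms(1) U(1) by blast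
  have "Ck_on 1 (\<phi> ` U) F" using F unfolding vf_rep_def smooth_on_def by blast
  from Ck_on_1_lipschitz[OF chart_image_open[OF U(1)] this imageI[OF U(2)]]
  obtain R K where R: "R > 0" "K \<ge> 0" "\<And>y z. y \<in> ball (\<phi> (c t0)) R \<Longrightarrow> z \<in> ball (\<phi> (c t0)) R \<Longrightarrow>
      norm (F z - F y) \<le> K * norm (z - y)" by blast
  have ev: "\<forall>\<^sub>F s in nhds 0. t0 + s \<in> J \<and> a (t0 + s) \<in> U \<and> dist (\<phi> (a (t0 + s))) (\<phi> (c t0)) < R"
    if J: "open J" "smooth_curve_on X \<A> J a" "t0 \<in> J" "a t0 = c t0" for J a
  proof (intro eventually_conj)
    have sm: "smooth_curve_near_0 X \<A> (\<lambda>s. a (t0 + s))" by (rule smooth_curve_shift[OF J(2,1,3)])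
    show "\<forall>\<^sub>F s in nhds 0. a (t0 + s) \<in> U"
      using smooth_near_0_chart_tendsto(1)[OF sm U(1)] J(4) U(2) by simp
    show "\<forall>\<^sub>F s in nhds 0. dist (\<phi> (a (t0 + s))) (\<phi> (c t0)) < R"
      using tendstoD[OF smooth_near_0_chart_tendsto(2)[OF sm U(1)] R(1)] J(4) U(2) by simp
    obtain e where e: "e > 0" "ball t0 e \<subseteq> J" using openE[OF J(1,3)] by blast
    show "\<forall>\<^sub>F s in nhds 0. t0 + s \<in> J"
      using eventually_abs_le_nhds_0[OF e(1)] e(2) by (auto elim!: eventually_mono simp: dist_real_def subset_eq)
  qed
  obtain d1 where d1: "d1 > 0" "\<And>s. \<bar>s\<bar> < d1 \<Longrightarrow>
      (t0 + s \<in> I \<and> c (t0 + s) \<in> U \<and> dist (\<phi> (c (t0 + s))) (\<phi> (c t0)) < R) \<and>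
      (t0 + s \<in> I' \<and> c' (t0 + s) \<in> U \<and> dist (\<phi> (c' (t0 + s))) (\<phi> (c t0)) < R)"
    using eventually_conj[OF ev[OF I(1,3) assms(4) refl] ev[OF I(2,4) assms(5) assms(6)[symmetric]]]
    unfolding eventually_nhds_metric dist_real_def by auto
  define d where "d = min d1 (1 / (2 * (K + 1)))"
  have d: "d > 0" "d \<le> d1" using d1(1) R(2) by (auto simp: d_def)
  have Kd: "K * d \<le> 3/4"
  proof -
    have "K * d \<le> (K + 1) * (1 / (2 * (K + 1)))" using R(2) d by (intro mult_mono) (auto simp: d_def)
    then show ?thesis using mult_divide_double[of "K + 1" 1] R(2) by linarith
  qed
  have "c (t0 + s) = c' (t0 + s)" if s: "\<bar>s\<bar> < d" for s
  proof -
    let ?z = "\<lambda>s. \<phi> (c (t0 + s)) - \<phi> (c' (t0 + s))"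
    have "norm (?z s) \<le> 4 * (norm (?z 0) + d * 0)"
    proof (rule ode_growth[where T = "{-d<..<d}"])
      fix s assume "s \<in> {-d<..<d}"
      then have s: "\<bar>s\<bar> < d1" "\<bar>s\<bar> \<le> d" using d(2) by auto
      note D = d1(2)[OF s(1)]
      show "(?z has_vector_derivative F (\<phi> (c (t0 + s))) - F (\<phi> (c' (t0 + s)))) (at s within {-d<..<d})"
        using integral_curve_chart_derivative[OF assms(2) F U(1)] integral_curve_chart_derivative[OF assms(3) F U(1)] D
        by (intro has_vector_derivative_at_within[OF has_vector_derivative_diff]
            iffD2[OF has_vector_derivative_shift[where f = "\<lambda>t. \<phi> (c t)"]]
            iffD2[OF has_vector_derivative_shift[where f = "\<lambda>t. \<phi> (c' t)"]]) blast+
      show "norm (F (\<phi> (c (t0 + s))) - F (\<phi> (c' (t0 + s)))) \<le> K * norm (?z s) + 0"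
        using R(3)[of "\<phi> (c' (t0 + s))" "\<phi> (c (t0 + s))"] D by (simp add: dist_commute)
      show "\<bar>s\<bar> \<le> d" by fact
    qed (use s d R(2) Kd in auto)
    then have "\<phi> (c (t0 + s)) = \<phi> (c' (t0 + s))" using assms(6) by simp
    moreover have "c (t0 + s) \<in> U" "c' (t0 + s) \<in> U" using d1(2)[of s] s d(2) by auto
    ultimately show ?thesis using chart_inj[OF U(1)] by (simp add: inj_on_eq_iff)
  qed
  from this[of "t - t0" for t] show ?thesis using d(1) by auto
qed

text \<open>A connectedness argument on the common interval: agreement is open by local uniqueness,
  disagreement is open by the Hausdorff property.\<close>

lemma integral_curve_unique:
  assumes A: "smooth_vector_field X \<A> A" and c: "integral_curve X \<A> A I c" "integral_curve X \<A> A I' c'"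
    and "0 \<in> I" "0 \<in> I'" "s \<in> I" "s \<in> I'" "c 0 = c' 0"
  shows "c s = c' s"
proof (rule ccontr)
  assume ne: "c s \<noteq> c' s"
  have I: "open I" "open I'" "smooth_curve_on X \<A> I c" "smooth_curve_on X \<A> I' c'" "is_interval I" "is_interval I'"
    using c by (auto simp: integral_curve_def)
  let ?E = "{t \<in> I \<inter> I'. c t = c' t}" and ?N = "{t \<in> I \<inter> I'. c t \<noteq> c' t}"
  have "open ?E"
    unfolding open_dist
  proof
    fix t assume t: "t \<in> ?E"
    obtain d where d: "d > 0" "\<And>t'. \<bar>t' - t\<bar> < d \<Longrightarrow> c t' = c' t'"
      using integral_curve_local_unique[OF A c, of t] t by auto
    obtain e where e: "e > 0" "ball t e \<subseteq> I \<inter> I'"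
      using openE[OF open_Int[OF I(1,2)], of t] t by auto
    show "\<exists>e>0. \<forall>y. dist y t < e \<longrightarrow> y \<in> ?E"
      using d e by (intro exI[of _ "min d e"]) (auto simp: dist_real_def subset_eq abs_minus_commute)
  qed
  moreover have "open ?N"
  proof (subst open_subopen, intro ballI)
    fix t assume t: "t \<in> ?N"
    then have "c t \<in> topspace X" "c' t \<in> topspace X"
      using smooth_curve_on_topspace I(3,4) by auto
    moreover have "Hausdorff_space X" using smooth_mfd by (simp add: smooth_manifold_def)
    ultimately obtain P Q where PQ: "openin X P" "openin X Q" "c t \<in> P" "c' t \<in> Q" "disjnt P Q"
      using t unfolding Hausdorff_space_def by blast
    have o: "open {r \<in> J. a r \<in> P}" if "smooth_curve_on X \<A> J a" "open J" "openin X P" for J a P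
    proof -
      have "openin (top_of_set J) {r \<in> topspace (top_of_set J). a r \<in> P}"
        using that by (intro openin_continuous_map_preimage) (auto simp: smooth_curve_on_def)
      then show ?thesis using openin_open_trans that(2) by fastforce
    qed
    let ?T = "{r \<in> I. c r \<in> P} \<inter> {r \<in> I'. c' r \<in> Q}"
    have "open ?T" using o[OF I(3,1) PQ(1)] o[OF I(4,2) PQ(2)] by (rule open_Int)
    moreover have "t \<in> ?T" "?T \<subseteq> ?N" using t PQ by (auto simp: disjnt_def)
    ultimately show "\<exists>T. open T \<and> t \<in> T \<and> T \<subseteq> ?N" by blast
  qed
  moreover have "connected (I \<inter> I')"
    using I(5,6) by (simp add: is_interval_Int is_interval_connected)
  moreover have "0 \<in> ?E" "s \<in> ?N" using assms ne by auto
  ultimately show False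
    using connectedD[of "I \<inter> I'" ?E ?N] by blast
qed

lemma flow_eqI:
  assumes "smooth_vector_field X \<A> A" "flow_reaches X \<A> A s x y"
  shows "flow X \<A> A s x = y"
  unfolding flow_def
proof (rule the_equality)
  show "flow_reaches X \<A> A s x y" by fact
next
  fix z assume z: "flow_reaches X \<A> A s x z"
  obtain I c where c: "integral_curve X \<A> A I c" "0 \<in> I" "s \<in> I" "c 0 = x" "c s = y"
    using assms(2) unfolding flow_reaches_def by blast
  obtain I' c' where c': "integral_curve X \<A> A I' c'" "0 \<in> I'" "s \<in> I'" "c' 0 = x" "c' s = z"
    using z unfolding flow_reaches_def by blast
  show "z = y"
    using integral_curve_unique[OF assms(1) c(1) c'(1) c(2) c'(2) c(3) c'(3)] c c' by simp
qed

text \<open>One \<open>d\<close> works for all starting points in \<open>W\<close>. Composites need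
  this, since the starting point of a later flow moves with \<open>t\<close>.\<close>

lemma flow_chart:
  assumes A: "smooth_vector_field X \<A> A" and F: "vf_rep A U \<phi> F" and U: "(U, \<phi>) \<in> \<A>" "x \<in> U"
  obtains d W u where "d > 0" "open W" "\<phi> x \<in> W" "W \<subseteq> \<phi> ` U" "smooth_on (W \<times> {-d<..<d}) u"
    "\<And>y. y \<in> W \<Longrightarrow> u (y, 0) = y"
    "\<And>y s. y \<in> W \<Longrightarrow> \<bar>s\<bar> < d \<Longrightarrow> u (y, s) \<in> \<phi> ` U"
    "\<And>y s. y \<in> W \<Longrightarrow> \<bar>s\<bar> < d \<Longrightarrow> ((\<lambda>s. u (y, s)) has_vector_derivative F (u (y, s))) (at s)"
    "\<And>y s. y \<in> W \<Longrightarrow> \<bar>s\<bar> < d \<Longrightarrow> flow_reaches X \<A> A s (inv_into U \<phi> y) (inv_into U \<phi> (u (y, s)))"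
proof -
  have "smooth_on (\<phi> ` U) F" using F by (simp add: vf_rep_def)
  from smooth_local_flow[OF chart_image_open[OF U(1)] this imageI[OF U(2)]]
  obtain d W u where u: "d > 0" "open W" "\<phi> x \<in> W" "W \<subseteq> \<phi> ` U" "smooth_on (W \<times> {-d<..<d}) u"
    "\<And>y. y \<in> W \<Longrightarrow> u (y, 0) = y"
    and u': "\<And>y s. y \<in> W \<Longrightarrow> s \<in> {-d<..<d} \<Longrightarrow> u (y, s) \<in> \<phi> ` U"
    "\<And>y s. y \<in> W \<Longrightarrow> s \<in> {-d<..<d} \<Longrightarrow> ((\<lambda>s. u (y, s)) has_vector_derivative F (u (y, s))) (at s)"
    by blast
  have abs: "s \<in> {-d<..<d}" if "\<bar>s\<bar> < d" for s using that by auto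
  show thesis
  proof (rule that[OF u])
    fix y s assume y: "y \<in> W" and s: "\<bar>s\<bar> < d"
    show "u (y, s) \<in> \<phi> ` U" "((\<lambda>s. u (y, s)) has_vector_derivative F (u (y, s))) (at s)"
      using u'[OF y abs[OF s]] by auto
    have "smooth_on {-d<..<d} (\<lambda>s. u (y, s))"
      by (rule smooth_on_compose[OF _ u(5)])
         (auto intro!: smooth_on_Pair smooth_on_const smooth_on_ident open_Times u(2) y)
    then have "integral_curve X \<A> A {-d<..<d} (\<lambda>s. inv_into U \<phi> (u (y, s)))"
      by (intro integral_curve_chartI[OF F U(1)] u' y) (auto simp: is_interval_oo)
    then show "flow_reaches X \<A> A s (inv_into U \<phi> y) (inv_into U \<phi> (u (y, s)))"
      unfolding flow_reaches_def using u(1,6) y abs[OF s]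
      by (intro exI[of _ "{-d<..<d}"] exI[of _ "\<lambda>s. inv_into U \<phi> (u (y, s))"]) auto
  qed assumption+
qed

section \<open>Composites of flows\<close>

lemma flow_composite_snoc:
  "flow_composite X \<A> (As @ [A]) t x = flow X \<A> A (t ^ Suc (length As)) (flow_composite X \<A> As t x)"
proof -
  have "fold (\<lambda>i. flow X \<A> ((As @ [A]) ! (i - 1)) (t ^ i)) [1..<Suc (length As)] x =
      fold (\<lambda>i. flow X \<A> (As ! (i - 1)) (t ^ i)) [1..<Suc (length As)] x"
    by (rule fold_cong) (auto simp: nth_append fun_eq_iff)
  then show ?thesis
    by (simp add: flow_composite_def nth_append del: power_Suc)
qed

lemma flow_composite_Nil: "flow_composite X \<A> [] t x = x"
  by (simp add: flow_composite_def)

lemma flow_composite_defined_snoc: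
  "flow_composite_defined X \<A> (As @ [A]) t x \<longleftrightarrow> flow_composite_defined X \<A> As t x \<and>
    flow_defined X \<A> A (t ^ Suc (length As)) (flow_composite X \<A> As t x)"
proof -
  have "{1..length (As @ [A])} = insert (Suc (length As)) {1..length As}" by auto
  moreover have "(As @ [A]) ! (i - 1) = As ! (i - 1)" "take (i - 1) (As @ [A]) = take (i - 1) As"
    if "i \<in> {1..length As}" for i
    using that by (auto simp: nth_append)
  ultimately show ?thesis
    by (auto simp: flow_composite_defined_def nth_append simp del: power_Suc)
qed

text \<open>Joint smoothness in the starting point and \<open>t\<close> is established because the
  Taylor coefficients of the composite must later depend smoothly on the starting point.\<close>

lemma flow_composite_chart:
  assumes "\<forall>A\<in>set As. smooth_vector_field X \<A> A" and U: "(U, \<phi>) \<in> \<A>" "x \<in> U"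
  shows "\<exists>d>0. \<exists>W u. open W \<and> \<phi> x \<in> W \<and> W \<subseteq> \<phi> ` U \<and> smooth_on (W \<times> {-d<..<d}) u \<and>
    (\<forall>y\<in>W. u (y, 0) = y) \<and>
    (\<forall>y\<in>W. \<forall>t\<in>{-d<..<d}. u (y, t) \<in> \<phi> ` U \<and> flow_composite_defined X \<A> As t (inv_into U \<phi> y) \<and>
      flow_composite X \<A> As t (inv_into U \<phi> y) = inv_into U \<phi> (u (y, t)))"
  using assms(1)
proof (induction As rule: rev_induct)
  case Nil
  have "smooth_on (\<phi> ` U \<times> {-1<..<1::real}) fst"
    by (intro smooth_on_bounded_linear bounded_linear_fst open_Times chart_image_open[OF U(1)]) auto
  then show ?case
    using chart_image_open[OF U(1)] U(2)
    by (intro exI[of _ 1] conjI exI[of _ "\<phi> ` U"] exI[of _ fst])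
       (auto simp: flow_composite_Nil flow_composite_defined_def)
next
  case (snoc A As)
  obtain d1 W1 u1 where 1: "d1 > 0" "open W1" "\<phi> x \<in> W1" "W1 \<subseteq> \<phi> ` U" "smooth_on (W1 \<times> {-d1<..<d1}) u1"
    "\<And>y. y \<in> W1 \<Longrightarrow> u1 (y, 0) = y"
    "\<And>y t. y \<in> W1 \<Longrightarrow> t \<in> {-d1<..<d1} \<Longrightarrow> u1 (y, t) \<in> \<phi> ` U \<and> flow_composite_defined X \<A> As t (inv_into U \<phi> y) \<and>
      flow_composite X \<A> As t (inv_into U \<phi> y) = inv_into U \<phi> (u1 (y, t))"
    using snoc by force
  have A: "smooth_vector_field X \<A> A" using snoc.prems by simp
  obtain F where F: "vf_rep A U \<phi> F" using vf_rep_exists[OF A U(1)] .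
  obtain d2 W2 u2 where 2: "d2 > 0" "open W2" "\<phi> x \<in> W2" "W2 \<subseteq> \<phi> ` U" "smooth_on (W2 \<times> {-d2<..<d2}) u2"
    "\<And>y. y \<in> W2 \<Longrightarrow> u2 (y, 0) = y"
    "\<And>y s. y \<in> W2 \<Longrightarrow> \<bar>s\<bar> < d2 \<Longrightarrow> u2 (y, s) \<in> \<phi> ` U"
    "\<And>y s. y \<in> W2 \<Longrightarrow> \<bar>s\<bar> < d2 \<Longrightarrow> flow_reaches X \<A> A s (inv_into U \<phi> y) (inv_into U \<phi> (u2 (y, s)))"
    using flow_chart[OF A F U] by metis
  \<comment> \<open>The earlier composite must land where the local flow of the new field is
    available. This is an open condition that holds at time 0, so it holds on a product
    neighbourhood.\<close>
  have "open ((W1 \<times> {-d1<..<d1}) \<inter> u1 -` W2)"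
    using continuous_on_open_vimage[of "W1 \<times> {-d1<..<d1}" u1] smooth_on_imp_continuous_on[OF 1(5)] 1(2) 2(2)
    by (metis Int_commute open_Times open_greaterThanLessThan)
  moreover have "(\<phi> x, 0) \<in> (W1 \<times> {-d1<..<d1}) \<inter> u1 -` W2" using 1 2 by auto
  ultimately obtain W T where WT: "open W" "open T" "(\<phi> x, 0::real) \<in> W \<times> T"
    "W \<times> T \<subseteq> (W1 \<times> {-d1<..<d1}) \<inter> u1 -` W2"
    using open_prod_elim by metis
  obtain d3 where d3: "d3 > 0" "ball 0 d3 \<subseteq> T" using openE[OF WT(2)] WT(3) by auto
  \<comment> \<open>The bound by 1 gives \<open>\<bar>t ^ j\<bar> \<le> \<bar>t\<bar>\<close> for
    \<open>j \<ge> 1\<close>, so \<open>d2\<close> also bounds the flow time.\<close>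
  define d where "d = min d3 (min d2 1)"
  have d: "d > 0" "d \<le> d2" "d \<le> 1" using d3(1) 2(1) by (auto simp: d_def)
  have WT': "y \<in> W1" "t \<in> {-d1<..<d1}" "u1 (y, t) \<in> W2" if "y \<in> W" "t \<in> {-d<..<d}" for y t
  proof -
    have "t \<in> T" using that(2) d3(2) by (auto simp: d_def dist_real_def subset_eq)
    then show "y \<in> W1" "t \<in> {-d1<..<d1}" "u1 (y, t) \<in> W2" using that(1) WT(4) by auto
  qed
  let ?j = "Suc (length As)"
  have tj: "\<bar>t ^ ?j\<bar> < d2" if "t \<in> {-d<..<d}" for t
  proof -
    have t: "\<bar>t\<bar> < d" using that by auto
    have "\<bar>t ^ ?j\<bar> \<le> \<bar>t\<bar> ^ 1"
      unfolding power_abs using t d(3) by (intro power_decreasing) auto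
    then show ?thesis using t d(2) by simp
  qed
  have zero: "0 \<in> {-d<..<d}" using d(1) by simp
  let ?u = "\<lambda>p. u2 (u1 p, snd p ^ ?j)"
  have "smooth_on (W \<times> {-d<..<d}) ?u"
  proof (rule smooth_on_compose[OF _ 2(5)])
    have o: "open (W \<times> {-d<..<d})" using WT(1) by (auto intro: open_Times)
    then show "open (W \<times> {-d<..<d})" .
    show "smooth_on (W \<times> {-d<..<d}) (\<lambda>p. (u1 p, snd p ^ ?j))"
      by (intro smooth_on_Pair smooth_on_power o smooth_on_bounded_linear bounded_linear_snd
          smooth_on_subset[OF 1(5)]) (use WT' in auto)
    show "(u1 p, snd p ^ ?j) \<in> W2 \<times> {-d2<..<d2}" if "p \<in> W \<times> {-d<..<d}" for p
      using that WT'(3) tj[of "snd p"] by (auto simp del: power_Suc)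
  qed (use 2(2) in \<open>auto intro: open_Times\<close>)
  moreover have "W \<subseteq> \<phi> ` U" using WT'(1) zero 1(4) by blast
  moreover have "\<phi> x \<in> W" using WT(3) by simp
  moreover have "?u (y, 0) = y" if "y \<in> W" for y
    using WT'[OF that zero] 1(6) 2(6) by (metis fst_conv snd_conv power_0_Suc)
  moreover have "?u (y, t) \<in> \<phi> ` U \<and> flow_composite_defined X \<A> (As @ [A]) t (inv_into U \<phi> y) \<and>
      flow_composite X \<A> (As @ [A]) t (inv_into U \<phi> y) = inv_into U \<phi> (?u (y, t))"
    if yt: "y \<in> W" "t \<in> {-d<..<d}" for y t
  proof -
    note w = WT'[OF yt]
    have r: "flow_reaches X \<A> A (t ^ ?j) (inv_into U \<phi> (u1 (y, t))) (inv_into U \<phi> (u2 (u1 (y, t), t ^ ?j)))"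
      by (rule 2(8)[OF w(3) tj[OF yt(2)]])
    then show ?thesis
      using 1(7)[OF w(1,2)] 2(7)[OF w(3) tj[OF yt(2)]] flow_eqI[OF A r]
      by (auto simp: flow_composite_snoc flow_composite_defined_snoc flow_defined_def simp del: power_Suc)
  qed
  ultimately show ?case
    using WT(1) d(1) by (intro exI[of _ d] conjI exI[of _ W] exI[of _ ?u] ballI) auto
qed

lemma flow_composite_at_0:
  assumes "\<forall>A\<in>set As. smooth_vector_field X \<A> A" "x \<in> topspace X"
  shows "smooth_curve_near_0 X \<A> (\<lambda>t. flow_composite X \<A> As t x)"
    and "flow_composite X \<A> As 0 x = x"
    and "\<forall>\<^sub>F t in nhds 0. flow_composite_defined X \<A> As t x"
proof -
  obtain U \<phi> where U: "(U, \<phi>) \<in> \<A>" "x \<in> U" using chart_exists assms(2) by blast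
  obtain d W u where u: "d > 0" "open W" "\<phi> x \<in> W" "W \<subseteq> \<phi> ` U" "smooth_on (W \<times> {-d<..<d}) u"
    "\<And>y. y \<in> W \<Longrightarrow> u (y, 0) = y"
    "\<And>y t. y \<in> W \<Longrightarrow> t \<in> {-d<..<d} \<Longrightarrow> u (y, t) \<in> \<phi> ` U \<and> flow_composite_defined X \<A> As t (inv_into U \<phi> y) \<and>
      flow_composite X \<A> As t (inv_into U \<phi> y) = inv_into U \<phi> (u (y, t))"
    using flow_composite_chart[OF assms(1) U] by force
  have inv: "inv_into U \<phi> (\<phi> x) = x" using U by simp
  have eq: "u (\<phi> x, t) \<in> \<phi> ` U" "flow_composite_defined X \<A> As t x"
    "flow_composite X \<A> As t x = inv_into U \<phi> (u (\<phi> x, t))" if "t \<in> {-d<..<d}" for t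
    using u(7)[OF u(3) that] inv by auto
  have "smooth_on {-d<..<d} (\<lambda>t. u (\<phi> x, t))"
    by (rule smooth_on_compose[OF _ u(5)])
       (auto intro!: smooth_on_Pair smooth_on_const smooth_on_ident open_Times u(2,3))
  then have "smooth_curve_on X \<A> {-d<..<d} (\<lambda>t. inv_into U \<phi> (u (\<phi> x, t)))"
    using eq(1) by (intro smooth_curve_on_chart[OF _ _ _ U(1)]) auto
  then have "smooth_curve_on X \<A> {-d<..<d} (\<lambda>t. flow_composite X \<A> As t x)"
    by (rule smooth_curve_on_cong) (use eq(3) in auto)
  then show "smooth_curve_near_0 X \<A> (\<lambda>t. flow_composite X \<A> As t x)"
    using u(1) by (auto simp: smooth_curve_near_0_def)
  show "flow_composite X \<A> As 0 x = x" using eq(3)[of 0] u(1,3,6) inv by simp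
  show "\<forall>\<^sub>F t in nhds 0. flow_composite_defined X \<A> As t x"
    using eventually_abs_le_nhds_0[OF u(1)] by eventually_elim (rule eq(2), auto)
qed

text \<open>The estimate \<open>u (y, s) = y + s F (\<phi> x) + o(s)\<close> is proved uniformly for
  \<open>y\<close> near \<open>\<phi> x\<close>. Only then are the moving start
  \<open>y = \<phi> (C t)\<close>, with \<open>C\<close> the earlier composite, and the time
  \<open>s = t ^ j\<close> inserted, so no expansion of the earlier composite is needed.\<close>

lemma flow_composite_snoc_flat:
  assumes As: "\<forall>A\<in>set (As @ [A]). smooth_vector_field X \<A> A"
    and F: "vf_rep A U \<phi> F" and U: "(U, \<phi>) \<in> \<A>" "x \<in> U"
  shows "flat (Suc (length As)) (\<lambda>t. \<phi> (flow_composite X \<A> (As @ [A]) t x) -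
    \<phi> (flow_composite X \<A> As t x) - t ^ Suc (length As) *\<^sub>R F (\<phi> x))"
  unfolding flat_def
proof (intro allI impI)
  fix e :: real assume "e > 0"
  let ?C = "\<lambda>t. flow_composite X \<A> As t x" and ?j = "Suc (length As)"
  have A: "smooth_vector_field X \<A> A" and As': "\<forall>A\<in>set As. smooth_vector_field X \<A> A" using As by auto
  have x: "x \<in> topspace X" using chart_subset U by blast
  obtain d W u where u: "d > 0" "open W" "\<phi> x \<in> W" "W \<subseteq> \<phi> ` U" "smooth_on (W \<times> {-d<..<d}) u"
    "\<And>y. y \<in> W \<Longrightarrow> u (y, 0) = y"
    "\<And>y s. y \<in> W \<Longrightarrow> \<bar>s\<bar> < d \<Longrightarrow> u (y, s) \<in> \<phi> ` U"
    "\<And>y s. y \<in> W \<Longrightarrow> \<bar>s\<bar> < d \<Longrightarrow> ((\<lambda>s. u (y, s)) has_vector_derivative F (u (y, s))) (at s)"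
    "\<And>y s. y \<in> W \<Longrightarrow> \<bar>s\<bar> < d \<Longrightarrow> flow_reaches X \<A> A s (inv_into U \<phi> y) (inv_into U \<phi> (u (y, s)))"
    by (rule flow_chart[OF A F U], rule that)
  have "continuous_on (W \<times> {-d<..<d}) (\<lambda>p. F (u p))"
    by (rule continuous_on_compose2[OF _ smooth_on_imp_continuous_on[OF u(5)], of "\<phi> ` U"])
       (use F u(7) in \<open>auto simp: vf_rep_def smooth_on_imp_continuous_on\<close>)
  then have "isCont (\<lambda>p. F (u p)) (\<phi> x, 0)"
    using u(1-3) by (simp add: continuous_on_eq_continuous_at open_Times)
  then obtain r where r: "r > 0" "\<And>p. dist p (\<phi> x, 0) < r \<Longrightarrow> dist (F (u p)) (F (u (\<phi> x, 0))) < e"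
    unfolding continuous_at_eps_delta using \<open>e > 0\<close> by blast
  \<comment> \<open>Half of \<open>r\<close> is reserved for the distance of \<open>y\<close> from
    \<open>\<phi> x\<close>, half for the time.\<close>
  define q where "q = min (r/2) d"
  have q: "q > 0" "q \<le> d" "q \<le> r/2" using r(1) u(1) by (auto simp: q_def)
  have est: "norm (u (y, s) - y - s *\<^sub>R F (\<phi> x)) \<le> e * \<bar>s\<bar>"
    if y: "y \<in> W" "dist y (\<phi> x) < r/2" and s: "\<bar>s\<bar> < q" for y s
  proof -
    let ?z = "\<lambda>s. u (y, s) - s *\<^sub>R F (\<phi> x)"
    have "norm (?z s - ?z 0) \<le> e * \<bar>s - 0\<bar>"
    proof (rule vector_derivative_bound[where T = "{-q<..<q}"])
      fix t assume "t \<in> {-q<..<q}"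
      then have t: "\<bar>t\<bar> < d" "\<bar>t\<bar> < r/2" using q by auto
      have "((\<lambda>s. s *\<^sub>R F (\<phi> x)) has_vector_derivative F (\<phi> x)) (at t)"
        by (auto simp: has_vector_derivative_def intro!: derivative_eq_intros)
      then show "(?z has_vector_derivative F (u (y, t)) - F (\<phi> x)) (at t within {-q<..<q})"
        by (intro has_vector_derivative_at_within[OF has_vector_derivative_diff] u(8) y t)
      have "dist (y, t) (\<phi> x, 0) \<le> dist y (\<phi> x) + \<bar>t\<bar>"
        unfolding dist_Pair_Pair using sqrt_sum_squares_le_sum_abs[of "dist y (\<phi> x)" "dist t 0"]
        by (simp add: dist_real_def)
      also have "\<dots> < r" using y(2) t(2) by linarith
      finally show "norm (F (u (y, t)) - F (\<phi> x)) \<le> e"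
        using r(2)[of "(y, t)"] u(3,6) by (simp add: dist_norm)
    qed (use q s in auto)
    then show ?thesis using u(6)[OF y(1)] by (simp add: algebra_simps)
  qed
  have C: "smooth_curve_near_0 X \<A> ?C" "?C 0 = x"
    using flow_composite_at_0[OF As' x] by auto
  then have C0: "?C 0 \<in> U" using U by simp
  have ev: "\<forall>\<^sub>F t in nhds 0. ?C t \<in> U" "((\<lambda>t. \<phi> (?C t)) \<longlongrightarrow> \<phi> x) (nhds 0)"
    using smooth_near_0_chart_tendsto[OF C(1) U(1) C0] C(2) by auto
  have "\<forall>\<^sub>F t in nhds 0. \<phi> (?C t) \<in> W" using topological_tendstoD[OF ev(2) u(2,3)] .
  moreover have "\<forall>\<^sub>F t in nhds 0. dist (\<phi> (?C t)) (\<phi> x) < r/2"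
    by (rule tendstoD[OF ev(2) half_gt_zero[OF r(1)]])
  moreover have "\<forall>\<^sub>F t::real in nhds 0. \<bar>t\<bar> < min 1 q"
    using q(1) by (intro eventually_abs_le_nhds_0) auto
  ultimately show "\<forall>\<^sub>F t in nhds 0. norm (\<phi> (flow_composite X \<A> (As @ [A]) t x) - \<phi> (?C t) - t ^ ?j *\<^sub>R F (\<phi> x)) \<le> e * \<bar>t\<bar> ^ ?j"
    using ev(1)
  proof eventually_elim
    case (elim t)
    have "\<bar>t ^ ?j\<bar> \<le> \<bar>t\<bar> ^ 1"
      unfolding power_abs using elim(3) by (intro power_decreasing) auto
    then have tj: "\<bar>t ^ ?j\<bar> < q" "\<bar>t ^ ?j\<bar> < d" using elim(3) q by auto
    have "flow_reaches X \<A> A (t ^ ?j) (?C t) (inv_into U \<phi> (u (\<phi> (?C t), t ^ ?j)))"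
      using u(9)[OF elim(1) tj(2)] elim(4) U(1) by simp
    then have "flow_composite X \<A> (As @ [A]) t x = inv_into U \<phi> (u (\<phi> (?C t), t ^ ?j))"
      unfolding flow_composite_snoc by (rule flow_eqI[OF A])
    then have "\<phi> (flow_composite X \<A> (As @ [A]) t x) = u (\<phi> (?C t), t ^ ?j)"
      using f_inv_into_f[OF u(7)[OF elim(1) tj(2)]] by simp
    then show ?case
      using est[OF elim(1,2) tj(1)] by (simp add: power_abs del: power_Suc)
  qed
qed

end

section \<open>Families of jets\<close>

text \<open>The coefficient functions, which are only asserted to exist for each chart, are fixed
  here. Different charts are linked only through the common jet \<open>J x\<close>.\<close>

locale jet_family = smooth_mfd X \<A>
  for X :: "'a topology" and \<A> :: "('a, 'b::{real_inner, heine_borel}) chart set" +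
  fixes k :: nat and J :: "'a \<Rightarrow> (real \<Rightarrow> 'a) set"
    and a :: "'a set \<Rightarrow> ('a \<Rightarrow> 'b) \<Rightarrow> nat \<Rightarrow> 'b \<Rightarrow> 'b"
  assumes a_smooth: "(U, \<phi>) \<in> \<A> \<Longrightarrow> i \<in> {1..k} \<Longrightarrow> smooth_on (\<phi> ` U) (a U \<phi> i)"
    and J_eq: "(U, \<phi>) \<in> \<A> \<Longrightarrow> x \<in> U \<Longrightarrow>
      J x = kjet X \<A> k (\<lambda>t. inv_into U \<phi> (\<phi> x + (\<Sum>i=1..k. t ^ i *\<^sub>R a U \<phi> i (\<phi> x))))"
begin

definition jet_poly :: "'a set \<Rightarrow> ('a \<Rightarrow> 'b) \<Rightarrow> 'a \<Rightarrow> real \<Rightarrow> 'b" where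
  "jet_poly U \<phi> x t = \<phi> x + (\<Sum>i=1..k. t ^ i *\<^sub>R a U \<phi> i (\<phi> x))"

abbreviation jet_curve :: "'a set \<Rightarrow> ('a \<Rightarrow> 'b) \<Rightarrow> 'a \<Rightarrow> real \<Rightarrow> 'a" where
  "jet_curve U \<phi> x t \<equiv> inv_into U \<phi> (jet_poly U \<phi> x t)"

section \<open>The given jets as polynomial curves in charts\<close>

lemma jet_poly_0 [simp]: "jet_poly U \<phi> x 0 = \<phi> x"
  by (simp add: jet_poly_def power_0_left sum.neutral)

lemma jet_curve_smooth:
  assumes "(U, \<phi>) \<in> \<A>" "x \<in> U"
  shows "smooth_curve_near_0 X \<A> (jet_curve U \<phi> x)"
    and "\<forall>\<^sub>F t in nhds 0. \<phi> (jet_curve U \<phi> x t) = jet_poly U \<phi> x t"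
proof -
  have "smooth_on {-1<..<1} (jet_poly U \<phi> x)"
    unfolding jet_poly_def
    by (intro smooth_on_add smooth_on_sum smooth_on_scaleR smooth_on_const smooth_on_power smooth_on_ident) auto
  from smooth_near_0_inv_chart[OF assms(1) zero_less_one this] assms(2)
  show "smooth_curve_near_0 X \<A> (jet_curve U \<phi> x)"
    and "\<forall>\<^sub>F t in nhds 0. \<phi> (jet_curve U \<phi> x t) = jet_poly U \<phi> x t" by auto
qed

lemma J_eq_iff_flat:
  assumes "(U, \<phi>) \<in> \<A>" "x \<in> U" "smooth_curve_near_0 X \<A> c" "c 0 = x"
  shows "J x = kjet X \<A> k c \<longleftrightarrow> flat k (\<lambda>t. \<phi> (c t) - jet_poly U \<phi> x t)"
proof -
  have "J x = kjet X \<A> k c \<longleftrightarrow> kjet X \<A> k c = kjet X \<A> k (jet_curve U \<phi> x)"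
    using J_eq[OF assms(1,2)] by (auto simp: jet_poly_def)
  also have "\<dots> \<longleftrightarrow> flat k (\<lambda>t. \<phi> (c t) - \<phi> (jet_curve U \<phi> x t))"
    using assms by (intro kjet_eq_iff_flat jet_curve_smooth) auto
  also have "\<dots> \<longleftrightarrow> flat k (\<lambda>t. \<phi> (c t) - jet_poly U \<phi> x t)"
    by (rule flat_cong) (use jet_curve_smooth(2)[OF assms(1,2)] in \<open>auto elim: eventually_mono\<close>)
  finally show ?thesis .
qed

text \<open>The required identity for the \<open>j\<close>-jet in place of the \<open>k\<close>-jet.
  Stating it by remainders in charts avoids forming the truncated families of jets.\<close>

definition agree :: "nat \<Rightarrow> ('a \<Rightarrow> (real \<Rightarrow> 'a) set) list \<Rightarrow> bool" where
  "agree j As \<longleftrightarrow> length As = j \<and> (\<forall>A\<in>set As. smooth_vector_field X \<A> A) \<and>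
    (\<forall>U \<phi>. (U, \<phi>) \<in> \<A> \<longrightarrow> (\<forall>x\<in>U. flat j (\<lambda>t. \<phi> (flow_composite X \<A> As t x) - jet_poly U \<phi> x t)))"

text \<open>For smooth vector fields, definedness near 0 and smoothness of the composite hold
  automatically by \<open>flow_composite_at_0\<close>; the equality of jets is the flatness
  condition in charts.\<close>

lemma agree_iff:
  "agree k As \<longleftrightarrow> length As = k \<and> (\<forall>A\<in>set As. smooth_vector_field X \<A> A) \<and>
    (\<forall>x\<in>topspace X. (\<forall>\<^sub>F t in nhds 0. flow_composite_defined X \<A> As t x) \<and>
       smooth_curve_near_0 X \<A> (\<lambda>t. flow_composite X \<A> As t x) \<and>
       J x = kjet X \<A> k (\<lambda>t. flow_composite X \<A> As t x))"
proof (cases "\<forall>A\<in>set As. smooth_vector_field X \<A> A")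
  case True
  have iff: "J x = kjet X \<A> k (\<lambda>t. flow_composite X \<A> As t x) \<longleftrightarrow>
      flat k (\<lambda>t. \<phi> (flow_composite X \<A> As t x) - jet_poly U \<phi> x t)"
    if "(U, \<phi>) \<in> \<A>" "x \<in> U" for U \<phi> x
    using that chart_subset[OF that(1)] by (intro J_eq_iff_flat flow_composite_at_0[OF True]) auto
  have "(\<forall>x\<in>topspace X. J x = kjet X \<A> k (\<lambda>t. flow_composite X \<A> As t x)) \<longleftrightarrow>
      (\<forall>U \<phi>. (U, \<phi>) \<in> \<A> \<longrightarrow> (\<forall>x\<in>U. flat k (\<lambda>t. \<phi> (flow_composite X \<A> As t x) - jet_poly U \<phi> x t)))"
    (is "?L \<longleftrightarrow> ?R")
  proof
    assume ?L
    then show ?R using iff chart_subset by blast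
  next
    assume R: ?R
    show ?L
    proof
      fix x assume "x \<in> topspace X"
      then obtain U \<phi> where "(U, \<phi>) \<in> \<A>" "x \<in> U" by (rule chart_exists)
      with R iff show "J x = kjet X \<A> k (\<lambda>t. flow_composite X \<A> As t x)" by blast
    qed
  qed
  moreover have "(\<forall>x\<in>topspace X. (\<forall>\<^sub>F t in nhds 0. flow_composite_defined X \<A> As t x) \<and>
       smooth_curve_near_0 X \<A> (\<lambda>t. flow_composite X \<A> As t x) \<and>
       J x = kjet X \<A> k (\<lambda>t. flow_composite X \<A> As t x)) \<longleftrightarrow> ?L"
    using flow_composite_at_0(1,3)[OF True] by (intro ball_cong refl) simp
  ultimately show ?thesis
    unfolding agree_def by (simp only:)
qed (auto simp: agree_def)

lemma agree_flat:
  "agree j As \<Longrightarrow> (U, \<phi>) \<in> \<A> \<Longrightarrow> x \<in> U \<Longrightarrow>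
    flat j (\<lambda>t. \<phi> (flow_composite X \<A> As t x) - jet_poly U \<phi> x t)"
  by (simp add: agree_def)

text \<open>Up to \<open>o(t ^ j)\<close> the last flow adds exactly
  \<open>t ^ j F (\<phi> x)\<close>, so matching at order \<open>j\<close>, the new length, is a
  condition on the value of the last field at \<open>x\<close> alone.\<close>

lemma agree_snoc_iff:
  assumes As: "\<forall>A\<in>set (As @ [A]). smooth_vector_field X \<A> A"
    and F: "vf_rep A U \<phi> F" and U: "(U, \<phi>) \<in> \<A>" "x \<in> U"
  shows "flat (Suc (length As)) (\<lambda>t. \<phi> (flow_composite X \<A> (As @ [A]) t x) - jet_poly U \<phi> x t) \<longleftrightarrow>
    flat (Suc (length As)) (\<lambda>t. jet_poly U \<phi> x t - \<phi> (flow_composite X \<A> As t x) -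
      t ^ Suc (length As) *\<^sub>R F (\<phi> x))"
    (is "flat ?j ?f \<longleftrightarrow> flat ?j ?g")
proof -
  note s = flow_composite_snoc_flat[OF As F U]
  show ?thesis
  proof
    assume "flat ?j ?f"
    from flat_diff[OF s this] show "flat ?j ?g" by (simp add: algebra_simps del: power_Suc)
  next
    assume "flat ?j ?g"
    from flat_diff[OF s this] show "flat ?j ?f" by (simp add: algebra_simps del: power_Suc)
  qed
qed

text \<open>The last flow moves the curve only by \<open>O(t ^ Suc j)\<close>, so the orders up to
  \<open>j\<close> are already matched without it. This makes induction on the length possible for
  uniqueness.\<close>

lemma agree_butlast:
  assumes "agree (Suc j) (As @ [A])"
  shows "agree j As"
  unfolding agree_def
proof (intro conjI allI impI ballI)
  show len: "length As = j" using assms by (simp add: agree_def)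
  have As: "\<forall>A\<in>set (As @ [A]). smooth_vector_field X \<A> A"
    using assms unfolding agree_def by blast
  then show "smooth_vector_field X \<A> B" if "B \<in> set As" for B using that by simp
  fix U \<phi> x assume U: "(U, \<phi>) \<in> \<A>" "x \<in> U"
  obtain F where F: "vf_rep A U \<phi> F" using vf_rep_exists[OF _ U(1)] As by auto
  have "flat (Suc j) (\<lambda>t. jet_poly U \<phi> x t - \<phi> (flow_composite X \<A> As t x) - t ^ Suc j *\<^sub>R F (\<phi> x))"
    by (rule iffD1[OF agree_snoc_iff[OF As F U, unfolded len] agree_flat[OF assms U]])
  then have "flat j (\<lambda>t. jet_poly U \<phi> x t - \<phi> (flow_composite X \<A> As t x) - t ^ Suc j *\<^sub>R F (\<phi> x))"
    by (rule flat_mono) simp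
  from flat_uminus[OF flat_add[OF this flat_power[OF lessI, where c = "F (\<phi> x)"]]]
  show "flat j (\<lambda>t. \<phi> (flow_composite X \<A> As t x) - jet_poly U \<phi> x t)" by (simp del: power_Suc)
qed

text \<open>Both fields are the coefficient of \<open>t ^ Suc j\<close> of the same defect in each
  chart; extensionality turns agreement on the manifold into equality.\<close>

lemma agree_last_unique:
  assumes "agree (Suc j) (As @ [A])" "agree (Suc j) (As @ [B])"
  shows "A = B"
proof (rule extensionalityI)
  have As: "\<forall>A\<in>set (As @ [A]). smooth_vector_field X \<A> A" "\<forall>A\<in>set (As @ [B]). smooth_vector_field X \<A> A"
    and len: "length As = j"
    using assms unfolding agree_def by auto
  then show "A \<in> extensional (topspace X)" "B \<in> extensional (topspace X)"
    by (auto simp: smooth_vector_field_def)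
  fix x assume "x \<in> topspace X"
  then obtain U \<phi> where U: "(U, \<phi>) \<in> \<A>" "x \<in> U" by (rule chart_exists)
  obtain F where F: "vf_rep A U \<phi> F" using vf_rep_exists[OF _ U(1)] As by auto
  obtain G where G: "vf_rep B U \<phi> G" using vf_rep_exists[OF _ U(1)] As by auto
  have "flat (Suc j) (\<lambda>t. jet_poly U \<phi> x t - \<phi> (flow_composite X \<A> As t x) - t ^ Suc j *\<^sub>R F (\<phi> x))"
    "flat (Suc j) (\<lambda>t. jet_poly U \<phi> x t - \<phi> (flow_composite X \<A> As t x) - t ^ Suc j *\<^sub>R G (\<phi> x))"
    using iffD1[OF agree_snoc_iff[OF As(1) F U, unfolded len] agree_flat[OF assms(1) U]]
      iffD1[OF agree_snoc_iff[OF As(2) G U, unfolded len] agree_flat[OF assms(2) U]] .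
  from flat_diff[OF this] have "flat (Suc j) (\<lambda>t. t ^ Suc j *\<^sub>R (G (\<phi> x) - F (\<phi> x)))"
    by (simp add: scaleR_diff_right)
  from flat_power_eq_0[OF this] have "G (\<phi> x) = F (\<phi> x)" by simp
  then show "A x = B x" using F G U(2) by (simp add: vf_rep_def)
qed

section \<open>Construction of the next vector field\<close>

lemma flat_jet_poly:
  assumes "j \<le> k"
  shows "flat j (\<lambda>t. jet_poly U \<phi> x t - (\<Sum>i\<le>j. t ^ i *\<^sub>R (if i = 0 then \<phi> x else a U \<phi> i (\<phi> x))))"
proof -
  \<comment> \<open>The family prescribes coefficients from index 1 on; the constant term is the
    base point.\<close>
  let ?b = "\<lambda>i. if i = 0 then \<phi> x else a U \<phi> i (\<phi> x)"
  have "jet_poly U \<phi> x t = (\<Sum>i\<le>k. t ^ i *\<^sub>R ?b i)" for t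
    unfolding jet_poly_def atMost_atLeast0 by (subst sum.atLeast_Suc_atMost) auto
  moreover have "(\<Sum>i\<le>k. t ^ i *\<^sub>R ?b i) = (\<Sum>i\<le>j. t ^ i *\<^sub>R ?b i) + (\<Sum>i\<in>{j<..k}. t ^ i *\<^sub>R ?b i)" for t
    using assms by (subst sum.union_disjoint[symmetric]) (auto intro!: sum.cong)
  moreover have "flat j (\<lambda>t. \<Sum>i\<in>{j<..k}. t ^ i *\<^sub>R ?b i)"
    by (intro flat_sum flat_power) auto
  ultimately show ?thesis by simp
qed

text \<open>The coordinate representation of the only possible next vector field.\<close>

definition leading :: "('a \<Rightarrow> (real \<Rightarrow> 'a) set) list \<Rightarrow> 'a set \<Rightarrow> ('a \<Rightarrow> 'b) \<Rightarrow> 'b \<Rightarrow> 'b" where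
  "leading As U \<phi> y = a U \<phi> (Suc (length As)) y -
    taylor_coeff (Suc (length As)) (\<lambda>t. \<phi> (flow_composite X \<A> As t (inv_into U \<phi> y)))"

text \<open>By uniqueness of expansions the coefficients up to \<open>j\<close> of the composite are
  those of the given jet, so only the terms of order \<open>Suc j\<close> survive in the
  difference.\<close>

lemma leading_flat:
  assumes ag: "agree j As" and jk: "j < k" and U: "(U, \<phi>) \<in> \<A>" "x \<in> U"
  shows "flat (Suc j) (\<lambda>t. jet_poly U \<phi> x t - \<phi> (flow_composite X \<A> As t x) - t ^ Suc j *\<^sub>R leading As U \<phi> (\<phi> x))"
proof -
  let ?f = "\<lambda>t. \<phi> (flow_composite X \<A> As t x)"
  let ?b = "\<lambda>i. if i = 0 then \<phi> x else a U \<phi> i (\<phi> x)"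
  have As: "\<forall>A\<in>set As. smooth_vector_field X \<A> A" "length As = j" using ag by (auto simp: agree_def)
  have x: "x \<in> topspace X" using chart_subset U by blast
  have "flow_composite X \<A> As 0 x \<in> U" using flow_composite_at_0(2)[OF As(1) x] U by simp
  from smooth_near_0_chartD[OF flow_composite_at_0(1)[OF As(1) x] U(1) this]
  obtain d where d: "d > 0" "smooth_on {-d<..<d} ?f" by blast
  have Ck: "Ck_on n {-d<..<d} ?f" for n using d(2) by (simp add: smooth_on_def)
  have zero: "0 \<in> {-d<..<d}" using d(1) by simp
  have "flat j (\<lambda>t. ?f t - jet_poly U \<phi> x t)" by (rule agree_flat[OF ag U])
  from flat_add[OF this flat_jet_poly[of j U \<phi> x]] jk
  have "flat j (\<lambda>t. ?f t - (\<Sum>i\<le>j. t ^ i *\<^sub>R ?b i))" by simp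
  then have c: "taylor_coeff i ?f = ?b i" if "i \<le> j" for i
    using taylor_coeff_unique[where c = ?b, OF open_greaterThanLessThan zero Ck _ that] by blast
  have "flat (Suc j) (\<lambda>t. (jet_poly U \<phi> x t - (\<Sum>i\<le>Suc j. t ^ i *\<^sub>R ?b i)) -
      (?f t - (\<Sum>i\<le>Suc j. t ^ i *\<^sub>R taylor_coeff i ?f)))"
    using jk by (intro flat_diff flat_jet_poly taylor_flat[OF open_greaterThanLessThan zero Ck]) simp
  moreover have "(\<Sum>i\<le>Suc j. t ^ i *\<^sub>R ?b i) - (\<Sum>i\<le>Suc j. t ^ i *\<^sub>R taylor_coeff i ?f) =
      t ^ Suc j *\<^sub>R leading As U \<phi> (\<phi> x)" for t :: real
  proof -
    have "(\<Sum>i\<le>j. t ^ i *\<^sub>R ?b i) = (\<Sum>i\<le>j. t ^ i *\<^sub>R taylor_coeff i ?f)"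
      by (rule sum.cong) (simp_all add: c)
    then show ?thesis
      using U by (simp add: leading_def As(2) scaleR_diff_right del: power_Suc)
  qed
  ultimately show ?thesis by (simp add: algebra_simps del: power_Suc sum.atMost_Suc)
qed

text \<open>Near each point the composite is a jointly smooth \<open>u\<close> in coordinates, and
  Taylor coefficients of \<open>u\<close> in \<open>t\<close> are smooth in
  \<open>y\<close>.\<close>

lemma leading_smooth:
  assumes As: "\<forall>A\<in>set As. smooth_vector_field X \<A> A" "length As < k" and U: "(U, \<phi>) \<in> \<A>"
  shows "smooth_on (\<phi> ` U) (leading As U \<phi>)"
proof (rule smooth_on_local)
  let ?j = "Suc (length As)"
  fix y0 assume "y0 \<in> \<phi> ` U"
  then obtain x where x: "x \<in> U" "y0 = \<phi> x" by blast
  obtain d W u where u: "d > 0" "open W" "\<phi> x \<in> W" "W \<subseteq> \<phi> ` U" "smooth_on (W \<times> {-d<..<d}) u"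
    "\<And>y t. y \<in> W \<Longrightarrow> t \<in> {-d<..<d} \<Longrightarrow> u (y, t) \<in> \<phi> ` U \<and>
      flow_composite X \<A> As t (inv_into U \<phi> y) = inv_into U \<phi> (u (y, t))"
    using flow_composite_chart[OF As(1) U x(1)] by force
  have "taylor_coeff ?j (\<lambda>t. \<phi> (flow_composite X \<A> As t (inv_into U \<phi> y))) = taylor_coeff ?j (\<lambda>t. u (y, t))"
    if y: "y \<in> W" for y
    by (rule taylor_coeff_cong[of "{-d<..<d}"]) (use u(1) u(6)[OF y] in \<open>auto simp: f_inv_into_f\<close>)
  then have "leading As U \<phi> y = a U \<phi> ?j y - taylor_coeff ?j (\<lambda>t. u (y, t))" if "y \<in> W" for y
    using that by (simp add: leading_def)
  moreover have "smooth_on W (\<lambda>y. a U \<phi> ?j y - taylor_coeff ?j (\<lambda>t. u (y, t)))"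
  proof (rule smooth_on_diff[OF u(2)])
    show "smooth_on W (a U \<phi> ?j)"
      by (rule smooth_on_subset[OF a_smooth[OF U] u(4)]) (use As(2) in auto)
    show "smooth_on W (\<lambda>y. taylor_coeff ?j (\<lambda>t. u (y, t)))"
      by (rule smooth_on_taylor_coeff[OF u(2,1,5)])
  qed
  ultimately have "smooth_on W (leading As U \<phi>)"
    using smooth_on_cong[OF u(2), of "leading As U \<phi>"] by simp
  then show "\<exists>T. open T \<and> y0 \<in> T \<and> smooth_on T (leading As U \<phi>)"
    using u(2,3) x(2) by blast
qed

text \<open>Both leading coefficients describe the order \<open>t ^ Suc j\<close> part of the difference of the same
  two curves, so they transform like tangent vectors.\<close>

lemma leading_chart_change:
  assumes ag: "agree j As" and jk: "j < k"
    and U: "(U, \<phi>) \<in> \<A>" "x \<in> U" and V: "(V, \<psi>) \<in> \<A>" "x \<in> V"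
  shows "kjet X \<A> 1 (\<lambda>t. inv_into U \<phi> (\<phi> x + t *\<^sub>R leading As U \<phi> (\<phi> x))) =
    kjet X \<A> 1 (\<lambda>t. inv_into V \<psi> (\<psi> x + t *\<^sub>R leading As V \<psi> (\<psi> x)))"
proof -
  let ?C = "\<lambda>t. flow_composite X \<A> As t x" and ?b = "leading As U \<phi> (\<phi> x)" and ?b' = "leading As V \<psi> (\<psi> x)"
  let ?D = "frechet_derivative (\<psi> \<circ> inv_into U \<phi>) (at (\<phi> x))"
  have As: "\<forall>A\<in>set As. smooth_vector_field X \<A> A" using ag by (auto simp: agree_def)
  have x: "x \<in> topspace X" using chart_subset U by blast
  \<comment> \<open>The polynomial is replaced by the curve it represents near 0, since the change
    of charts is formulated for curves in the manifold.\<close>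
  have "flat (Suc j) (\<lambda>t. \<phi> (jet_curve U \<phi> x t) - \<phi> (?C t) - t ^ Suc j *\<^sub>R ?b)"
    by (rule flat_cong_imp[OF leading_flat[OF ag jk U]])
       (use jet_curve_smooth(2)[OF U] in \<open>auto elim: eventually_mono\<close>)
  then have "flat (Suc j) (\<lambda>t. \<psi> (jet_curve U \<phi> x t) - \<psi> (?C t) - t ^ Suc j *\<^sub>R ?D ?b)"
    by (intro flat_chart_change_strict[OF U(1) V(1) jet_curve_smooth(1)[OF U] flow_composite_at_0(1)[OF As x]])
       (use U V flow_composite_at_0(2)[OF As x] in auto)
  moreover have "flat (Suc j) (\<lambda>t. \<psi> (jet_curve V \<psi> x t) - \<psi> (?C t) - t ^ Suc j *\<^sub>R ?b')"
    by (rule flat_cong_imp[OF leading_flat[OF ag jk V]])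
       (use jet_curve_smooth(2)[OF V] in \<open>auto elim: eventually_mono\<close>)
  ultimately have "flat (Suc j) (\<lambda>t. (\<psi> (jet_curve U \<phi> x t) - \<psi> (?C t) - t ^ Suc j *\<^sub>R ?D ?b) -
      (\<psi> (jet_curve V \<psi> x t) - \<psi> (?C t) - t ^ Suc j *\<^sub>R ?b'))"
    by (rule flat_diff)
  then have "flat (Suc j) (\<lambda>t. \<psi> (jet_curve U \<phi> x t) - \<psi> (jet_curve V \<psi> x t) - t ^ Suc j *\<^sub>R (?D ?b - ?b'))"
    by (simp add: algebra_simps del: power_Suc)
  \<comment> \<open>The two polynomial curves differ in general, but they represent the same jet
    \<open>J x\<close>, hence agree to order \<open>k \<ge> Suc j\<close>.\<close>
  moreover have "flat (Suc j) (\<lambda>t. \<psi> (jet_curve U \<phi> x t) - \<psi> (jet_curve V \<psi> x t))"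
  proof -
    have "kjet X \<A> k (jet_curve U \<phi> x) = kjet X \<A> k (jet_curve V \<psi> x)"
      unfolding jet_poly_def J_eq[OF U, symmetric] J_eq[OF V, symmetric] ..
    then have "flat k (\<lambda>t. \<psi> (jet_curve U \<phi> x t) - \<psi> (jet_curve V \<psi> x t))"
      using kjet_eq_iff_flat[OF V(1) jet_curve_smooth(1)[OF U] jet_curve_smooth(1)[OF V], of k] U V by simp
    then show ?thesis by (rule flat_mono) (use jk in simp)
  qed
  ultimately have "flat (Suc j) (\<lambda>t. (\<psi> (jet_curve U \<phi> x t) - \<psi> (jet_curve V \<psi> x t)) -
      (\<psi> (jet_curve U \<phi> x t) - \<psi> (jet_curve V \<psi> x t) - t ^ Suc j *\<^sub>R (?D ?b - ?b')))"
    by (rule flat_diff[rotated])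
  then have "flat (Suc j) (\<lambda>t. t ^ Suc j *\<^sub>R (?D ?b - ?b'))"
    by (simp del: power_Suc)
  from flat_power_eq_0[OF this] have b': "?D ?b = ?b'" by simp
  let ?l = "\<lambda>t. inv_into U \<phi> (\<phi> x + t *\<^sub>R ?b)"
  \<comment> \<open>Comparing the coordinate line with the constant curve at order 1 identifies its
    velocity in the second chart by the same transformation rule.\<close>
  have const: "smooth_curve_near_0 X \<A> (\<lambda>t. x)"
    by (rule smooth_near_0_chartI[OF U(1) zero_less_one]) (auto simp: U smooth_on_const)
  have "flat 1 (\<lambda>t. \<phi> (?l t) - \<phi> x - t ^ 1 *\<^sub>R ?b)"
    by (rule flat_cong_imp[OF flat_zero]) (use smooth_line(2)[OF U, of ?b] in \<open>auto elim: eventually_mono\<close>)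
  then have "flat 1 (\<lambda>t. \<psi> (?l t) - \<psi> x - t ^ 1 *\<^sub>R ?D ?b)"
    by (intro flat_chart_change_strict[OF U(1) V(1) smooth_line(1)[OF U] const]) (use U V in auto)
  then show ?thesis
    using kjet_1_eq_line_iff[OF V(1) smooth_line(1)[OF U], of ?b ?b'] U V by (simp add: b')
qed

lemma agree_extend:
  assumes ag: "agree j As" and jk: "j < k"
  shows "\<exists>A. agree (Suc j) (As @ [A])"
proof -
  have As: "\<forall>A\<in>set As. smooth_vector_field X \<A> A" and len: "length As = j" using ag by (auto simp: agree_def)
  let ?line = "\<lambda>U \<phi> x t. inv_into U \<phi> (\<phi> x + t *\<^sub>R leading As U \<phi> (\<phi> x))"
  \<comment> \<open>An arbitrary chart is chosen at each point; \<open>leading_chart_change\<close>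
    makes the value independent of it, and only then can smoothness be checked chart by
    chart.\<close>
  define A where "A = restrict (\<lambda>x. let c = SOME c. c \<in> \<A> \<and> x \<in> fst c
    in kjet X \<A> 1 (?line (fst c) (snd c) x)) (topspace X)"
  have A_eq: "A x = kjet X \<A> 1 (?line U \<phi> x)" if U: "(U, \<phi>) \<in> \<A>" "x \<in> U" for U \<phi> x
  proof -
    define c where "c = (SOME c. c \<in> \<A> \<and> x \<in> fst c)"
    have "\<exists>c. c \<in> \<A> \<and> x \<in> fst c" using U by force
    from someI_ex[OF this] have "(fst c, snd c) \<in> \<A>" "x \<in> fst c" by (auto simp: c_def)
    from leading_chart_change[OF ag jk this U] show ?thesis
      using chart_subset U by (auto simp: A_def c_def[symmetric])
  qed
  have sm: "smooth_on (\<phi> ` U) (leading As U \<phi>)" if "(U, \<phi>) \<in> \<A>" for U \<phi>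
    using leading_smooth[OF As _ that] jk len by simp
  have rep: "vf_rep A U \<phi> (leading As U \<phi>)" if "(U, \<phi>) \<in> \<A>" for U \<phi>
    using sm A_eq that by (simp add: vf_rep_def)
  have "smooth_vector_field X \<A> A"
    unfolding smooth_vector_field_def smooth_kjet_family_def
  proof (intro conjI ballI)
    show "A \<in> extensional (topspace X)" by (simp add: A_def)
    fix x assume "x \<in> topspace X"
    then obtain U \<phi> where U: "(U, \<phi>) \<in> \<A>" "x \<in> U" by (rule chart_exists)
    then show "\<exists>\<gamma>. smooth_curve_near_0 X \<A> \<gamma> \<and> \<gamma> 0 = x \<and> A x = kjet X \<A> 1 \<gamma>"
      using smooth_line(1)[OF U] A_eq[OF U] by (intro exI[of _ "?line U \<phi> x"]) auto
  next
    fix c assume c: "c \<in> \<A>"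
    obtain U \<phi> where "c = (U, \<phi>)" by (cases c)
    then show "case c of (U, \<phi>) \<Rightarrow> \<exists>b :: nat \<Rightarrow> 'b \<Rightarrow> 'b. (\<forall>i\<in>{1..1}. smooth_on (\<phi> ` U) (b i)) \<and>
        (\<forall>x\<in>U. A x = kjet X \<A> 1 (\<lambda>t. inv_into U \<phi> (\<phi> x + (\<Sum>i=1..1. t ^ i *\<^sub>R b i (\<phi> x)))))"
      using rep[of U \<phi>] c by (auto simp: vf_rep_def intro!: exI[of _ "\<lambda>_. leading As U \<phi>"])
  qed
  then have AsA: "\<forall>A\<in>set (As @ [A]). smooth_vector_field X \<A> A" using As by simp
  have "flat (Suc j) (\<lambda>t. \<phi> (flow_composite X \<A> (As @ [A]) t x) - jet_poly U \<phi> x t)"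
    if U: "(U, \<phi>) \<in> \<A>" "x \<in> U" for U \<phi> x
    using agree_snoc_iff[OF AsA rep[OF U(1)] U] leading_flat[OF ag jk U] unfolding len by blast
  then show ?thesis using AsA len unfolding agree_def by (intro exI[of _ A]) auto
qed

text \<open>Existence and uniqueness go through one induction: a competing list has the unique
  prefix by \<open>agree_butlast\<close>, and then the same last field.\<close>

lemma agree_ex1: "j \<le> k \<Longrightarrow> \<exists>!As. agree j As"
proof (induction j)
  case 0
  have "flat 0 (\<lambda>t. \<phi> x - jet_poly U \<phi> x t)" for U \<phi> x
    using flat_uminus[OF flat_jet_poly[of 0 U \<phi> x]] by simp
  then show ?case
    by (intro ex1I[of _ "[]"]) (auto simp: agree_def flow_composite_Nil)
next
  case (Suc j)
  then obtain As where As: "agree j As" "\<And>Bs. agree j Bs \<Longrightarrow> Bs = As" by auto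
  obtain A where A: "agree (Suc j) (As @ [A])" using agree_extend[OF As(1)] Suc.prems by auto
  show ?case
  proof (rule ex1I[of _ "As @ [A]"])
    show "agree (Suc j) (As @ [A])" by fact
    fix Bs assume Bs: "agree (Suc j) Bs"
    then have "Bs \<noteq> []" by (auto simp: agree_def)
    then obtain Cs B where Cs: "Bs = Cs @ [B]" by (metis append_butlast_last_id)
    then have "Cs = As" using As(2) agree_butlast Bs by blast
    then show "Bs = As @ [A]" using agree_last_unique A Bs Cs by blast
  qed
qed

end

theorem theorem2:
  fixes X :: "'a topology"
    and \<A> :: "('a, 'b::{real_inner, heine_borel}) chart set"
    and k :: nat
    and J :: "'a \<Rightarrow> (real \<Rightarrow> 'a) set"
  assumes "smooth_manifold X \<A>"
    and "k \<ge> 1"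
    and "smooth_kjet_family X \<A> k J"
  shows "\<exists>!As. length As = k \<and> (\<forall>A\<in>set As. smooth_vector_field X \<A> A) \<and>
    (\<forall>x\<in>topspace X.
       (\<forall>\<^sub>F t in nhds 0. flow_composite_defined X \<A> As t x) \<and>
       smooth_curve_near_0 X \<A> (\<lambda>t. flow_composite X \<A> As t x) \<and>
       J x = kjet X \<A> k (\<lambda>t. flow_composite X \<A> As t x))"
proof -
  \<comment> \<open>Charts are treated as single objects \<open>c\<close> so that the coefficients
    can be chosen for all of them at once.\<close>
  have "\<forall>c\<in>\<A>. \<exists>a :: nat \<Rightarrow> 'b \<Rightarrow> 'b. (\<forall>i\<in>{1..k}. smooth_on (snd c ` fst c) (a i)) \<and>
      (\<forall>x\<in>fst c. J x = kjet X \<A> k (\<lambda>t. inv_into (fst c) (snd c) (snd c x + (\<Sum>i=1..k. t ^ i *\<^sub>R a i (snd c x)))))"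
    using assms(3) unfolding smooth_kjet_family_def by (simp add: case_prod_beta)
  from bchoice[OF this] obtain a where a: "\<forall>c\<in>\<A>. (\<forall>i\<in>{1..k}. smooth_on (snd c ` fst c) (a c i)) \<and>
      (\<forall>x\<in>fst c. J x = kjet X \<A> k (\<lambda>t. inv_into (fst c) (snd c) (snd c x + (\<Sum>i=1..k. t ^ i *\<^sub>R a c i (snd c x)))))"
    by blast
  interpret jet_family X \<A> k J "\<lambda>U \<phi>. a (U, \<phi>)"
    by unfold_locales (use assms(1) a in force)+
  show ?thesis using agree_ex1[OF order_refl] unfolding agree_iff .
qed

end
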